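(* Let $N\ge1$, $1\le p<\infty$ and $0<s<1$ be such that $s\,p\le N$. There exists a threshold $0<\gamma_0=\gamma_0(N,p,s)\le1$ (equal to $1$ if $p=1$), namely the same threshold for which, for all $p\le q<p^*_s$ and $0<\gamma<\gamma_0$, there is a constant $\mathcal{C}=\mathcal{C}(N,p,s,q,\gamma)>0$ with $\lambda^s_{p,q}(\Omega)\le\mathcal{C}\,(1/R^s_{p,\gamma}(\Omega))^{sp-N+Np/q}$ for every open set $\Omega\subseteq\mathbb{R}^N$, such that the following holds. For every $p\le q<p^*_s$ and every open set $\Omega\subseteq\mathbb{R}^N$, $$\mathcal{D}^{s,p}_0(\Omega)\hookrightarrow L^q(\Omega)\quad\Longleftrightarrow\quad R^s_{p,\gamma}(\Omega)<\infty\ \text{ for some }0<\gamma<\gamma_0(N,p,s).$$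
   Context: $p^*_s=\frac{Np}{N-sp}$ if $sp<N$ and $p^*_s=\infty$ if $sp\ge N$. Write $[u]^p_{W^{s,p}(\mathbb{R}^N)}=\iint_{\mathbb{R}^N\times\mathbb{R}^N}\frac{|u(x)-u(y)|^p}{|x-y|^{N+sp}}\,dx\,dy$. For an open set $\Omega\subseteq\mathbb{R}^N$, $C^\infty_0(\Omega)$ is the set of smooth functions with compact support in $\Omega$ (extended by $0$), $\mathcal{D}^{s,p}_0(\Omega)$ is the completion of $C^\infty_0(\Omega)$ with respect to the norm $[\,\cdot\,]_{W^{s,p}(\mathbb{R}^N)}$, and $\mathcal{D}^{s,p}_0(\Omega)\hookrightarrow L^q(\Omega)$ denotes continuous embedding, which is equivalent to $\lambda^s_{p,q}(\Omega)>0$, where $$\lambda^s_{p,q}(\Omega)=\inf\{[u]^p_{W^{s,p}(\mathbb{R}^N)}:\ u\in C^\infty_0(\Omega),\ \|u\|_{L^q(\Omega)}=1\}.$$ For an open set $E$ and a compact set $\Sigma\subseteq E$, $\widetilde{\mathrm{cap}}_{s,p}(\Sigma;E)=\inf\{[\varphi]^p_{W^{s,p}(\mathbb{R}^N)}:\varphi\in C^\infty_0(E),\ \varphi\ge1\text{ on }\Sigma\}$. $B_r(x_0)$ is the open ball of centre $x_0$ and radius $r$. For $0<\gamma<1$, a compact set $\Sigma\subseteq\overline{B_r(x_0)}$ is $(s,p,\gamma)$-negligible if $\widetilde{\mathrm{cap}}_{s,p}(\Sigma;B_{2r}(x_0))\le\gamma\,\widetilde{\mathrm{cap}}_{s,p}(\overline{B_r(x_0)};B_{2r}(x_0))$.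 The fractional capacitary inradius is $$R^s_{p,\gamma}(\Omega)=\sup\{r>0:\ \exists\, B_r(x_0)\text{ such that }\overline{B_r(x_0)}\setminus\Omega\text{ is }(s,p,\gamma)\text{-negligible}\}\in(0,+\infty],$$ with $1/(+\infty)=0$. *)

theory Defs
  imports "HOL-Analysis.Analysis"
begin

text \<open>Real powers on \<open>[0,\<infinity>]\<close>; meant for exponents \<open>a > 0\<close>, so that \<open>0\<close> has power \<open>0\<close>
  and \<open>\<infinity>\<close> has power \<open>\<infinity>\<close>.\<close>

definition ennpowr :: "ennreal \<Rightarrow> real \<Rightarrow> ennreal" where
  "ennpowr x a = (if x = \<infinity> then \<infinity> else ennreal (enn2real x powr a))"

fun Ck :: "nat \<Rightarrow> ('a::euclidean_space \<Rightarrow> real) \<Rightarrow> bool" where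
  "Ck 0 f = continuous_on UNIV f"
| "Ck (Suc k) f = ((\<forall>x. f differentiable (at x)) \<and>
      (\<forall>i\<in>Basis. Ck k (\<lambda>x. frechet_derivative f (at x) i)))"

definition test_functions :: "'a::euclidean_space set \<Rightarrow> ('a \<Rightarrow> real) set" where
  "test_functions \<Omega> = {u. (\<forall>k. Ck k u) \<and> compact (closure {x. u x \<noteq> 0}) \<and>
      closure {x. u x \<noteq> 0} \<subseteq> \<Omega>}"

text \<open>The \<open>p\<close>-th power \<open>[u]\<^sup>p\<close> of the Gagliardo--Slobodeckii seminorm. On the (null) diagonal
  the integrand is \<open>0 / 0 = 0\<close>.\<close>

definition gagliardo :: "real \<Rightarrow> real \<Rightarrow> ('a::euclidean_space \<Rightarrow> real) \<Rightarrow> ennreal" where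
  "gagliardo s p u = (\<integral>\<^sup>+(x, y). ennreal (\<bar>u x - u y\<bar> powr p / norm (x - y) powr (real DIM('a) + s * p))
      \<partial>(lborel \<Otimes>\<^sub>M lborel))"

definition gagliardo_norm :: "real \<Rightarrow> real \<Rightarrow> ('a::euclidean_space \<Rightarrow> real) \<Rightarrow> ennreal" where
  "gagliardo_norm s p u = ennpowr (gagliardo s p u) (1 / p)"

definition Lq_norm :: "real \<Rightarrow> 'a::euclidean_space set \<Rightarrow> ('a \<Rightarrow> real) \<Rightarrow> ennreal" where
  "Lq_norm q \<Omega> f = ennpowr (\<integral>\<^sup>+x. ennreal (\<bar>f x\<bar> powr q) \<partial>lebesgue_on \<Omega>) (1 / q)"

text \<open>Functions, not classes: equality in \<open>L\<^sup>q\<close> is expressed by \<open>AE\<close> below.\<close>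

definition Lq_space :: "real \<Rightarrow> 'a::euclidean_space set \<Rightarrow> ('a \<Rightarrow> real) set" where
  "Lq_space q \<Omega> = {f. f \<in> borel_measurable (lebesgue_on \<Omega>) \<and> Lq_norm q \<Omega> f < \<infinity>}"

definition critical_exponent :: "nat \<Rightarrow> real \<Rightarrow> real \<Rightarrow> ereal" where
  "critical_exponent N s p =
     (if s * p < real N then ereal (real N * p / (real N - s * p)) else \<infinity>)"

text \<open>The completion of the test functions, as Cauchy sequences modulo null sequences.\<close>

definition D0_cauchy :: "real \<Rightarrow> real \<Rightarrow> 'a::euclidean_space set \<Rightarrow> (nat \<Rightarrow> 'a \<Rightarrow> real) set" where
  "D0_cauchy s p \<Omega> = {X. (\<forall>n. X n \<in> test_functions \<Omega>) \<and>
      (\<forall>\<epsilon>>0. \<exists>M. \<forall>m\<ge>M. \<forall>n\<ge>M. gagliardo_norm s p (\<lambda>x. X m x - X n x) < ennreal \<epsilon>)}"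

definition D0_class ::
  "real \<Rightarrow> real \<Rightarrow> 'a::euclidean_space set \<Rightarrow> (nat \<Rightarrow> 'a \<Rightarrow> real) \<Rightarrow> (nat \<Rightarrow> 'a \<Rightarrow> real) set" where
  "D0_class s p \<Omega> X = {Y \<in> D0_cauchy s p \<Omega>.
      (\<lambda>n. gagliardo_norm s p (\<lambda>x. X n x - Y n x)) \<longlonglongrightarrow> 0}"

definition D0_space :: "real \<Rightarrow> real \<Rightarrow> 'a::euclidean_space set \<Rightarrow> (nat \<Rightarrow> 'a \<Rightarrow> real) set set" where
  "D0_space s p \<Omega> = D0_class s p \<Omega> ` D0_cauchy s p \<Omega>"

definition D0_norm :: "real \<Rightarrow> real \<Rightarrow> (nat \<Rightarrow> 'a::euclidean_space \<Rightarrow> real) set \<Rightarrow> ennreal" where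
  "D0_norm s p \<xi> = (THE l. \<forall>X\<in>\<xi>. (\<lambda>n. gagliardo_norm s p (X n)) \<longlonglongrightarrow> l)"

text \<open>Continuous embedding of the completion into \<open>L\<^sup>q\<close>: a bounded linear injection
  that restricts to the inclusion on test functions (identified with the classes of constant
  sequences).\<close>

definition D0_embeds :: "real \<Rightarrow> real \<Rightarrow> real \<Rightarrow> 'a::euclidean_space set \<Rightarrow> bool" where
  "D0_embeds s p q \<Omega> \<longleftrightarrow> (\<exists>J :: (nat \<Rightarrow> 'a \<Rightarrow> real) set \<Rightarrow> 'a \<Rightarrow> real.
      (\<forall>\<xi>\<in>D0_space s p \<Omega>. J \<xi> \<in> Lq_space q \<Omega>) \<and>
      (\<forall>u\<in>test_functions \<Omega>. AE x in lebesgue_on \<Omega>. J (D0_class s p \<Omega> (\<lambda>_. u)) x = u x) \<and>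
      (\<forall>X\<in>D0_cauchy s p \<Omega>. \<forall>Y\<in>D0_cauchy s p \<Omega>. \<forall>a b.
         AE x in lebesgue_on \<Omega>. J (D0_class s p \<Omega> (\<lambda>n x. a * X n x + b * Y n x)) x
            = a * J (D0_class s p \<Omega> X) x + b * J (D0_class s p \<Omega> Y) x) \<and>
      (\<forall>\<xi>\<in>D0_space s p \<Omega>. \<forall>\<eta>\<in>D0_space s p \<Omega>.
         (AE x in lebesgue_on \<Omega>. J \<xi> x = J \<eta> x) \<longrightarrow> \<xi> = \<eta>) \<and>
      (\<exists>C::real. \<forall>\<xi>\<in>D0_space s p \<Omega>. Lq_norm q \<Omega> (J \<xi>) \<le> ennreal C * D0_norm s p \<xi>))"

definition lambda_spq :: "real \<Rightarrow> real \<Rightarrow> real \<Rightarrow> 'a::euclidean_space set \<Rightarrow> ennreal" where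
  "lambda_spq s p q \<Omega> = Inf {gagliardo s p u | u. u \<in> test_functions \<Omega> \<and> Lq_norm q \<Omega> u = 1}"

definition frac_cap :: "real \<Rightarrow> real \<Rightarrow> 'a::euclidean_space set \<Rightarrow> 'a set \<Rightarrow> ennreal" where
  "frac_cap s p \<Sigma> E = Inf {gagliardo s p \<phi> | \<phi>. \<phi> \<in> test_functions E \<and> (\<forall>x\<in>\<Sigma>. 1 \<le> \<phi> x)}"

definition cap_negligible ::
  "real \<Rightarrow> real \<Rightarrow> real \<Rightarrow> 'a::euclidean_space \<Rightarrow> real \<Rightarrow> 'a set \<Rightarrow> bool" where
  "cap_negligible s p \<gamma> x\<^sub>0 r \<Sigma> \<longleftrightarrow> compact \<Sigma> \<and> \<Sigma> \<subseteq> cball x\<^sub>0 r \<and>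
     frac_cap s p \<Sigma> (ball x\<^sub>0 (2 * r)) \<le> ennreal \<gamma> * frac_cap s p (cball x\<^sub>0 r) (ball x\<^sub>0 (2 * r))"

text \<open>For \<open>\<Omega> = {}\<close> the supremum is over the empty set and equals \<open>0\<close>.\<close>

definition cap_inradius :: "real \<Rightarrow> real \<Rightarrow> real \<Rightarrow> 'a::euclidean_space set \<Rightarrow> ennreal" where
  "cap_inradius s p \<gamma> \<Omega> =
     Sup {ennreal r | r. r > 0 \<and> (\<exists>x\<^sub>0. cap_negligible s p \<gamma> x\<^sub>0 r (cball x\<^sub>0 r - \<Omega>))}"

end

theory Submission
  imports Defs
begin

text \<open>The argument rests on three facts about the energy \<open>[u]\<^sup>p\<close>, each obtained by elementary means.

\<^emph>\<open>Finite inradius implies the inequality.\<close> Let \<open>r\<close> exceed the capacitary inradius. Then the part of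
every ball of radius \<open>r\<close> outside \<open>\<Omega>\<close> has capacity bounded below, uniformly in the centre. If \<open>u\<close> is
a test function of \<open>\<Omega>\<close> and \<open>a\<close> its average over the concentric ball of radius \<open>2 r\<close>, the cut-off
function \<open>1 - u / a\<close> equals \<open>1\<close> on that part and is thus admissible for its capacity; the fractional
Poincare inequality then bounds \<open>|a|\<^sup>p\<close> by the energy of \<open>u\<close> inside the larger ball
(\<open>ball_average_le_local_energy\<close>). Writing \<open>u\<close> as this average plus the differences of consecutive
averages over balls of radii \<open>2 r / 2 ^ k\<close> gives \<open>\<parallel>u\<parallel>\<^sub>q \<le> C [u]\<close> for all subcritical \<open>q\<close> at once,
including \<open>q = p\<close> (\<open>Lq_le_gagliardo_if_average_le\<close>). Instead of summing over a covering by balls, one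
integrates over all centres.

\<^emph>\<open>The inequality is equivalent to the embedding.\<close> Completeness of \<open>L\<^sup>q\<close> provides the limit of a
Cauchy sequence of test functions, and the inequality makes it independent of the sequence. The
resulting map is injective because the energy is lower semicontinuous under convergence almost
everywhere (\<open>embedding_inj\<close>).

\<^emph>\<open>The upper bound for \<open>\<lambda>\<close>.\<close> By scaling it suffices to consider the unit ball. Suppose that the part
of it outside \<open>\<Omega>\<close> is negligible, and let \<open>\<psi>\<close> be an almost optimal function for its capacity, with
values in \<open>[0, 1]\<close>. The function \<open>1 - \<psi>\<close>, cut off near the boundary of the ball, is a test function
of \<open>\<Omega>\<close> with controlled energy; it is a good competitor for \<open>\<lambda>\<close> unless \<open>\<psi>\<close> is nearly \<open>1\<close> on almost all
of the ball (\<open>competitor_from_deficit\<close>). For small \<open>\<gamma>\<close> this is excluded by the Poincare inequality,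
which suffices for \<open>p > 1\<close>, where the threshold may be small. For \<open>p = 1\<close> all \<open>\<gamma> < 1\<close> are required.
There the energy is submodular and satisfies a coarea formula, and these show that the energy of a
function which is nearly \<open>1\<close> on the ball is at least almost the capacity of the ball
(\<open>deficit_of_energy_below_capacity\<close>).

Hence, if the embedding holds, \<open>\<lambda>\<close> is positive and the upper bound forces the inradius to be finite,
for every \<open>\<gamma>\<close> below the threshold.\<close>

section \<open>Calculus of smooth functions\<close>

lemma Ck_SucI:
  fixes f :: "'a::euclidean_space \<Rightarrow> real"
  assumes "\<And>x. (f has_derivative f' x) (at x)"
    and "\<And>i. i \<in> Basis \<Longrightarrow> Ck k (\<lambda>x. f' x i)"
  shows "Ck (Suc k) f"
proof -
  have "frechet_derivative f (at x) = f' x" for x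
    using frechet_derivative_at[OF assms(1)] by simp
  then show ?thesis using assms by (auto simp: differentiable_def)
qed

lemma Ck_SucD:
  fixes f :: "'a::euclidean_space \<Rightarrow> real"
  assumes "Ck (Suc k) f"
  shows "(f has_derivative frechet_derivative f (at x)) (at x)"
    and "i \<in> Basis \<Longrightarrow> Ck k (\<lambda>x. frechet_derivative f (at x) i)"
  using assms frechet_derivative_works by auto

lemma Ck_Suc_imp_Ck: "Ck (Suc k) f \<Longrightarrow> Ck k f"
proof (induction k arbitrary: f)
  case 0
  then show ?case
    by (auto simp: continuous_on_eq_continuous_at intro: differentiable_imp_continuous_within)
next
  case (Suc k)
  show ?case
    by (rule Ck_SucI[OF Ck_SucD(1)[OF Suc.prems]]) (rule Suc.IH[OF Ck_SucD(2)[OF Suc.prems]])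
qed

lemma Ck_const: "Ck k (\<lambda>x. c)"
proof (induction k arbitrary: c)
  case (Suc k)
  show ?case by (rule Ck_SucI[where f'="\<lambda>x h. 0"]) (auto intro: Suc)
qed simp

lemma Ck_inner: "Ck k (\<lambda>x. x \<bullet> c)"
proof (cases k)
  case (Suc l)
  show ?thesis unfolding Suc
    by (rule Ck_SucI[where f'="\<lambda>x h. h \<bullet> c"]) (auto intro!: Ck_const derivative_eq_intros)
qed (auto intro: continuous_intros)

lemma Ck_add: "Ck k f \<Longrightarrow> Ck k g \<Longrightarrow> Ck k (\<lambda>x. f x + g x)"
proof (induction k arbitrary: f g)
  case (Suc k)
  show ?case
    by (rule Ck_SucI[OF has_derivative_add[OF Ck_SucD(1)[OF Suc.prems(1)] Ck_SucD(1)[OF Suc.prems(2)]]])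
       (rule Suc.IH[OF Ck_SucD(2)[OF Suc.prems(1)] Ck_SucD(2)[OF Suc.prems(2)]])
qed (auto intro: continuous_intros)

lemma Ck_mult: "Ck k f \<Longrightarrow> Ck k g \<Longrightarrow> Ck k (\<lambda>x. f x * g x)"
proof (induction k arbitrary: f g)
  case (Suc k)
  show ?case
    by (rule Ck_SucI[OF has_derivative_mult[OF Ck_SucD(1)[OF Suc.prems(1)] Ck_SucD(1)[OF Suc.prems(2)]]])
       (intro Ck_add Suc.IH Ck_Suc_imp_Ck[OF Suc.prems(1)] Ck_Suc_imp_Ck[OF Suc.prems(2)]
          Ck_SucD(2)[OF Suc.prems(1)] Ck_SucD(2)[OF Suc.prems(2)])
qed (auto intro: continuous_intros)

lemma Ck_cmult: "Ck k f \<Longrightarrow> Ck k (\<lambda>x. c * f x)"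
  by (rule Ck_mult[OF Ck_const])

lemma Ck_diff: "Ck k f \<Longrightarrow> Ck k g \<Longrightarrow> Ck k (\<lambda>x. f x - g x)"
  using Ck_add[OF _ Ck_cmult[of k g "-1"], of f] by simp

lemma Ck_sum: "finite I \<Longrightarrow> (\<And>i. i \<in> I \<Longrightarrow> Ck k (f i)) \<Longrightarrow> Ck k (\<lambda>x. \<Sum>i\<in>I. f i x)"
  by (induction I rule: finite_induct) (auto intro: Ck_add Ck_const)

lemma Ck_dist_square: "Ck k (\<lambda>x. (dist x c)\<^sup>2)"
proof -
  have "(dist x c)\<^sup>2 = (\<Sum>i\<in>Basis. (x \<bullet> i - c \<bullet> i) * (x \<bullet> i - c \<bullet> i))" for x
    unfolding dist_norm power2_norm_eq_inner by (subst euclidean_inner) (simp add: inner_diff_left)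
  then show ?thesis
    by (auto intro!: Ck_sum Ck_mult Ck_diff Ck_inner Ck_const)
qed

lemma Ck_inverse:
  assumes "Ck k f" "\<And>x. f x \<noteq> 0"
  shows "Ck k (\<lambda>x. inverse (f x))"
  using assms
proof (induction k arbitrary: f)
  case (Suc k)
  have inv: "Ck k (\<lambda>x. inverse (f x))"
    by (rule Suc.IH[OF Ck_Suc_imp_Ck[OF Suc.prems(1)] Suc.prems(2)])
  show ?case
  proof (rule Ck_SucI)
    show "((\<lambda>x. inverse (f x)) has_derivative
        (\<lambda>h. -1 * ((inverse (f x) * frechet_derivative f (at x) h) * inverse (f x)))) (at x)" for x
      using Deriv.has_derivative_inverse[OF Suc.prems(2) Ck_SucD(1)[OF Suc.prems(1)], of x] by simp
    show "Ck k (\<lambda>x. -1 * ((inverse (f x) * frechet_derivative f (at x) i) * inverse (f x)))"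
      if "i \<in> Basis" for i
      by (intro Ck_mult Ck_const inv Ck_SucD(2)[OF Suc.prems(1) that])
  qed
qed (auto intro: continuous_intros)

text \<open>The derivative of the root contains the reciprocal of the root, which is differentiated once less;
  this makes the induction work.\<close>

lemma Ck_sqrt:
  assumes "Ck k f" "\<And>x. f x > 0"
  shows "Ck k (\<lambda>x. sqrt (f x))"
  using assms
proof (induction k arbitrary: f)
  case (Suc k)
  have pos: "sqrt (f x) \<noteq> 0" for x using Suc.prems(2)[of x] by simp
  have inv: "Ck k (\<lambda>x. inverse (sqrt (f x)))"
    by (rule Ck_inverse[OF Suc.IH[OF Ck_Suc_imp_Ck[OF Suc.prems(1)] Suc.prems(2)] pos])
  show ?case
  proof (rule Ck_SucI)
    show "((\<lambda>x. sqrt (f x)) has_derivative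
        (\<lambda>h. (1/2) * (frechet_derivative f (at x) h * inverse (sqrt (f x))))) (at x)" for x
      by (rule has_derivative_eq_rhs[OF
            has_derivative_real_sqrt[OF Suc.prems(2) Ck_SucD(1)[OF Suc.prems(1)]]])
         (auto simp: field_simps)
    show "Ck k (\<lambda>x. (1/2) * (frechet_derivative f (at x) i * inverse (sqrt (f x))))"
      if "i \<in> Basis" for i
      by (intro Ck_mult Ck_const inv Ck_SucD(2)[OF Suc.prems(1) that])
  qed
qed (auto intro: continuous_intros)

lemma Ck_affine:
  assumes "Ck k f"
  shows "Ck k (\<lambda>x. f (c *\<^sub>R x + a))"
  using assms
proof (induction k arbitrary: f)
  case 0
  then have "continuous_on UNIV f" by (simp only: Ck.simps)
  then have "continuous_on UNIV (\<lambda>x. f (c *\<^sub>R x + a))"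
    by (rule continuous_on_compose2) (intro continuous_intros subset_UNIV)+
  then show ?case by (simp only: Ck.simps)
next
  case (Suc k)
  show ?case
  proof (rule Ck_SucI)
    show "((\<lambda>x. f (c *\<^sub>R x + a)) has_derivative
        (\<lambda>h. c * frechet_derivative f (at (c *\<^sub>R x + a)) h)) (at x)" for x
    proof -
      note D = Ck_SucD(1)[OF Suc.prems, of "c *\<^sub>R x + a"]
      have 1: "((\<lambda>x. c *\<^sub>R x + a) has_derivative (\<lambda>h. c *\<^sub>R h)) (at x)"
        by (auto intro!: derivative_eq_intros)
      have 2: "(\<lambda>h. frechet_derivative f (at (c *\<^sub>R x + a)) (c *\<^sub>R h))
          = (\<lambda>h. c * frechet_derivative f (at (c *\<^sub>R x + a)) h)"
        using linear_cmul[OF has_derivative_linear[OF D]] by (simp only: real_scaleR_def)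
      show ?thesis
        using has_derivative_compose[OF 1 D] unfolding 2 .
    qed
    show "Ck k (\<lambda>x. c * frechet_derivative f (at (c *\<^sub>R x + a)) i)" if "i \<in> Basis" for i
      by (rule Ck_cmult[OF Suc.IH[OF Ck_SucD(2)[OF Suc.prems that]]])
  qed
qed

text \<open>The functions \<open>exp (-d / t) / t ^ n\<close>, extended by \<open>0\<close> to \<open>t \<le> 0\<close>, are mapped by
  differentiation to combinations of functions of the same shape; all orders \<open>n\<close> are therefore
  treated together.\<close>

definition flat_exp :: "real \<Rightarrow> nat \<Rightarrow> real \<Rightarrow> real" where
  "flat_exp d n t = (if t > 0 then exp (- d / t) / t ^ n else 0)"

lemma flat_exp_nonneg: "0 \<le> flat_exp d n t"
  by (simp add: flat_exp_def)

lemma flat_exp_le_square: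
  assumes "d > 0"
  shows "\<bar>flat_exp d n t\<bar> \<le> fact (n + 2) / d ^ (n + 2) * t\<^sup>2"
proof (cases "t > 0")
  case True
  \<comment> \<open>one term of the exponential series of \<open>d / t\<close>\<close>
  have "(d / t) ^ (n + 2) / fact (n + 2) = (\<Sum>i\<in>{n + 2}. (d / t) ^ i /\<^sub>R fact i)"
    by (simp add: divide_inverse mult.commute)
  also have "\<dots> \<le> (\<Sum>i. (d / t) ^ i /\<^sub>R fact i)"
    by (rule sum_le_suminf[OF summable_exp_generic]) (use True assms in auto)
  finally have "(d / t) ^ (n + 2) / fact (n + 2) \<le> exp (d / t)"
    by (simp only: exp_def)
  then have "inverse (exp (d / t)) \<le> inverse ((d / t) ^ (n + 2) / fact (n + 2))"
    by (rule le_imp_inverse_le) (use True assms in \<open>intro divide_pos_pos zero_less_power fact_gt_zero; simp\<close>)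
  then have "exp (- d / t) / t ^ n \<le> inverse ((d / t) ^ (n + 2) / fact (n + 2)) / t ^ n"
    using True by (intro divide_right_mono) (auto simp: exp_minus)
  also have "\<dots> = fact (n + 2) / d ^ (n + 2) * (t ^ (n + 2) / t ^ n)"
    by (simp only: inverse_divide power_divide divide_divide_eq_left divide_divide_eq_right
        times_divide_eq_right times_divide_eq_left mult.commute)
  also have "t ^ (n + 2) / t ^ n = t\<^sup>2"
    using True by (simp only: power_add) simp
  finally show ?thesis
    using True unfolding flat_exp_def by (simp only: if_True abs_of_nonneg divide_nonneg_nonneg exp_ge_zero zero_le_power less_imp_le)
next
  case False
  have "0 \<le> fact (n + 2) / d ^ (n + 2) * t\<^sup>2"
    by (intro mult_nonneg_nonneg divide_nonneg_nonneg fact_ge_zero zero_le_power zero_le_power2)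
       (use assms in simp)
  then show ?thesis using False by (simp only: flat_exp_def if_False abs_zero)
qed

lemma flat_exp_has_derivative:
  assumes "d > 0"
  shows "(flat_exp d n has_real_derivative d * flat_exp d (n + 2) t - n * flat_exp d (n + 1) t) (at t)"
proof -
  consider "t > 0" | "t < 0" | "t = 0" by linarith
  then show ?thesis
  proof cases
    case 1
    have "((\<lambda>t. exp (- d / t) / t ^ n) has_real_derivative
        d * flat_exp d (n + 2) t - n * flat_exp d (n + 1) t) (at t)"
      using 1
    proof -
      have tn: "n * t ^ (n - 1) * t = n * t ^ n" by (cases n) auto
      have "((\<lambda>t. exp (- d / t) / t ^ n) has_real_derivative
          (exp (- d / t) * (d / (t * t)) * t ^ n - exp (- d / t) * (n * t ^ (n - 1))) / (t ^ n * t ^ n)) (at t)"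
        by (rule DERIV_divide) (use 1 in \<open>auto intro!: derivative_eq_intros\<close>)
      also have "(exp (- d / t) * (d / (t * t)) * t ^ n - exp (- d / t) * (n * t ^ (n - 1))) / (t ^ n * t ^ n)
          = exp (- d / t) * (d / (t * t)) * t ^ n / (t ^ n * t ^ n)
            - exp (- d / t) * (n * t ^ (n - 1)) / (t ^ n * t ^ n)"
        by (rule diff_divide_distrib)
      also have "exp (- d / t) * (d / (t * t)) * t ^ n / (t ^ n * t ^ n) = d * flat_exp d (n + 2) t"
        using 1 by (simp add: flat_exp_def power_add power2_eq_square)
      also have "exp (- d / t) * (n * t ^ (n - 1)) / (t ^ n * t ^ n)
          = exp (- d / t) * (n * t ^ (n - 1) * t) / (t ^ n * t ^ n * t)"
        using 1 by simp
      also have "\<dots> = n * flat_exp d (n + 1) t"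
        unfolding tn using 1 by (simp add: flat_exp_def mult.commute)
      finally show ?thesis .
    qed
    then show ?thesis
      by (rule has_field_derivative_transform_within[where d=t])
         (use 1 in \<open>auto simp: flat_exp_def dist_real_def\<close>)
  next
    case 2
    have "((\<lambda>t. 0) has_real_derivative d * flat_exp d (n + 2) t - n * flat_exp d (n + 1) t) (at t)"
      using 2 by (simp add: flat_exp_def)
    then show ?thesis
      by (rule has_field_derivative_transform_within[where d="-t"])
         (use 2 in \<open>auto simp: flat_exp_def dist_real_def\<close>)
  next
    case 3
    define C where "C = fact (n + 2) / d ^ (n + 2)"
    have f0: "flat_exp d m 0 = 0" for m by (simp add: flat_exp_def)
    have "((\<lambda>h. (flat_exp d n (0 + h) - flat_exp d n 0) / h) \<longlongrightarrow> 0) (at 0)"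
    proof (rule Lim_null_comparison)
      show "eventually (\<lambda>h. norm ((flat_exp d n (0 + h) - flat_exp d n 0) / h) \<le> C * \<bar>h\<bar>) (at 0)"
      proof (rule eventually_at_topological[THEN iffD2], intro exI[of _ UNIV] conjI ballI impI)
        fix h :: real assume "h \<noteq> 0"
        have "\<bar>flat_exp d n h\<bar> \<le> C * (\<bar>h\<bar> * \<bar>h\<bar>)"
          using flat_exp_le_square[OF assms, of n h] unfolding C_def
          by (simp only: abs_mult_self_eq power2_eq_square)
        then have "\<bar>flat_exp d n h\<bar> / \<bar>h\<bar> \<le> C * \<bar>h\<bar>"
          using \<open>h \<noteq> 0\<close> by (simp add: pos_divide_le_eq mult.assoc)
        then show "norm ((flat_exp d n (0 + h) - flat_exp d n 0) / h) \<le> C * \<bar>h\<bar>"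
          by (simp add: f0)
      qed auto
      show "((\<lambda>h. C * \<bar>h\<bar>) \<longlongrightarrow> 0) (at 0)"
        by (auto intro!: tendsto_eq_intros)
    qed
    then show ?thesis using 3 by (simp add: DERIV_def f0)
  qed
qed

lemma Ck_flat_exp:
  assumes "d > 0" "\<And>k. Ck k u"
  shows "Ck k (\<lambda>x. flat_exp d n (u x))"
proof (induction k arbitrary: n)
  case 0
  have "continuous_on UNIV (flat_exp d n)"
    by (rule continuous_at_imp_continuous_on)
       (use DERIV_isCont[OF flat_exp_has_derivative[OF assms(1)]] in blast)
  moreover have "continuous_on UNIV u"
    using assms(2)[of 0] by (simp only: Ck.simps)
  ultimately have "continuous_on UNIV (\<lambda>x. flat_exp d n (u x))"
    by (rule continuous_on_compose2) (rule subset_UNIV)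
  then show ?case by (simp only: Ck.simps)
next
  case (Suc k)
  show ?case
  proof (rule Ck_SucI)
    show "((\<lambda>x. flat_exp d n (u x)) has_derivative
       (\<lambda>h. (d * flat_exp d (n + 2) (u x) - n * flat_exp d (n + 1) (u x))
          * frechet_derivative u (at x) h)) (at x)" for x
    proof -
      have u: "(u has_derivative frechet_derivative u (at x)) (at x)"
        using Ck_SucD(1)[OF assms(2)[of "Suc 0"]] .
      have "(flat_exp d n has_derivative
          (*) (d * flat_exp d (n + 2) (u x) - n * flat_exp d (n + 1) (u x))) (at (u x))"
        using flat_exp_has_derivative[OF assms(1)] by (rule has_field_derivative_imp_has_derivative)
      from has_derivative_compose[OF u this] show ?thesis .
    qed
    show "Ck k (\<lambda>x. (d * flat_exp d (n + 2) (u x) - n * flat_exp d (n + 1) (u x))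
          * frechet_derivative u (at x) i)" if "i \<in> Basis" for i
      by (rule Ck_mult[OF Ck_diff[OF Ck_cmult[OF Suc.IH] Ck_cmult[OF Suc.IH]]
            Ck_SucD(2)[OF assms(2) that]])
  qed
qed

subsection \<open>Smooth steps, cutoffs and a smooth absolute value\<close>

lemma id_times_flat_exp_slope:
  assumes "d > 0"
  shows "\<exists>D. ((\<lambda>t. t * flat_exp d 0 t) has_real_derivative D) (at t) \<and> 0 \<le> D \<and> D \<le> 1"
proof -
  define D where "D = flat_exp d 0 t + t * (d * flat_exp d 2 t)"
  have "((\<lambda>t. t * flat_exp d 0 t) has_real_derivative D) (at t)"
    using DERIV_mult[OF DERIV_ident flat_exp_has_derivative[OF assms, of 0 t]]
    by (simp add: D_def mult.commute add.commute numeral_2_eq_2)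
  moreover have "0 \<le> D \<and> D \<le> 1"
  proof (cases "t > 0")
    case True
    have "D = exp (- (d / t)) * (1 + d / t)"
      using True by (simp add: D_def flat_exp_def power2_eq_square field_simps)
    moreover have "exp (- (d / t)) * (1 + d / t) \<le> exp (- (d / t)) * exp (d / t)"
      by (intro mult_left_mono exp_ge_add_one_self) auto
    moreover have "exp (- (d / t)) * exp (d / t) = 1" by (simp flip: exp_add)
    ultimately show ?thesis using True assms by simp
  next
    case False
    then show ?thesis by (simp add: D_def flat_exp_def)
  qed
  ultimately show ?thesis by blast
qed

lemma id_times_flat_exp_mono:
  assumes "d > 0" "a \<le> b"
  shows "a * flat_exp d 0 a \<le> b * flat_exp d 0 b"
    and "b * flat_exp d 0 b - a * flat_exp d 0 a \<le> b - a"
proof -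
  show "a * flat_exp d 0 a \<le> b * flat_exp d 0 b"
    using id_times_flat_exp_slope[OF assms(1)]
    by (intro DERIV_nonneg_imp_nondecreasing[OF assms(2)]) blast
  have "\<exists>D. ((\<lambda>t. t - t * flat_exp d 0 t) has_real_derivative D) (at t) \<and> 0 \<le> D" for t
  proof -
    obtain D where D: "((\<lambda>t. t * flat_exp d 0 t) has_real_derivative D) (at t)" "D \<le> 1"
      using id_times_flat_exp_slope[OF assms(1)] by blast
    show ?thesis
      using DERIV_diff[OF DERIV_ident D(1)] D(2) by (intro exI[of _ "1 - D"]) auto
  qed
  then have "a - a * flat_exp d 0 a \<le> b - b * flat_exp d 0 b"
    by (intro DERIV_nonneg_imp_nondecreasing[OF assms(2)]) blast
  then show "b * flat_exp d 0 b - a * flat_exp d 0 a \<le> b - a" by simp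
qed

text \<open>A smooth replacement for \<open>min t 1\<close> on \<open>t \<ge> 0\<close>. Its slope is at most \<open>exp d\<close>, because
  that of \<open>t * exp (- d / t)\<close> is \<open>(1 + d / t) * exp (- d / t) \<le> 1\<close>; hence truncating with it
  raises the seminorm by a factor arbitrarily close to \<open>1\<close> only.\<close>

definition soft_step :: "real \<Rightarrow> real \<Rightarrow> real" where
  "soft_step d t = 1 - exp d * ((1 - t) * flat_exp d 0 (1 - t))"

lemma soft_step_0: "soft_step d 0 = 0"
  by (simp add: soft_step_def flat_exp_def flip: exp_add)

lemma soft_step_ge_1: "1 \<le> t \<Longrightarrow> soft_step d t = 1"
  by (simp add: soft_step_def flat_exp_def)

lemma soft_step_mono: "d > 0 \<Longrightarrow> a \<le> b \<Longrightarrow> soft_step d a \<le> soft_step d b"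
  using id_times_flat_exp_mono(1)[of d "1 - b" "1 - a"] by (simp add: soft_step_def)

lemma soft_step_le_1: "d > 0 \<Longrightarrow> soft_step d t \<le> 1"
  using soft_step_mono[of d t "max t 1"] soft_step_ge_1[of "max t 1" d] by simp

lemma soft_step_nonneg: "d > 0 \<Longrightarrow> 0 \<le> t \<Longrightarrow> 0 \<le> soft_step d t"
  using soft_step_mono[of d 0 t] by (simp add: soft_step_0)

lemma soft_step_Lipschitz:
  assumes "d > 0"
  shows "\<bar>soft_step d a - soft_step d b\<bar> \<le> exp d * \<bar>a - b\<bar>"
proof -
  have *: "\<bar>soft_step d a - soft_step d b\<bar> \<le> exp d * (b - a)" if "a \<le> b" for a b
  proof -
    have "\<bar>soft_step d a - soft_step d b\<bar>
      = exp d * ((1 - a) * flat_exp d 0 (1 - a) - (1 - b) * flat_exp d 0 (1 - b))"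
      using soft_step_mono[OF assms that] by (simp add: soft_step_def right_diff_distrib)
    also have "\<dots> \<le> exp d * (b - a)"
      using id_times_flat_exp_mono(2)[OF assms, of "1 - b" "1 - a"] that
      by (intro mult_left_mono) auto
    finally show ?thesis .
  qed
  show ?thesis
    using *[of a b] *[of b a] by (cases "a \<le> b") (auto simp: abs_minus_commute)
qed

lemma Ck_soft_step:
  assumes "d > 0" "\<And>k. Ck k u"
  shows "Ck k (\<lambda>x. soft_step d (u x))"
proof -
  have v: "Ck k (\<lambda>x. 1 - u x)" for k by (rule Ck_diff[OF Ck_const assms(2)])
  show ?thesis
    unfolding soft_step_def
    by (rule Ck_diff[OF Ck_const Ck_cmult[OF Ck_mult[OF v Ck_flat_exp[OF assms(1) v]]]])
qed

text \<open>The function \<open>flat_exp 1 0\<close> vanishes for negative arguments, and the factor \<open>exp 1\<close> normalises its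
  value at \<open>1\<close>; the soft step then truncates at height \<open>1\<close>. The result is \<open>1\<close> within distance \<open>a\<close>
  of \<open>c\<close>, \<open>0\<close> beyond distance \<open>b\<close> and nonincreasing in the distance, for \<open>0 \<le> a < b\<close>.\<close>

definition cutoff :: "'a::euclidean_space \<Rightarrow> real \<Rightarrow> real \<Rightarrow> 'a \<Rightarrow> real" where
  "cutoff c a b x = soft_step 1 (exp 1 * flat_exp 1 0 ((b\<^sup>2 - (dist x c)\<^sup>2) / (b\<^sup>2 - a\<^sup>2)))"

lemma Ck_cutoff:
  fixes c :: "'a::euclidean_space"
  shows "Ck k (cutoff c a b)"
proof -
  have 1: "Ck k (\<lambda>x. inverse (b\<^sup>2 - a\<^sup>2) * (b\<^sup>2 - (dist x c)\<^sup>2))" for k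
    by (rule Ck_cmult[OF Ck_diff[OF Ck_const Ck_dist_square]])
  have 2: "Ck k (\<lambda>x. exp 1 * flat_exp 1 0 (inverse (b\<^sup>2 - a\<^sup>2) * (b\<^sup>2 - (dist x c)\<^sup>2)))" for k
    by (rule Ck_cmult[OF Ck_flat_exp[OF _ 1]]) simp
  have "Ck k (\<lambda>x. soft_step 1 (exp 1 * flat_exp 1 0 (inverse (b\<^sup>2 - a\<^sup>2) * (b\<^sup>2 - (dist x c)\<^sup>2))))"
    by (rule Ck_soft_step[OF _ 2]) simp
  then show ?thesis
    by (simp only: cutoff_def[abs_def] divide_inverse mult.commute[of _ "inverse _"])
qed

lemma flat_exp_mono: "d > 0 \<Longrightarrow> s \<le> t \<Longrightarrow> flat_exp d 0 s \<le> flat_exp d 0 t"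
  by (auto simp: flat_exp_def frac_le)

lemma cutoff_range: "0 \<le> cutoff c a b x" "cutoff c a b x \<le> 1"
  by (auto simp: cutoff_def intro!: soft_step_nonneg soft_step_le_1 mult_nonneg_nonneg flat_exp_nonneg)

lemma cutoff_eq_1:
  assumes "0 \<le> a" "a < b" "dist x c \<le> a"
  shows "cutoff c a b x = 1"
proof -
  have "(dist x c)\<^sup>2 \<le> a\<^sup>2" "a\<^sup>2 < b\<^sup>2"
    using assms by (auto intro: power_mono power_strict_mono)
  then have t: "1 \<le> (b\<^sup>2 - (dist x c)\<^sup>2) / (b\<^sup>2 - a\<^sup>2)" (is "1 \<le> ?t")
    by simp
  have "exp (1::real) * flat_exp 1 0 1 = 1"
    by (simp add: flat_exp_def flip: exp_add)
  moreover have "exp (1::real) * flat_exp 1 0 1 \<le> exp 1 * flat_exp 1 0 ?t"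
    using flat_exp_mono[OF _ t, of 1] by simp
  ultimately show ?thesis
    unfolding cutoff_def by (intro soft_step_ge_1) simp
qed

lemma cutoff_eq_0:
  assumes "0 \<le> a" "a < b" "b \<le> dist x c"
  shows "cutoff c a b x = 0"
proof -
  have "b\<^sup>2 \<le> (dist x c)\<^sup>2" "a\<^sup>2 < b\<^sup>2"
    using assms by (auto intro: power_mono power_strict_mono)
  then have "(b\<^sup>2 - (dist x c)\<^sup>2) / (b\<^sup>2 - a\<^sup>2) \<le> 0"
    by (simp add: divide_nonpos_pos)
  then show ?thesis
    by (simp add: cutoff_def flat_exp_def soft_step_0)
qed

lemma cutoff_antimono:
  assumes "0 \<le> a" "a < b" "dist x c \<le> dist y c"
  shows "cutoff c a b y \<le> cutoff c a b x"
proof -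
  have "(dist x c)\<^sup>2 \<le> (dist y c)\<^sup>2" "a\<^sup>2 < b\<^sup>2"
    using assms by (auto intro: power_mono power_strict_mono)
  then show ?thesis
    unfolding cutoff_def by (intro soft_step_mono mult_left_mono flat_exp_mono divide_right_mono) auto
qed

definition soft_abs :: "real \<Rightarrow> real \<Rightarrow> real" where
  "soft_abs e t = sqrt (t\<^sup>2 + e\<^sup>2) - e"

lemma soft_abs_0: "e \<ge> 0 \<Longrightarrow> soft_abs e 0 = 0"
  by (simp add: soft_abs_def)

lemma soft_abs_bounds:
  assumes "e \<ge> 0"
  shows "0 \<le> soft_abs e t" "\<bar>t\<bar> - e \<le> soft_abs e t" "soft_abs e t \<le> \<bar>t\<bar>"
proof -
  have "e \<le> sqrt (t\<^sup>2 + e\<^sup>2)" by (rule real_le_rsqrt) simp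
  then show "0 \<le> soft_abs e t" by (simp add: soft_abs_def)
  have "\<bar>t\<bar> \<le> sqrt (t\<^sup>2 + e\<^sup>2)" by (rule real_le_rsqrt) simp
  then show "\<bar>t\<bar> - e \<le> soft_abs e t" by (simp add: soft_abs_def)
  have "sqrt (t\<^sup>2 + e\<^sup>2) \<le> \<bar>t\<bar> + e"
    using assms by (intro real_le_lsqrt) (auto simp: power2_sum)
  then show "soft_abs e t \<le> \<bar>t\<bar>" by (simp add: soft_abs_def)
qed

text \<open>The triangle inequality in the plane, for the vectors \<open>(s, e)\<close> and \<open>(t, e)\<close>.\<close>

lemma soft_abs_Lipschitz: "\<bar>soft_abs e s - soft_abs e t\<bar> \<le> \<bar>s - t\<bar>"
proof -
  have *: "soft_abs e s - soft_abs e t \<le> \<bar>s - t\<bar>" for s t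
    using real_sqrt_sum_squares_triangle_ineq[of t "s - t" e 0] by (simp add: soft_abs_def)
  show ?thesis using *[of s t] *[of t s] by (auto simp: abs_minus_commute abs_le_iff)
qed

lemma Ck_soft_abs:
  assumes "e > 0" "Ck k u"
  shows "Ck k (\<lambda>x. soft_abs e (u x))"
proof -
  have 1: "Ck k (\<lambda>x. u x * u x + e * e)"
    by (rule Ck_add[OF Ck_mult[OF assms(2) assms(2)] Ck_const])
  have "u x * u x + e * e > 0" for x
    using assms(1) by (simp add: add_nonneg_pos)
  then show ?thesis
    unfolding soft_abs_def power2_eq_square by (intro Ck_diff Ck_const Ck_sqrt[OF 1])
qed

section \<open>Test functions\<close>

lemma test_functionsI:
  assumes "\<And>k. Ck k u" "compact K" "K \<subseteq> \<Omega>" "\<And>x. x \<notin> K \<Longrightarrow> u x = 0"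
  shows "u \<in> test_functions \<Omega>"
proof -
  have "closure {x. u x \<noteq> 0} \<subseteq> K"
    using assms(2,4) by (intro closure_minimal compact_imp_closed) auto
  then show ?thesis
    using assms compact_Int_closed[OF assms(2), of "closure {x. u x \<noteq> 0}"]
    by (auto simp: test_functions_def Int_absorb1)
qed

lemma test_functionsE:
  assumes "u \<in> test_functions \<Omega>"
  obtains K where "compact K" "K \<subseteq> \<Omega>" "\<And>x. x \<notin> K \<Longrightarrow> u x = 0"
  using assms closure_subset[of "{x. u x \<noteq> 0}"] unfolding test_functions_def by blast

lemma test_functions_Ck: "u \<in> test_functions \<Omega> \<Longrightarrow> Ck k u"
  by (simp add: test_functions_def)

lemma test_functions_outside: "u \<in> test_functions \<Omega> \<Longrightarrow> x \<notin> \<Omega> \<Longrightarrow> u x = 0"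
  by (elim test_functionsE) blast

lemma test_functions_subset: "u \<in> test_functions \<Omega> \<Longrightarrow> \<Omega> \<subseteq> \<Omega>' \<Longrightarrow> u \<in> test_functions \<Omega>'"
  by (auto simp: test_functions_def)

lemma test_functions_continuous: "u \<in> test_functions \<Omega> \<Longrightarrow> continuous_on UNIV u"
  using test_functions_Ck[of u \<Omega> 0] by (simp only: Ck.simps)

lemma test_functions_borel: "u \<in> test_functions \<Omega> \<Longrightarrow> u \<in> borel_measurable borel"
  by (intro borel_measurable_continuous_onI test_functions_continuous)

text \<open>Composition with a function of two variables that vanishes at the origin; with a
  constant second function it also covers the composition with a function of one variable.\<close>

lemma test_functions_compose2:
  assumes u: "u \<in> test_functions \<Omega>" and v: "v \<in> test_functions \<Omega>"
    and F: "\<And>k. Ck k (\<lambda>x. F (u x) (v x))" "F 0 0 = 0"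
  shows "(\<lambda>x. F (u x) (v x)) \<in> test_functions \<Omega>"
proof -
  obtain K where K: "compact K" "K \<subseteq> \<Omega>" "\<And>x. x \<notin> K \<Longrightarrow> u x = 0"
    by (rule test_functionsE[OF u]) blast
  obtain L where L: "compact L" "L \<subseteq> \<Omega>" "\<And>x. x \<notin> L \<Longrightarrow> v x = 0"
    by (rule test_functionsE[OF v]) blast
  show ?thesis
    by (rule test_functionsI[where K="K \<union> L"]) (use K L F in auto)
qed

lemma test_functions_zero: "(\<lambda>x. 0) \<in> test_functions \<Omega>"
  by (rule test_functionsI[where K="{}"]) (auto intro: Ck_const)

lemma test_functions_lincomb:
  assumes "u \<in> test_functions \<Omega>" "v \<in> test_functions \<Omega>"
  shows "(\<lambda>x. a * u x + b * v x) \<in> test_functions \<Omega>"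
  by (rule test_functions_compose2[OF assms, where F="\<lambda>s t. a * s + b * t"])
     (simp_all add: Ck_add[OF Ck_cmult Ck_cmult] test_functions_Ck[OF assms(1)] test_functions_Ck[OF assms(2)])

lemma test_functions_diff:
  assumes "u \<in> test_functions \<Omega>" "v \<in> test_functions \<Omega>"
  shows "(\<lambda>x. u x - v x) \<in> test_functions \<Omega>"
  using test_functions_lincomb[OF assms, of 1 "-1"] by simp

lemma test_functions_cmult:
  assumes "u \<in> test_functions \<Omega>"
  shows "(\<lambda>x. a * u x) \<in> test_functions \<Omega>"
  using test_functions_lincomb[OF assms assms, of a 0] by simp

lemma test_functions_mult_smooth:
  assumes "u \<in> test_functions \<Omega>" "\<And>k. Ck k w"
  shows "(\<lambda>x. u x * w x) \<in> test_functions \<Omega>"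
proof -
  obtain K where K: "compact K" "K \<subseteq> \<Omega>" "\<And>x. x \<notin> K \<Longrightarrow> u x = 0"
    by (rule test_functionsE[OF assms(1)]) blast
  show ?thesis
    by (rule test_functionsI[OF _ K(1,2)])
       (use K(3) in \<open>auto intro: Ck_mult test_functions_Ck[OF assms(1)] assms(2)\<close>)
qed

lemma test_functions_soft_abs:
  assumes "u \<in> test_functions \<Omega>" "e > 0"
  shows "(\<lambda>x. soft_abs e (u x)) \<in> test_functions \<Omega>"
  by (rule test_functions_compose2[OF assms(1) test_functions_zero, where F="\<lambda>s t. soft_abs e s"])
     (auto intro: Ck_soft_abs test_functions_Ck assms simp: soft_abs_0 assms(2)[THEN less_imp_le])

lemma test_functions_soft_step:
  assumes "u \<in> test_functions \<Omega>" "d > 0"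
  shows "(\<lambda>x. soft_step d (u x)) \<in> test_functions \<Omega>"
  by (rule test_functions_compose2[OF assms(1) test_functions_zero, where F="\<lambda>s t. soft_step d s"])
     (auto intro: Ck_soft_step test_functions_Ck assms simp: soft_step_0)

lemma test_functions_cutoff:
  assumes "0 \<le> a" "a < b" "cball c b \<subseteq> \<Omega>"
  shows "cutoff c a b \<in> test_functions \<Omega>"
  by (rule test_functionsI[OF Ck_cutoff compact_cball assms(3)])
     (use assms(1,2) in \<open>auto simp: dist_commute intro!: cutoff_eq_0\<close>)

lemma test_functions_affine:
  fixes u :: "'a::euclidean_space \<Rightarrow> real"
  assumes u: "u \<in> test_functions \<Omega>" and "c \<noteq> 0"
    and sub: "\<And>x. c *\<^sub>R x + a \<in> \<Omega> \<Longrightarrow> x \<in> \<Omega>'"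
  shows "(\<lambda>x. u (c *\<^sub>R x + a)) \<in> test_functions \<Omega>'"
proof -
  obtain K where K: "compact K" "K \<subseteq> \<Omega>" "\<And>x. x \<notin> K \<Longrightarrow> u x = 0"
    by (rule test_functionsE[OF u]) blast
  have eq: "c *\<^sub>R ((1 / c) *\<^sub>R y + (- (1 / c)) *\<^sub>R a) + a = y" for y
    using \<open>c \<noteq> 0\<close> by (simp add: scaleR_diff_right)
  have eq2: "x = (1 / c) *\<^sub>R (c *\<^sub>R x + a) + (- (1 / c)) *\<^sub>R a" for x
    using \<open>c \<noteq> 0\<close> by (simp add: scaleR_add_right)
  show ?thesis
  proof (rule test_functionsI)
    show "Ck k (\<lambda>x. u (c *\<^sub>R x + a))" for k by (rule Ck_affine[OF test_functions_Ck[OF u]])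
    show "compact ((\<lambda>y. (1 / c) *\<^sub>R y + (- (1 / c)) *\<^sub>R a) ` K)"
      by (intro compact_continuous_image K continuous_intros)
    show "(\<lambda>y. (1 / c) *\<^sub>R y + (- (1 / c)) *\<^sub>R a) ` K \<subseteq> \<Omega>'"
      using K(2) by (auto intro!: sub simp only: eq)
    show "u (c *\<^sub>R x + a) = 0" if "x \<notin> (\<lambda>y. (1 / c) *\<^sub>R y + (- (1 / c)) *\<^sub>R a) ` K" for x
    proof (rule K(3))
      show "c *\<^sub>R x + a \<notin> K" using that eq2[of x] by (metis imageI)
    qed
  qed
qed

lemma continuous_compact_support_bounded:
  fixes u :: "'a::euclidean_space \<Rightarrow> real"
  assumes "continuous_on UNIV u" "compact K" "\<And>x. x \<notin> K \<Longrightarrow> u x = 0"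
  obtains M where "M \<ge> 0" "\<And>x. \<bar>u x\<bar> \<le> M"
proof -
  have "bounded (u ` K)"
    using assms by (intro compact_imp_bounded compact_continuous_image continuous_on_subset[OF assms(1)]) auto
  then obtain M where "\<And>x. x \<in> K \<Longrightarrow> \<bar>u x\<bar> \<le> M"
    by (auto simp: bounded_iff)
  then have "\<bar>u x\<bar> \<le> \<bar>M\<bar>" for x
    using assms(3)[of x] by (cases "x \<in> K") force+
  then show ?thesis by (intro that[of "\<bar>M\<bar>"]) auto
qed

lemma test_functions_bounded:
  fixes u :: "'a::euclidean_space \<Rightarrow> real"
  assumes "u \<in> test_functions \<Omega>"
  obtains M where "M \<ge> 0" "\<And>x. \<bar>u x\<bar> \<le> M"
  using continuous_compact_support_bounded[OF test_functions_continuous[OF assms]]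
    test_functionsE[OF assms] by metis

text \<open>The partial derivatives are continuous and vanish off the support, hence are bounded.\<close>

lemma test_functions_Lipschitz:
  fixes u :: "'a::euclidean_space \<Rightarrow> real"
  assumes "u \<in> test_functions \<Omega>"
  obtains L where "L > 0" "\<And>x y. \<bar>u x - u y\<bar> \<le> L * norm (x - y)"
proof -
  obtain K where K: "compact K" "K \<subseteq> \<Omega>" "\<And>x. x \<notin> K \<Longrightarrow> u x = 0"
    by (rule test_functionsE[OF assms]) blast
  let ?D = "\<lambda>x. frechet_derivative u (at x)"
  note C1 = test_functions_Ck[OF assms, of "Suc 0"]
  note D = Ck_SucD(1)[OF C1]
  have D0: "?D x i = 0" if "x \<notin> K" for x i
  proof -
    have "(u has_derivative (\<lambda>h. 0)) (at x)"
      by (rule has_derivative_transform_within_open[OF has_derivative_const[of 0], where s="- K"])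
         (use K that in \<open>auto intro: compact_imp_closed\<close>)
    then show ?thesis using frechet_derivative_at by metis
  qed
  have "\<exists>M\<ge>0. \<forall>x. \<bar>?D x i\<bar> \<le> M" if "i \<in> Basis" for i
  proof -
    have "continuous_on UNIV (\<lambda>x. ?D x i)"
      using Ck_SucD(2)[OF C1 that] by (simp only: Ck.simps)
    from continuous_compact_support_bounded[OF this K(1) D0] show ?thesis by metis
  qed
  then obtain M where M: "\<And>i. i \<in> Basis \<Longrightarrow> M i \<ge> 0 \<and> (\<forall>x. \<bar>?D x i\<bar> \<le> M i)" by metis
  define L where "L = 1 + (\<Sum>i\<in>Basis. M i)"
  have "L > 0" unfolding L_def using M by (intro add_pos_nonneg sum_nonneg) auto
  have Dle: "norm (?D x h) \<le> norm h * L" for x h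
  proof -
    have lin: "linear (?D x)" by (rule has_derivative_linear[OF D])
    have "?D x h = ?D x (\<Sum>i\<in>Basis. (h \<bullet> i) *\<^sub>R i)" by (simp add: euclidean_representation)
    also have "\<dots> = (\<Sum>i\<in>Basis. (h \<bullet> i) * ?D x i)"
      by (simp add: linear_sum[OF lin] linear_cmul[OF lin])
    also have "norm \<dots> \<le> (\<Sum>i\<in>Basis. norm h * M i)"
      by (intro sum_norm_le) (auto simp: abs_mult intro!: mult_mono Basis_le_norm M[THEN conjunct2, rule_format])
    also have "\<dots> \<le> norm h * L"
      by (simp add: L_def sum_distrib_left[symmetric] distrib_left)
    finally show ?thesis .
  qed
  have "norm (u x - u y) \<le> L * norm (x - y)" for x y
  proof (rule differentiable_bound[OF convex_UNIV])
    show "(u has_derivative ?D x) (at x within UNIV)" for x using D by simp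
    show "onorm (?D x) \<le> L" for x
      by (rule onorm_bound) (use \<open>L > 0\<close> Dle[of x] in \<open>auto simp: mult.commute\<close>)
  qed auto
  then show ?thesis using that[OF \<open>L > 0\<close>] by simp
qed

section \<open>The Gagliardo seminorm\<close>

definition gagliardo_density :: "real \<Rightarrow> real \<Rightarrow> ('a::euclidean_space \<Rightarrow> real) \<Rightarrow> 'a \<Rightarrow> 'a \<Rightarrow> real" where
  "gagliardo_density s p u x y = \<bar>u x - u y\<bar> powr p / norm (x - y) powr (real DIM('a) + s * p)"

lemma gagliardo_density_nonneg: "0 \<le> gagliardo_density s p u x y"
  by (simp add: gagliardo_density_def)

lemma gagliardo_density_measurable [measurable]:
  fixes u :: "'a::euclidean_space \<Rightarrow> real"
  assumes [measurable]: "u \<in> borel_measurable borel"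
  shows "(\<lambda>(x, y). gagliardo_density s p u x y) \<in> borel_measurable (borel \<Otimes>\<^sub>M borel)"
  unfolding gagliardo_density_def by measurable

lemma gagliardo_density_measurable' [measurable]:
  fixes u :: "'a::euclidean_space \<Rightarrow> real"
  assumes "u \<in> borel_measurable borel"
  shows "(\<lambda>(x, y). gagliardo_density s p u x y) \<in> borel_measurable (lborel \<Otimes>\<^sub>M lborel)"
  using gagliardo_density_measurable[OF assms] by (simp cong: measurable_cong_sets)

lemma gagliardo_eq:
  "gagliardo s p u = (\<integral>\<^sup>+z. ennreal (gagliardo_density s p u (fst z) (snd z)) \<partial>(lborel \<Otimes>\<^sub>M lborel))"
  by (simp add: gagliardo_def gagliardo_density_def split_beta')

lemma gagliardo_iterated:
  fixes u :: "'a::euclidean_space \<Rightarrow> real"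
  assumes [measurable]: "u \<in> borel_measurable borel"
  shows "gagliardo s p u = (\<integral>\<^sup>+x. \<integral>\<^sup>+y. ennreal (gagliardo_density s p u x y) \<partial>lborel \<partial>lborel)"
  unfolding gagliardo_eq by (subst lborel.nn_integral_fst[symmetric]) auto

lemma gagliardo_le_cmult:
  fixes u v :: "'a::euclidean_space \<Rightarrow> real"
  assumes "v \<in> borel_measurable borel" "c \<ge> 0" "p > 0"
    and le: "\<And>x y. \<bar>u x - u y\<bar> \<le> c * \<bar>v x - v y\<bar>"
  shows "gagliardo s p u \<le> ennreal (c powr p) * gagliardo s p v"
proof -
  note [measurable] = assms(1)
  have *: "gagliardo_density s p u x y \<le> c powr p * gagliardo_density s p v x y" for x y
  proof -
    have "\<bar>u x - u y\<bar> powr p \<le> (c * \<bar>v x - v y\<bar>) powr p"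
      using le assms(3) by (intro powr_mono2) auto
    then show ?thesis
      using assms(2) by (simp add: gagliardo_density_def powr_mult divide_right_mono)
  qed
  have "gagliardo s p u \<le> (\<integral>\<^sup>+z. ennreal (c powr p) *
      ennreal (gagliardo_density s p v (fst z) (snd z)) \<partial>(lborel \<Otimes>\<^sub>M lborel))"
    unfolding gagliardo_eq
    by (intro nn_integral_mono) (use * in \<open>auto simp flip: ennreal_mult' intro!: ennreal_leI\<close>)
  also have "\<dots> = ennreal (c powr p) * gagliardo s p v"
    unfolding gagliardo_eq by (rule nn_integral_cmult) measurable
  finally show ?thesis .
qed

lemma gagliardo_cmult:
  fixes u :: "'a::euclidean_space \<Rightarrow> real"
  assumes "u \<in> borel_measurable borel"
  shows "gagliardo s p (\<lambda>x. c * u x) = ennreal (\<bar>c\<bar> powr p) * gagliardo s p u"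
proof -
  note [measurable] = assms(1)
  have *: "gagliardo_density s p (\<lambda>x. c * u x) x y = \<bar>c\<bar> powr p * gagliardo_density s p u x y" for x y
    by (simp add: gagliardo_density_def powr_mult abs_mult flip: right_diff_distrib)
  have "gagliardo s p (\<lambda>x. c * u x) = (\<integral>\<^sup>+z. ennreal (\<bar>c\<bar> powr p) *
      ennreal (gagliardo_density s p u (fst z) (snd z)) \<partial>(lborel \<Otimes>\<^sub>M lborel))"
    unfolding gagliardo_eq * by (simp add: ennreal_mult')
  also have "\<dots> = ennreal (\<bar>c\<bar> powr p) * gagliardo s p u"
    unfolding gagliardo_eq by (rule nn_integral_cmult) measurable
  finally show ?thesis .
qed

lemma nn_integral_lborel_affine:
  fixes f :: "'a::euclidean_space \<Rightarrow> ennreal"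
  assumes [measurable]: "f \<in> borel_measurable borel" and "c \<noteq> 0"
  shows "(\<integral>\<^sup>+x. f x \<partial>lborel) = ennreal (\<bar>c\<bar> ^ DIM('a)) * (\<integral>\<^sup>+x. f (c *\<^sub>R x + a) \<partial>lborel)"
  by (subst lborel_affine[OF \<open>c \<noteq> 0\<close>, of a])
     (simp add: nn_integral_density nn_integral_distr nn_integral_cmult add.commute)

lemma nn_integral_lborel_translate:
  fixes f :: "'a::euclidean_space \<Rightarrow> ennreal"
  assumes "f \<in> borel_measurable borel"
  shows "(\<integral>\<^sup>+x. f (x - a) \<partial>lborel) = (\<integral>\<^sup>+x. f x \<partial>lborel)"
    and "(\<integral>\<^sup>+x. f (a - x) \<partial>lborel) = (\<integral>\<^sup>+x. f x \<partial>lborel)"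
  using nn_integral_lborel_affine[OF assms, of 1 "-a"] nn_integral_lborel_affine[OF assms, of "-1" a]
  by simp_all

lemma gagliardo_affine:
  fixes u :: "'a::euclidean_space \<Rightarrow> real"
  assumes [measurable]: "u \<in> borel_measurable borel" and "c > 0"
  shows "gagliardo s p (\<lambda>x. u (c *\<^sub>R x + a)) = ennreal (c powr (s * p - DIM('a))) * gagliardo s p u"
proof -
  let ?N = "real DIM('a)"
  define I where "I = (\<integral>\<^sup>+x. \<integral>\<^sup>+y. ennreal (gagliardo_density s p u (c *\<^sub>R x + a) (c *\<^sub>R y + a)) \<partial>lborel \<partial>lborel)"
  have dens: "gagliardo_density s p (\<lambda>x. u (c *\<^sub>R x + a)) x y
      = c powr (?N + s * p) * gagliardo_density s p u (c *\<^sub>R x + a) (c *\<^sub>R y + a)" for x y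
  proof -
    have "norm ((c *\<^sub>R x + a) - (c *\<^sub>R y + a)) = c * norm (x - y)"
      using \<open>c > 0\<close> by (simp flip: scaleR_diff_right)
    then show ?thesis using \<open>c > 0\<close> by (simp add: gagliardo_density_def powr_mult)
  qed
  have "gagliardo s p u = (\<integral>\<^sup>+x. ennreal (\<bar>c\<bar> ^ DIM('a)) *
      (\<integral>\<^sup>+y. ennreal (gagliardo_density s p u x (c *\<^sub>R y + a)) \<partial>lborel) \<partial>lborel)"
    unfolding gagliardo_iterated[OF assms(1)]
  proof (intro nn_integral_cong nn_integral_lborel_affine)
    show "c \<noteq> 0" using \<open>c > 0\<close> by simp
  qed measurable
  also have "\<dots> = ennreal (\<bar>c\<bar> ^ DIM('a)) * (\<integral>\<^sup>+x. ennreal (\<bar>c\<bar> ^ DIM('a)) *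
      (\<integral>\<^sup>+y. ennreal (gagliardo_density s p u (c *\<^sub>R x + a) (c *\<^sub>R y + a)) \<partial>lborel) \<partial>lborel)"
  proof (rule nn_integral_lborel_affine)
    show "c \<noteq> 0" using \<open>c > 0\<close> by simp
  qed measurable
  also have "\<dots> = ennreal (c ^ DIM('a) * c ^ DIM('a)) * I"
    unfolding I_def using \<open>c > 0\<close>
    by (subst nn_integral_cmult) (auto simp: ennreal_mult mult.assoc)
  also have "c ^ DIM('a) * c ^ DIM('a) = c powr (2 * ?N)"
    using \<open>c > 0\<close> by (simp add: powr_realpow[symmetric] powr_add[symmetric])
  finally have 1: "gagliardo s p u = ennreal (c powr (2 * ?N)) * I" .
  have "gagliardo s p (\<lambda>x. u (c *\<^sub>R x + a)) = ennreal (c powr (?N + s * p)) * I"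
    unfolding I_def by (subst gagliardo_iterated) (auto simp: dens ennreal_mult gagliardo_density_nonneg nn_integral_cmult)
  also have "c powr (?N + s * p) = c powr (s * p - ?N) * c powr (2 * ?N)"
    by (simp flip: powr_add)
  also have "ennreal \<dots> * I = ennreal (c powr (s * p - ?N)) * gagliardo s p u"
    by (simp add: 1 ennreal_mult mult.assoc)
  finally show ?thesis .
qed

subsection \<open>Minkowski's inequality\<close>

lemma convex_on_powr_nonneg:
  fixes p :: real
  assumes "p \<ge> 1"
  shows "convex_on {0..} (\<lambda>x. x powr p)"
proof (rule convex_onI)
  fix t x y :: real assume t: "0 < t" "t < 1" and xy: "x \<in> {0..}" "y \<in> {0..}"
  have shrink: "(l * z) powr p \<le> l * z powr p" if "0 \<le> z" "0 < l" "l < 1" for l z :: real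
  proof -
    have "l powr p \<le> l powr 1" using that assms by (intro powr_mono') auto
    then show ?thesis using that by (simp add: powr_mult mult_right_mono)
  qed
  consider "x > 0" "y > 0" | "x = 0" | "y = 0" using xy by fastforce
  then show "((1 - t) *\<^sub>R x + t *\<^sub>R y) powr p \<le> (1 - t) * x powr p + t * y powr p"
  proof cases
    case 1
    then show ?thesis using convex_onD[OF powr_convex[OF assms], of t x y] t by simp
  qed (use shrink[of y t] shrink[of x "1 - t"] t xy in auto)
qed simp

lemma powr_convex_combination:
  fixes a b x y p :: real
  assumes "p \<ge> 1" "a \<ge> 0" "b \<ge> 0" "x > 0" "y > 0"
  shows "(a + b) powr p \<le> (x + y) powr p *
    (x / (x + y) * (a powr p / x powr p) + y / (x + y) * (b powr p / y powr p))"
proof -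
  define l where "l = y / (x + y)"
  have l: "0 \<le> l" "l \<le> 1" "1 - l = x / (x + y)"
    using assms by (auto simp: l_def field_simps)
  have "((1 - l) * (a / x) + l * (b / y)) powr p \<le> (1 - l) * (a / x) powr p + l * (b / y) powr p"
    using convex_onD[OF convex_on_powr_nonneg[OF assms(1)], of l "a / x" "b / y"] l assms by simp
  moreover have "a + b = (x + y) * ((1 - l) * (a / x) + l * (b / y))"
    using assms(4,5) by (simp add: l(3)) (simp add: l_def distrib_left)
  moreover have "0 \<le> (1 - l) * (a / x) + l * (b / y)"
    using l(1,2) assms by simp
  ultimately show ?thesis
    using assms by (simp add: powr_mult powr_divide l_def[symmetric] l(3)[symmetric] mult_left_mono)
qed

text \<open>Convexity of \<open>t \<mapsto> t powr p\<close>, applied to \<open>f / a\<close> and \<open>g / b\<close> with weights proportional to \<open>a > A\<close>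
  and \<open>b > B\<close>. Strictly larger bounds are used first so that \<open>A\<close> and \<open>B\<close> may vanish.\<close>

lemma nn_integral_Minkowski:
  fixes f g :: "'b \<Rightarrow> real"
  assumes [measurable]: "f \<in> borel_measurable M" "g \<in> borel_measurable M"
    and p: "p \<ge> 1" and nonneg: "\<And>x. f x \<ge> 0" "\<And>x. g x \<ge> 0" "A \<ge> 0" "B \<ge> 0"
    and f: "(\<integral>\<^sup>+x. ennreal (f x powr p) \<partial>M) \<le> ennreal (A powr p)"
    and g: "(\<integral>\<^sup>+x. ennreal (g x powr p) \<partial>M) \<le> ennreal (B powr p)"
  shows "(\<integral>\<^sup>+x. ennreal ((f x + g x) powr p) \<partial>M) \<le> ennreal ((A + B) powr p)"
proof -
  have *: "(\<integral>\<^sup>+x. ennreal ((f x + g x) powr p) \<partial>M) \<le> ennreal ((a + b) powr p)"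
    if "a > A" "b > B" for a b
  proof -
    have ab: "a > 0" "b > 0" using that nonneg by auto
    define c d where "c = (a + b) powr p * (a / (a + b) / a powr p)"
      and "d = (a + b) powr p * (b / (a + b) / b powr p)"
    have cd: "c \<ge> 0" "d \<ge> 0" using ab by (auto simp: c_def d_def)
    have "(\<integral>\<^sup>+x. ennreal ((f x + g x) powr p) \<partial>M)
        \<le> (\<integral>\<^sup>+x. ennreal c * ennreal (f x powr p) + ennreal d * ennreal (g x powr p) \<partial>M)"
    proof (intro nn_integral_mono)
      fix x
      have "(f x + g x) powr p \<le> c * f x powr p + d * g x powr p"
        using powr_convex_combination[OF p nonneg(1)[of x] nonneg(2)[of x] ab]
        by (simp add: c_def d_def distrib_left)
      then show "ennreal ((f x + g x) powr p)
          \<le> ennreal c * ennreal (f x powr p) + ennreal d * ennreal (g x powr p)"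
        using cd by (simp flip: ennreal_mult ennreal_plus add: ennreal_leI)
    qed
    also have "\<dots> = ennreal c * (\<integral>\<^sup>+x. ennreal (f x powr p) \<partial>M)
        + ennreal d * (\<integral>\<^sup>+x. ennreal (g x powr p) \<partial>M)"
      by (subst nn_integral_add) (auto simp: nn_integral_cmult)
    also have "\<dots> \<le> ennreal c * ennreal (a powr p) + ennreal d * ennreal (b powr p)"
      using that nonneg p
      by (intro add_mono mult_left_mono order_trans[OF f] order_trans[OF g] ennreal_leI powr_mono2) auto
    also have "\<dots> = ennreal (c * a powr p + d * b powr p)"
      using cd by (simp flip: ennreal_mult ennreal_plus)
    also have "c * a powr p + d * b powr p = (a + b) powr p * (a / (a + b) + b / (a + b))"
      using ab by (simp add: c_def d_def distrib_left)
    also have "a / (a + b) + b / (a + b) = 1"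
      using ab by (simp flip: add_divide_distrib)
    finally show ?thesis by simp
  qed
  have lim: "(\<lambda>n. ennreal (((A + inverse (Suc n)) + (B + inverse (Suc n))) powr p))
      \<longlonglongrightarrow> ennreal (((A + 0) + (B + 0)) powr p)"
    using p nonneg
    by (intro tendsto_ennrealI tendsto_powr' tendsto_add tendsto_const LIMSEQ_inverse_real_of_nat) auto
  have "(\<integral>\<^sup>+x. ennreal ((f x + g x) powr p) \<partial>M)
      \<le> ennreal (((A + inverse (Suc n)) + (B + inverse (Suc n))) powr p)" for n
    by (rule *) simp_all
  then show ?thesis
    using LIMSEQ_le_const[OF lim] by simp
qed

subsection \<open>Integrability of the truncated kernel\<close>

lemma le_suminf_ennreal: "f k \<le> (\<Sum>i. f i :: ennreal)"
  using sum_le_suminf[OF summableI, of "{k}" f] by simp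

lemma nn_integral_le_ball_sum:
  fixes g :: "'a::euclidean_space \<Rightarrow> ennreal"
  assumes le: "\<And>z. g z \<le> (\<Sum>k. ennreal (c k) * indicator (ball 0 (r k)) z)"
    and nonneg: "\<And>k. c k \<ge> 0" "\<And>k. r k \<ge> 0" and sum: "summable (\<lambda>k. c k * r k ^ DIM('a))"
  shows "(\<integral>\<^sup>+z. g z \<partial>lborel) < \<infinity>"
proof -
  have [measurable]: "ball 0 (r k) \<in> sets (borel :: 'a measure)" for k by simp
  have "(\<integral>\<^sup>+z. g z \<partial>lborel) \<le> (\<integral>\<^sup>+z. (\<Sum>k. ennreal (c k) * indicator (ball 0 (r k)) (z::'a)) \<partial>lborel)"
    by (rule nn_integral_mono) (rule le)
  also have "\<dots> = (\<Sum>k. ennreal (c k) * emeasure lborel (ball 0 (r k) :: 'a set))"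
    by (subst nn_integral_suminf) (measurable, intro suminf_cong nn_integral_cmult_indicator, simp)
  also have "\<dots> = (\<Sum>k. ennreal (unit_ball_vol (DIM('a)) * (c k * r k ^ DIM('a))))"
  proof (rule suminf_cong)
    fix k
    have "ennreal (c k) * emeasure lborel (ball 0 (r k) :: 'a set)
        = ennreal (c k * (unit_ball_vol (DIM('a)) * r k ^ DIM('a)))"
      unfolding emeasure_ball[OF nonneg(2)] by (rule ennreal_mult[symmetric]) (use nonneg in auto)
    also have "c k * (unit_ball_vol (DIM('a)) * r k ^ DIM('a)) = unit_ball_vol (DIM('a)) * (c k * r k ^ DIM('a))"
      by (rule mult.left_commute)
    finally show "ennreal (c k) * emeasure lborel (ball 0 (r k) :: 'a set)
        = ennreal (unit_ball_vol (DIM('a)) * (c k * r k ^ DIM('a)))" .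
  qed
  also have "\<dots> < \<infinity>"
    unfolding infinity_ennreal_def less_top[symmetric]
    by (rule ennreal_suminf_neq_top[OF summable_mult[OF sum]]) (use nonneg in auto)
  finally show ?thesis .
qed

lemma dyadic_scale:
  fixes t :: real
  assumes "1 \<le> t"
  obtains k :: nat where "2 powr k \<le> t" "t < 2 powr (real k + 1)"
proof
  define k where "k = nat \<lfloor>log 2 t\<rfloor>"
  have "0 \<le> log 2 t" using assms by simp
  then have k: "real k \<le> log 2 t" "log 2 t < real k + 1"
    unfolding k_def by linarith+
  show "2 powr (nat \<lfloor>log 2 t\<rfloor>) \<le> t" "t < 2 powr (real (nat \<lfloor>log 2 t\<rfloor>) + 1)"
    unfolding k_def[symmetric] using k assms le_log_iff[of 2 t k] log_less_iff[of 2 t "real k + 1"] by auto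
qed

text \<open>The increment of a bounded Lipschitz function over \<open>z\<close> is at most a multiple of \<open>min 1 |z|\<close>; this
  mass bounds, up to a constant, the energy that such a function can have per point.\<close>

definition kernel_mass :: "real \<Rightarrow> real \<Rightarrow> 'a::euclidean_space itself \<Rightarrow> ennreal" where
  "kernel_mass s p _ = (\<integral>\<^sup>+z. ennreal (min 1 (norm z) powr p /
      norm (z::'a) powr (real DIM('a) + s * p)) \<partial>lborel)"

lemma summable_powr2: "a < 0 \<Longrightarrow> summable (\<lambda>k. C * 2 powr (a * real k))"
proof -
  assume "a < 0"
  have "2 powr (a * real k) = (2 powr a) ^ k" for k
    by (simp add: powr_powr[symmetric] powr_realpow)
  then show ?thesis using \<open>a < 0\<close>
    by (auto intro!: summable_mult summable_geometric simp: powr_less_one)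
qed

text \<open>The kernel is \<open>|z| powr (p - N - s p)\<close> for small and \<open>|z| powr (- N - s p)\<close> for large
  \<open>z\<close>; on dyadic annuli of radius \<open>2 powr (-k)\<close>, respectively \<open>2 powr k\<close>, its mass is of order
  \<open>2 powr (- k p (1 - s))\<close>, respectively \<open>2 powr (- k s p)\<close>.\<close>

lemma kernel_mass_finite:
  assumes "p \<ge> 1" "0 < s" "s < 1"
  shows "kernel_mass s p TYPE('a::euclidean_space) < \<infinity>"
proof -
  let ?N = "real DIM('a)"
  have N: "?N > 0" by simp
  have p: "p > 0" using assms by simp
  define g where "g z = ennreal (min 1 (norm z) powr p / norm z powr (?N + s * p))" for z :: 'a
  define ci ri co ro where "ci k = 2 powr ?N * 2 powr ((?N - p * (1 - s)) * real k)"
    and "ri k = 2 * 2 powr (- real k)" and "co k = 2 powr (- (?N + s * p) * real k)"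
    and "ro k = 2 powr (real k + 1)" for k :: nat
  have inner: "(\<integral>\<^sup>+z. g z * indicator (ball 0 1) z \<partial>lborel) < \<infinity>"
  proof (rule nn_integral_le_ball_sum[where c=ci and r=ri])
    show "g z * indicator (ball 0 1) z \<le> (\<Sum>k. ennreal (ci k) * indicator (ball 0 (ri k)) z)" for z
    proof (cases "z = 0 \<or> norm z \<ge> 1")
      case True
      then show ?thesis using p by (auto simp: g_def)
    next
      case False
      then have z: "norm z > 0" "norm z < 1" by auto
      then obtain k :: nat where k: "2 powr k \<le> 1 / norm z" "1 / norm z < 2 powr (real k + 1)"
        using dyadic_scale[of "1 / norm z"] by (auto simp: field_simps)
      have up: "norm z \<le> 2 powr (- real k)"
        using k(1) z by (simp add: powr_minus field_simps)
      have lo: "2 powr (- (real k + 1)) \<le> norm z"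
      proof -
        have "1 < norm z * 2 powr (real k + 1)" using k(2) z by (simp add: pos_divide_less_eq mult.commute add.commute)
        then have "1 / 2 powr (real k + 1) < norm z" by (simp add: pos_divide_less_eq)
        then show ?thesis unfolding powr_minus_divide by simp
      qed
      have "min 1 (norm z) powr p / norm z powr (?N + s * p)
          = norm z powr (p * (1 - s)) * norm z powr (- ?N)"
        using z by (simp add: powr_diff[symmetric] powr_add[symmetric] algebra_simps)
      also have "\<dots> \<le> (2 powr (- real k)) powr (p * (1 - s)) * (2 powr (- (real k + 1))) powr (- ?N)"
        using z up lo p assms by (intro mult_mono powr_mono2 powr_mono2') auto
      also have "\<dots> = ci k"
        by (simp add: ci_def powr_powr powr_add[symmetric] algebra_simps)
      finally have "g z \<le> ennreal (ci k)" by (simp add: g_def ennreal_leI)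
      moreover have "indicator (ball 0 (ri k)) z = (1::ennreal)"
      proof -
        have "norm z < ri k"
          using up powr_gt_zero[of 2 "- real k"] unfolding ri_def by linarith
        then show ?thesis by simp
      qed
      ultimately have "g z * indicator (ball 0 1) z \<le> ennreal (ci k) * indicator (ball 0 (ri k)) z"
        by (metis indicator_simps(1) mem_ball_0 mult.right_neutral z(2))
      also have "\<dots> \<le> (\<Sum>i. ennreal (ci i) * indicator (ball 0 (ri i)) z)"
        by (rule le_suminf_ennreal)
      finally show ?thesis .
    qed
    have "ri k ^ DIM('a) = 2 powr ?N * 2 powr (- ?N * real k)" for k
    proof -
      have "ri k = 2 powr (1 - real k)" by (simp add: ri_def powr_diff powr_minus divide_inverse)
      then have "ri k ^ DIM('a) = 2 powr ((1 - real k) * ?N)"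
        by (simp add: powr_realpow[symmetric] powr_powr)
      then show ?thesis by (simp add: powr_add[symmetric] algebra_simps)
    qed
    then have "ci k * ri k ^ DIM('a) = 2 powr (2 * ?N) * 2 powr (- (p * (1 - s)) * real k)" for k
      by (simp add: ci_def powr_add[symmetric] algebra_simps)
    then show "summable (\<lambda>k. ci k * ri k ^ DIM('a))"
      by (simp only:) (rule summable_powr2, use p assms in simp)
  qed (auto simp: ci_def ri_def)
  have outer: "(\<integral>\<^sup>+z. g z * indicator (- ball 0 1) z \<partial>lborel) < \<infinity>"
  proof (rule nn_integral_le_ball_sum[where c=co and r=ro])
    show "g z * indicator (- ball 0 1) z \<le> (\<Sum>k. ennreal (co k) * indicator (ball 0 (ro k)) z)" for z
    proof (cases "norm z \<ge> 1")
      case True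
      then obtain k :: nat where k: "2 powr k \<le> norm z" "norm z < 2 powr (real k + 1)"
        using dyadic_scale by blast
      have "min 1 (norm z) powr p / norm z powr (?N + s * p) = norm z powr (- (?N + s * p))"
        unfolding powr_minus_divide using True by simp
      also have "\<dots> \<le> (2 powr k) powr (- (?N + s * p))"
      proof (rule powr_mono2')
        have "0 \<le> s * p" using p assms by simp
        then have "0 \<le> ?N + s * p" by simp
        then show "- (?N + s * p) \<le> 0" by (simp only: neg_le_0_iff_le)
      qed (use k in auto)
      also have "\<dots> = co k" by (simp add: co_def powr_powr mult.commute)
      finally have "g z \<le> ennreal (co k)" by (simp add: g_def ennreal_leI)
      then have "g z * indicator (- ball 0 1) z \<le> ennreal (co k) * indicator (ball 0 (ro k)) z"
        using k(2) True by (simp add: ro_def)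
      also have "\<dots> \<le> (\<Sum>i. ennreal (co i) * indicator (ball 0 (ro i)) z)"
        by (rule le_suminf_ennreal)
      finally show ?thesis .
    qed simp
    have "ro k ^ DIM('a) = 2 powr ?N * 2 powr (?N * real k)" for k
    proof -
      have "ro k ^ DIM('a) = 2 powr ((real k + 1) * ?N)"
        by (simp add: ro_def powr_realpow[symmetric] powr_powr)
      then show ?thesis by (simp add: powr_add[symmetric] algebra_simps)
    qed
    then have "co k * ro k ^ DIM('a) = 2 powr ?N * 2 powr (- (s * p) * real k)" for k
      by (simp add: co_def powr_add[symmetric] algebra_simps)
    then show "summable (\<lambda>k. co k * ro k ^ DIM('a))"
      by (simp only:) (rule summable_powr2, use p assms in simp)
  qed (auto simp: co_def ro_def)
  have [measurable]: "g \<in> borel_measurable borel" unfolding g_def by measurable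
  have [measurable]: "ball 0 1 \<in> sets (borel :: 'a measure)" "- ball 0 1 \<in> sets (borel :: 'a measure)"
    by (rule borel_open[OF open_ball] borel_comp[OF borel_open[OF open_ball]])+
  have "kernel_mass s p TYPE('a) = (\<integral>\<^sup>+z. g z * indicator (ball 0 1) z + g z * indicator (- ball 0 1) z \<partial>lborel)"
    unfolding kernel_mass_def g_def[symmetric]
    by (intro nn_integral_cong) (auto split: split_indicator)
  also have "\<dots> < \<infinity>"
  proof (subst nn_integral_add)
    show "(\<integral>\<^sup>+z. g z * indicator (ball 0 1) z \<partial>lborel) + (\<integral>\<^sup>+z. g z * indicator (- ball 0 1) z \<partial>lborel) < \<infinity>"
      using inner outer by simp
  qed measurable
  finally show ?thesis .
qed

lemma kernel_mass_translate:
  fixes x :: "'a::euclidean_space"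
  shows "(\<integral>\<^sup>+y. ennreal (min 1 (norm (x - y)) powr p / norm (x - y) powr (real DIM('a) + s * p)) \<partial>lborel)
    = kernel_mass s p TYPE('a)"
    and "(\<integral>\<^sup>+y. ennreal (min 1 (norm (y - x)) powr p / norm (y - x) powr (real DIM('a) + s * p)) \<partial>lborel)
    = kernel_mass s p TYPE('a)"
proof -
  define f where "f z = ennreal (min 1 (norm z) powr p / norm z powr (real DIM('a) + s * p))" for z :: 'a
  have f: "f \<in> borel_measurable borel" unfolding f_def by measurable
  show "(\<integral>\<^sup>+y. ennreal (min 1 (norm (x - y)) powr p / norm (x - y) powr (real DIM('a) + s * p)) \<partial>lborel)
      = kernel_mass s p TYPE('a)"
    using nn_integral_lborel_translate(2)[OF f, of x] unfolding kernel_mass_def f_def .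
  show "(\<integral>\<^sup>+y. ennreal (min 1 (norm (y - x)) powr p / norm (y - x) powr (real DIM('a) + s * p)) \<partial>lborel)
      = kernel_mass s p TYPE('a)"
    using nn_integral_lborel_translate(1)[OF f, of x] unfolding kernel_mass_def f_def .
qed

text \<open>The energy lives on pairs of points of which at least one lies in the support, and each point of the
  support contributes at most a multiple of \<open>kernel_mass\<close>.\<close>

lemma gagliardo_finite:
  fixes u :: "'a::euclidean_space \<Rightarrow> real"
  assumes ps: "p \<ge> 1" "0 < s" "s < 1" and u: "u \<in> test_functions \<Omega>"
  shows "gagliardo s p u < \<infinity>"
proof -
  obtain M where M: "M \<ge> 0" "\<And>x. \<bar>u x\<bar> \<le> M" using test_functions_bounded[OF u] by blast
  obtain L where L: "L > 0" "\<And>x y. \<bar>u x - u y\<bar> \<le> L * norm (x - y)"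
    using test_functions_Lipschitz[OF u] by blast
  obtain K where K: "compact K" "\<And>x. x \<notin> K \<Longrightarrow> u x = 0"
    by (rule test_functionsE[OF u]) blast
  note [measurable] = test_functions_borel[OF u] borel_compact[OF K(1)]
  define c where "c = max (2 * M) L"
  have c: "c > 0" using L(1) by (simp add: c_def)
  define k where "k x y = ennreal (c powr p) * ennreal (min 1 (norm (x - y)) powr p / norm (x - y) powr (real DIM('a) + s * p))"
    for x y :: 'a
  have km [measurable]: "(\<lambda>(x, y). k x y) \<in> borel_measurable (lborel \<Otimes>\<^sub>M lborel)"
    unfolding k_def by measurable
  define C where "C = ennreal (c powr p) * kernel_mass s p TYPE('a)"
  have kx: "(\<integral>\<^sup>+y. k x y \<partial>lborel) = C" "(\<integral>\<^sup>+y. k y x \<partial>lborel) = C" for x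
    unfolding k_def C_def by (subst nn_integral_cmult; simp add: kernel_mass_translate)+
  have le: "ennreal (gagliardo_density s p u x y) \<le> k x y * indicator K x + k x y * indicator K y" for x y
  proof (cases "x \<in> K \<or> y \<in> K")
    case True
    have "\<bar>u x - u y\<bar> \<le> c * min 1 (norm (x - y))"
    proof -
      have "\<bar>u x - u y\<bar> \<le> 2 * M" using M(2)[of x] M(2)[of y] by linarith
      moreover have "L * norm (x - y) \<le> c * norm (x - y)" by (simp add: c_def mult_right_mono)
      ultimately show ?thesis using L(2)[of x y] by (auto simp: c_def min_def)
    qed
    then have "\<bar>u x - u y\<bar> powr p \<le> (c * min 1 (norm (x - y))) powr p"
      using ps by (intro powr_mono2) auto
    then have "\<bar>u x - u y\<bar> powr p \<le> c powr p * min 1 (norm (x - y)) powr p"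
      using c by (simp add: powr_mult)
    from divide_right_mono[OF this, of "norm (x - y) powr (real DIM('a) + s * p)"]
    have "gagliardo_density s p u x y
        \<le> c powr p * (min 1 (norm (x - y)) powr p / norm (x - y) powr (real DIM('a) + s * p))"
      by (simp add: gagliardo_density_def)
    then have "ennreal (gagliardo_density s p u x y) \<le> k x y"
      unfolding k_def by (subst ennreal_mult[symmetric]) (auto intro: ennreal_leI)
    then show ?thesis using True by (auto split: split_indicator intro: order_trans)
  next
    case False
    then show ?thesis using K(2) ps by (simp add: gagliardo_density_def)
  qed
  have "gagliardo s p u \<le> (\<integral>\<^sup>+x. \<integral>\<^sup>+y. k x y * indicator K x + k x y * indicator K y \<partial>lborel \<partial>lborel)"
    unfolding gagliardo_iterated[OF test_functions_borel[OF u]] by (intro nn_integral_mono le)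
  also have "\<dots> = (\<integral>\<^sup>+x. \<integral>\<^sup>+y. k x y * indicator K x \<partial>lborel \<partial>lborel)
      + (\<integral>\<^sup>+x. \<integral>\<^sup>+y. k x y * indicator K y \<partial>lborel \<partial>lborel)"
    by (simp add: nn_integral_add)
  also have "(\<integral>\<^sup>+x. \<integral>\<^sup>+y. k x y * indicator K y \<partial>lborel \<partial>lborel)
      = (\<integral>\<^sup>+y. \<integral>\<^sup>+x. k x y * indicator K y \<partial>lborel \<partial>lborel)"
    by (rule lborel_pair.Fubini'[symmetric]) measurable
  also have "\<dots> = C * emeasure lborel K"
  proof -
    have "(\<integral>\<^sup>+x. k x y * indicator K y \<partial>lborel) = C * indicator K y" for y
      by (subst nn_integral_multc) (measurable, simp only: kx)
    then show ?thesis by (simp add: nn_integral_cmult_indicator)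
  qed
  also have "(\<integral>\<^sup>+x. \<integral>\<^sup>+y. k x y * indicator K x \<partial>lborel \<partial>lborel) = C * emeasure lborel K"
  proof -
    have "(\<integral>\<^sup>+y. k x y * indicator K x \<partial>lborel) = C * indicator K x" for x
      by (subst nn_integral_multc) (measurable, simp only: kx)
    then show ?thesis by (simp add: nn_integral_cmult_indicator)
  qed
  also have "C * emeasure lborel K + C * emeasure lborel K < \<infinity>"
  proof -
    have C: "C < top"
      unfolding C_def by (rule ennreal_mult_less_top[THEN iffD2])
        (use kernel_mass_finite[OF ps, where 'a='a] in simp)
    have "C * emeasure lborel K < top"
      by (rule ennreal_mult_less_top[THEN iffD2]) (use C emeasure_compact_finite[OF K(1)] in simp)
    then show ?thesis by simp
  qed
  finally show ?thesis .
qed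

subsection \<open>The Poincare inequality on a ball and the capacity of a ball\<close>

text \<open>A ball of the same radius that lies outside the support already yields the inequality:
  there the difference quotient sees the full value of \<open>u\<close>.\<close>

lemma gagliardo_ge_Lp_of_bounded_support:
  fixes u :: "'a::euclidean_space \<Rightarrow> real" and s p R :: real
  assumes [measurable]: "u \<in> borel_measurable borel" and "p \<ge> 1" "s > 0" "R > 0"
    and supp: "\<And>x. x \<notin> ball x0 R \<Longrightarrow> u x = 0"
  shows "ennreal (unit_ball_vol (DIM('a)) * R ^ DIM('a) / (5 * R) powr (real DIM('a) + s * p)) *
      (\<integral>\<^sup>+x. ennreal (\<bar>u x\<bar> powr p) \<partial>lborel) \<le> gagliardo s p u"
proof -
  obtain e :: 'a where e: "norm e = 1" using vector_choose_size[of 1] by auto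
  define x1 where "x1 = x0 + (3 * R) *\<^sub>R e"
  have d01: "dist x0 x1 = 3 * R" using e \<open>R > 0\<close> by (simp add: x1_def dist_norm)
  let ?a = "real DIM('a) + s * p"
  have a: "?a > 0" using assms by (simp add: add_pos_pos)
  have le: "ennreal (\<bar>u x\<bar> powr p / (5 * R) powr ?a) * indicator (ball x1 R) y
      \<le> ennreal (gagliardo_density s p u x y)" for x y
  proof (cases "x \<in> ball x0 R \<and> y \<in> ball x1 R")
    case True
    then have d: "dist x0 x < R" "dist x1 y < R" by auto
    have t: "dist x0 x1 \<le> dist x0 y + dist y x1" "dist x y \<le> dist x x0 + dist x0 x1 + dist x1 y"
      "dist x0 x1 \<le> dist x0 x + dist x y + dist y x1"
      by metric+
    have "y \<notin> ball x0 R" using t(1) d d01 \<open>R > 0\<close> by (simp add: dist_commute)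
    then have "u y = 0" by (rule supp)
    moreover have "dist x y \<le> 5 * R" "0 < dist x y"
      using t d d01 \<open>R > 0\<close> unfolding dist_commute[of x x0] dist_commute[of y x1] by linarith+
    then have "norm (x - y) \<le> 5 * R" "0 < norm (x - y)" by (simp_all only: dist_norm)
    then have "norm (x - y) powr ?a \<le> (5 * R) powr ?a" "norm (x - y) powr ?a > 0"
      using a by (auto intro: powr_mono2)
    ultimately show ?thesis
      using True \<open>R > 0\<close>
      by (auto simp: gagliardo_density_def intro!: ennreal_leI divide_left_mono mult_pos_pos)
  next
    case False
    then show ?thesis using supp[of x] assms by (auto split: split_indicator)
  qed
  have "(\<integral>\<^sup>+x. \<integral>\<^sup>+y. ennreal (\<bar>u x\<bar> powr p / (5 * R) powr ?a) * indicator (ball x1 R) y \<partial>lborel \<partial>lborel)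
      \<le> gagliardo s p u"
    unfolding gagliardo_iterated[OF assms(1)] by (intro nn_integral_mono le)
  also have "(\<integral>\<^sup>+x. \<integral>\<^sup>+y. ennreal (\<bar>u x\<bar> powr p / (5 * R) powr ?a) * indicator (ball x1 R) y \<partial>lborel \<partial>lborel)
      = (\<integral>\<^sup>+x. ennreal (unit_ball_vol (DIM('a)) * R ^ DIM('a) / (5 * R) powr ?a) * ennreal (\<bar>u x\<bar> powr p) \<partial>lborel)"
  proof (intro nn_integral_cong)
    fix x
    define W B A where "W = unit_ball_vol (DIM('a)) * R ^ DIM('a)" and "B = (5 * R) powr ?a"
      and "A = \<bar>u x\<bar> powr p"
    have nonneg: "0 \<le> W" "0 \<le> B" "0 \<le> A" using \<open>R > 0\<close> by (auto simp: W_def B_def A_def)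
    have "(\<integral>\<^sup>+y. ennreal (A / B) * indicator (ball x1 R) y \<partial>lborel) = ennreal (A / B) * ennreal W"
      using \<open>R > 0\<close> by (subst nn_integral_cmult_indicator) (simp_all add: emeasure_ball W_def)
    also have "\<dots> = ennreal (A / B * W)" using nonneg by (intro ennreal_mult[symmetric]) auto
    also have "A / B * W = W / B * A" by simp
    also have "ennreal (W / B * A) = ennreal (W / B) * ennreal A"
      using nonneg by (intro ennreal_mult) auto
    finally show "(\<integral>\<^sup>+y. ennreal (\<bar>u x\<bar> powr p / (5 * R) powr ?a) * indicator (ball x1 R) y \<partial>lborel)
        = ennreal (unit_ball_vol (DIM('a)) * R ^ DIM('a) / (5 * R) powr ?a) * ennreal (\<bar>u x\<bar> powr p)"
      by (simp only: W_def B_def A_def)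
  qed
  also have "\<dots> = ennreal (unit_ball_vol (DIM('a)) * R ^ DIM('a) / (5 * R) powr ?a) *
      (\<integral>\<^sup>+x. ennreal (\<bar>u x\<bar> powr p) \<partial>lborel)"
    by (intro nn_integral_cmult) measurable
  finally show ?thesis .
qed

text \<open>An admissible function has an \<open>L\<^sup>p\<close> norm bounded below by the volume of the ball. The bound
  does not depend on the centre.\<close>

lemma frac_cap_ball_lower_bound:
  fixes s p r :: real
  assumes "p \<ge> 1" "s > 0" "r > 0"
  obtains \<kappa> where "\<kappa> > 0"
    "\<And>x0::'a::euclidean_space. ennreal \<kappa> \<le> frac_cap s p (cball x0 r) (ball x0 (2 * r))"
proof
  let ?N = "DIM('a)"
  define c where "c = unit_ball_vol ?N * (2 * r) ^ ?N / (5 * (2 * r)) powr (real ?N + s * p)"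
  have c: "c > 0" using assms by (simp add: c_def)
  show "c * (unit_ball_vol ?N * r ^ ?N) > 0" using c assms by simp
  show "ennreal (c * (unit_ball_vol ?N * r ^ ?N)) \<le> frac_cap s p (cball x0 r) (ball x0 (2 * r))"
    for x0 :: 'a
    unfolding frac_cap_def
  proof (rule Inf_greatest, clarify)
    fix \<phi> assume \<phi>: "\<phi> \<in> test_functions (ball x0 (2 * r))" "\<forall>x\<in>cball x0 r. 1 \<le> \<phi> x"
    note [measurable] = test_functions_borel[OF \<phi>(1)]
    have "ennreal (unit_ball_vol ?N * r ^ ?N) = (\<integral>\<^sup>+x. indicator (cball x0 r) x \<partial>lborel)"
      using assms by (simp add: emeasure_cball)
    also have "\<dots> \<le> (\<integral>\<^sup>+x. ennreal (\<bar>\<phi> x\<bar> powr p) \<partial>lborel)"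
    proof (intro nn_integral_mono)
      fix x
      have "1 \<le> \<bar>\<phi> x\<bar> powr p" if "x \<in> cball x0 r"
        using \<phi>(2)[rule_format, OF that] assms(1) by (intro ge_one_powr_ge_zero) auto
      then show "indicator (cball x0 r) x \<le> ennreal (\<bar>\<phi> x\<bar> powr p)"
        by (auto split: split_indicator)
    qed
    finally have "ennreal c * ennreal (unit_ball_vol ?N * r ^ ?N) \<le> ennreal c * (\<integral>\<^sup>+x. ennreal (\<bar>\<phi> x\<bar> powr p) \<partial>lborel)"
      by (rule mult_left_mono) simp
    also have "\<dots> \<le> gagliardo s p \<phi>"
      unfolding c_def using assms
      by (intro gagliardo_ge_Lp_of_bounded_support[where R="2 * r" and ?x0.0=x0])
         (auto intro: test_functions_outside[OF \<phi>(1)])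
    finally show "ennreal (c * (unit_ball_vol ?N * r ^ ?N)) \<le> gagliardo s p \<phi>"
      using c by (simp add: ennreal_mult')
  qed
qed

lemma frac_cap_ball_finite:
  fixes x0 :: "'a::euclidean_space"
  assumes "p \<ge> 1" "0 < s" "s < 1" "r > 0"
  shows "frac_cap s p (cball x0 r) (ball x0 (2 * r)) < \<infinity>"
proof -
  have t: "cutoff x0 r (3 / 2 * r) \<in> test_functions (ball x0 (2 * r))"
    using assms by (intro test_functions_cutoff) auto
  have "frac_cap s p (cball x0 r) (ball x0 (2 * r)) \<le> gagliardo s p (cutoff x0 r (3 / 2 * r))"
    unfolding frac_cap_def
    by (rule Inf_lower) (use t assms in \<open>auto simp: cutoff_eq_1 dist_commute\<close>)
  also have "\<dots> < \<infinity>" using gagliardo_finite[OF assms(1-3) t] .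
  finally show ?thesis .
qed

section \<open>Averages over balls\<close>

lemma measurable_indicator_ball [measurable (raw)]:
  fixes f g :: "'b \<Rightarrow> 'a::euclidean_space"
  assumes [measurable]: "f \<in> borel_measurable M" "g \<in> borel_measurable M"
  shows "(\<lambda>w. indicator (ball (f w) r) (g w) :: ennreal) \<in> borel_measurable M"
    and "(\<lambda>w. indicator (ball (f w) r) (g w) :: real) \<in> borel_measurable M"
proof -
  have *: "{w \<in> space M. g w \<in> ball (f w) r} = {w \<in> space M. dist (f w) (g w) < r}" by auto
  have "{w \<in> space M. g w \<in> ball (f w) r} \<in> sets M" unfolding * by measurable
  then show "(\<lambda>w. indicator (ball (f w) r) (g w) :: ennreal) \<in> borel_measurable M"
    "(\<lambda>w. indicator (ball (f w) r) (g w) :: real) \<in> borel_measurable M"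
    by (auto intro!: borel_measurable_indicator')
qed

lemma powr_above_tangent:
  fixes c t p :: real
  assumes "p \<ge> 1" "c > 0" "t \<ge> 0"
  shows "c powr p + p * c powr (p - 1) * (t - c) \<le> t powr p"
proof -
  have "p * c powr (p - 1) * (t - c) \<le> t powr p - c powr p"
    by (rule convex_on_imp_above_tangent[OF convex_on_powr_nonneg[OF assms(1)]])
       (use assms in \<open>auto simp: interior_real_atLeast intro!: derivative_eq_intros\<close>)
  then show ?thesis by simp
qed

text \<open>Jensen's inequality for \<open>t \<mapsto> t powr p\<close>: the tangent at the mean value is integrated.\<close>

lemma average_deviation_le:
  fixes u :: "'a::euclidean_space \<Rightarrow> real" and p v :: real
  assumes [measurable]: "A \<in> sets borel" "u \<in> borel_measurable borel"
    and A: "emeasure lborel A = ennreal m" "m > 0" and bounded: "\<And>x. \<bar>u x\<bar> \<le> M" and p: "p \<ge> 1"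
  shows "ennreal (m * \<bar>v - (\<integral>y. u y * indicator A y \<partial>lborel) / m\<bar> powr p)
    \<le> (\<integral>\<^sup>+y. ennreal (\<bar>v - u y\<bar> powr p) * indicator A y \<partial>lborel)"
proof -
  have meas: "measure lborel A = m" using A by (simp add: measure_def)
  have int: "integrable lborel (\<lambda>y. f y * indicator A y)"
    if [measurable]: "f \<in> borel_measurable borel" and "\<And>x. \<bar>f x\<bar> \<le> K" for f :: "'a \<Rightarrow> real" and K
  proof (rule Bochner_Integration.integrable_bound[where f="\<lambda>y. K * indicator A y"])
    show "integrable lborel (\<lambda>y. K * indicator A y)"
      using A by (intro integrable_mult_right integrable_real_indicator) auto
    show "AE x in lborel. norm (f x * indicator A x) \<le> norm (K * indicator A x)"
    proof (intro AE_I2)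
      fix x
      show "norm (f x * indicator A x) \<le> norm (K * indicator A x)"
        using that(2)[of x] abs_ge_self[of K] by (auto split: split_indicator)
    qed
  qed measurable
  define w where "w y = \<bar>v - u y\<bar>" for y
  have [measurable]: "w \<in> borel_measurable borel" unfolding w_def by measurable
  have w: "0 \<le> w y" "w y \<le> \<bar>v\<bar> + M" for y
    using bounded[of y] by (auto simp: w_def)
  define c where "c = (\<integral>y. w y * indicator A y \<partial>lborel) / m"
  have iw: "integrable lborel (\<lambda>y. w y * indicator A y)" using w by (intro int[where K="\<bar>v\<bar> + M"]) auto
  have iu: "integrable lborel (\<lambda>y. u y * indicator A y)" using bounded by (intro int) auto
  have i1: "integrable lborel (\<lambda>y. d * indicator A y)" for d :: real by (intro int[where K="\<bar>d\<bar>"]) auto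
  have c1: "(\<integral>y. d * indicator A y \<partial>lborel) = d * m" for d :: real
    by (simp add: meas)
  have dev: "\<bar>v - (\<integral>y. u y * indicator A y \<partial>lborel) / m\<bar> \<le> c"
  proof -
    have "v - (\<integral>y. u y * indicator A y \<partial>lborel) / m = (\<integral>y. v * indicator A y - u y * indicator A y \<partial>lborel) / m"
      using A(2) by (subst Bochner_Integration.integral_diff[OF i1 iu]) (simp add: c1 meas diff_divide_distrib)
    also have "\<bar>\<dots>\<bar> \<le> c"
      unfolding c_def abs_divide using A(2)
      by (intro divide_mono order_trans[OF integral_abs_bound] Bochner_Integration.integral_mono
            integrable_abs Bochner_Integration.integrable_diff i1 iu iw)
         (auto simp: w_def integral_nonneg_AE split: split_indicator)
    finally show ?thesis .
  qed
  show ?thesis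
  proof (cases "c > 0")
    case False
    then have "\<bar>v - (\<integral>y. u y * indicator A y \<partial>lborel) / m\<bar> = 0" using dev by linarith
    then show ?thesis using p by (simp only: powr_zero_eq_one) simp
  next
    case True
    have "m * \<bar>v - (\<integral>y. u y * indicator A y \<partial>lborel) / m\<bar> powr p \<le> m * c powr p"
      using dev A(2) p by (intro mult_left_mono powr_mono2) auto
    also have "\<dots> = (c powr p - p * c powr (p - 1) * c) * m + p * c powr (p - 1) * (c * m)"
      by (simp add: algebra_simps)
    also have "c * m = (\<integral>y. w y * indicator A y \<partial>lborel)" using A(2) by (simp add: c_def)
    also have "(c powr p - p * c powr (p - 1) * c) * m + p * c powr (p - 1) * (\<integral>y. w y * indicator A y \<partial>lborel)
      = (\<integral>y. (c powr p - p * c powr (p - 1) * c) * indicator A y + p * c powr (p - 1) * (w y * indicator A y) \<partial>lborel)"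
      by (subst Bochner_Integration.integral_add[OF i1 integrable_mult_right[OF iw]]) (simp add: c1 meas)
    also have "\<dots> \<le> (\<integral>y. w y powr p * indicator A y \<partial>lborel)"
    proof (rule Bochner_Integration.integral_mono)
      show "integrable lborel (\<lambda>y. w y powr p * indicator A y)"
        using w p by (intro int[where K="(\<bar>v\<bar> + M) powr p"]) (auto intro!: powr_mono2)
      show "(c powr p - p * c powr (p - 1) * c) * indicator A y + p * c powr (p - 1) * (w y * indicator A y)
          \<le> w y powr p * indicator A y" for y
        using powr_above_tangent[OF p True w(1)[of y]] by (auto split: split_indicator simp: algebra_simps)
    qed (intro Bochner_Integration.integrable_add i1 integrable_mult_right iw)
    finally have "ennreal (m * \<bar>v - (\<integral>y. u y * indicator A y \<partial>lborel) / m\<bar> powr p)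
        \<le> ennreal (\<integral>y. w y powr p * indicator A y \<partial>lborel)"
      by (rule ennreal_leI)
    also have "\<dots> = (\<integral>\<^sup>+y. ennreal (w y powr p * indicator A y) \<partial>lborel)"
      using w p by (intro nn_integral_eq_integral[symmetric] int[where K="(\<bar>v\<bar> + M) powr p"])
        (auto intro!: powr_mono2)
    also have "\<dots> = (\<integral>\<^sup>+y. ennreal (\<bar>v - u y\<bar> powr p) * indicator A y \<partial>lborel)"
      by (intro nn_integral_cong) (auto simp: w_def split: split_indicator)
    finally show ?thesis .
  qed
qed

definition ball_average :: "('a::euclidean_space \<Rightarrow> real) \<Rightarrow> real \<Rightarrow> 'a \<Rightarrow> real" where
  "ball_average u r x = (\<integral>y. u y * indicator (ball x r) y \<partial>lborel) / (unit_ball_vol DIM('a) * r ^ DIM('a))"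

lemma ball_average_measurable [measurable]:
  fixes u :: "'a::euclidean_space \<Rightarrow> real"
  assumes [measurable]: "u \<in> borel_measurable borel"
  shows "ball_average u r \<in> borel_measurable borel"
proof -
  have "(\<lambda>x. \<integral>y. u y * indicator (ball x r) y \<partial>lborel) \<in> borel_measurable (borel :: 'a measure)"
    by (rule lborel.borel_measurable_lebesgue_integral) measurable
  then show ?thesis unfolding ball_average_def[abs_def] by measurable
qed

lemma ball_average_deviation_le:
  fixes u :: "'a::euclidean_space \<Rightarrow> real" and p v :: real
  assumes "u \<in> borel_measurable borel" "\<And>x. \<bar>u x\<bar> \<le> M" "p \<ge> 1" "r > 0"
  shows "ennreal (unit_ball_vol DIM('a) * r ^ DIM('a) * \<bar>v - ball_average u r x\<bar> powr p)
    \<le> (\<integral>\<^sup>+y. ennreal (\<bar>v - u y\<bar> powr p) * indicator (ball x r) y \<partial>lborel)"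
  unfolding ball_average_def
  by (rule average_deviation_le[OF _ assms(1) _ _ assms(2,3)]) (use assms(4) in \<open>auto simp: emeasure_ball\<close>)

lemma ball_average_tendsto:
  fixes u :: "'a::euclidean_space \<Rightarrow> real"
  assumes u: "continuous_on UNIV u" "\<And>x. \<bar>u x\<bar> \<le> M" and r: "r \<longlonglongrightarrow> 0" "\<And>k. r k > 0"
  shows "(\<lambda>k. ball_average u (r k) x) \<longlonglongrightarrow> u x"
proof (rule LIMSEQ_I)
  fix e :: real assume e: "e > 0"
  have [measurable]: "u \<in> borel_measurable borel" by (rule borel_measurable_continuous_onI[OF u(1)])
  have "isCont u x" using u(1) by (simp add: continuous_on_eq_continuous_at)
  then obtain d where d: "d > 0" "\<And>y. dist y x < d \<Longrightarrow> dist (u y) (u x) < e / 2"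
    using e unfolding continuous_at_eps_delta by (metis half_gt_zero)
  obtain k0 where k0: "\<And>k. k \<ge> k0 \<Longrightarrow> r k < d"
    using LIMSEQ_D[OF r(1) d(1)] by force
  show "\<exists>no. \<forall>k\<ge>no. norm (ball_average u (r k) x - u x) < e"
  proof (intro exI[of _ k0] allI impI)
    fix k assume "k \<ge> k0"
    let ?V = "unit_ball_vol DIM('a) * r k ^ DIM('a)"
    have V: "?V > 0" using r(2)[of k] by simp
    have "ennreal (?V * \<bar>u x - ball_average u (r k) x\<bar> powr 1)
        \<le> (\<integral>\<^sup>+y. ennreal (\<bar>u x - u y\<bar> powr 1) * indicator (ball x (r k)) y \<partial>lborel)"
      by (rule ball_average_deviation_le[OF _ u(2)]) (use r(2) in auto)
    also have "\<dots> \<le> (\<integral>\<^sup>+y. ennreal (e / 2) * indicator (ball x (r k)) y \<partial>lborel)"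
    proof (intro nn_integral_mono)
      fix y
      show "ennreal (\<bar>u x - u y\<bar> powr 1) * indicator (ball x (r k)) y \<le> ennreal (e / 2) * indicator (ball x (r k)) y"
        using d(2)[of y] k0[OF \<open>k \<ge> k0\<close>]
        by (auto split: split_indicator intro!: ennreal_leI
            simp: dist_real_def dist_commute abs_minus_commute)
    qed
    also have "\<dots> = ennreal (e / 2 * ?V)"
    proof -
      have "(\<integral>\<^sup>+y. ennreal (e / 2) * indicator (ball x (r k)) y \<partial>lborel) = ennreal (e / 2) * ennreal ?V"
        using r(2)[of k] by (subst nn_integral_cmult_indicator) (auto simp: emeasure_ball)
      also have "\<dots> = ennreal (e / 2 * ?V)"
        by (rule ennreal_mult[symmetric]) (use e V in auto)
      finally show ?thesis .
    qed
    finally have "?V * \<bar>u x - ball_average u (r k) x\<bar> \<le> e / 2 * ?V"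
      using e V by (simp add: ennreal_le_iff)
    then have "\<bar>u x - ball_average u (r k) x\<bar> \<le> e / 2"
      using V by (simp only: mult.commute[of ?V] mult_le_cancel_right_pos)
    then show "norm (ball_average u (r k) x - u x) < e" using e by (simp add: abs_minus_commute)
  qed
qed

section \<open>Local energies\<close>

definition local_energy :: "real \<Rightarrow> real \<Rightarrow> ('a::euclidean_space \<Rightarrow> real) \<Rightarrow> real \<Rightarrow> 'a \<Rightarrow> ennreal" where
  "local_energy s p u r x = (\<integral>\<^sup>+y. \<integral>\<^sup>+z. ennreal (gagliardo_density s p u y z) *
      (indicator (ball x r) y * indicator (ball x r) z) \<partial>lborel \<partial>lborel)"

lemma local_energy_measurable [measurable]:
  fixes u :: "'a::euclidean_space \<Rightarrow> real"
  assumes [measurable]: "u \<in> borel_measurable borel"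
  shows "local_energy s p u r \<in> borel_measurable borel"
  unfolding local_energy_def[abs_def] by measurable

lemma local_energy_le:
  fixes u :: "'a::euclidean_space \<Rightarrow> real"
  assumes "u \<in> borel_measurable borel"
  shows "local_energy s p u r x \<le> gagliardo s p u"
  unfolding local_energy_def gagliardo_iterated[OF assms]
  by (intro nn_integral_mono) (auto split: split_indicator)

text \<open>Every pair of points lies in the balls of radius \<open>r\<close> whose centres fill at most a ball of
  radius \<open>r\<close>; integration over the centres replaces a covering argument.\<close>

lemma nn_integral_local_energy_le:
  fixes u :: "'a::euclidean_space \<Rightarrow> real"
  assumes [measurable]: "u \<in> borel_measurable borel" and "r > 0"
  shows "(\<integral>\<^sup>+x. local_energy s p u r x \<partial>lborel) \<le> ennreal (unit_ball_vol DIM('a) * r ^ DIM('a)) * gagliardo s p u"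
proof -
  let ?V = "ennreal (unit_ball_vol DIM('a) * r ^ DIM('a))"
  let ?g = "\<lambda>y z. ennreal (gagliardo_density s p u y z)"
  have "(\<integral>\<^sup>+x. local_energy s p u r x \<partial>lborel)
      \<le> (\<integral>\<^sup>+x. \<integral>\<^sup>+y. (\<integral>\<^sup>+z. ?g y z \<partial>lborel) * indicator (ball x r) y \<partial>lborel \<partial>lborel)"
    unfolding local_energy_def
  proof (intro nn_integral_mono)
    fix x y :: 'a
    have "(\<integral>\<^sup>+z. ?g y z * (indicator (ball x r) y * indicator (ball x r) z) \<partial>lborel)
        \<le> (\<integral>\<^sup>+z. ?g y z * indicator (ball x r) y \<partial>lborel)"
      by (intro nn_integral_mono) (auto split: split_indicator)
    also have "\<dots> = (\<integral>\<^sup>+z. ?g y z \<partial>lborel) * indicator (ball x r) y"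
      by (rule nn_integral_multc) measurable
    finally show "(\<integral>\<^sup>+z. ?g y z * (indicator (ball x r) y * indicator (ball x r) z) \<partial>lborel)
        \<le> (\<integral>\<^sup>+z. ?g y z \<partial>lborel) * indicator (ball x r) y" .
  qed
  also have "\<dots> = (\<integral>\<^sup>+y. \<integral>\<^sup>+x. (\<integral>\<^sup>+z. ?g y z \<partial>lborel) * indicator (ball x r) y \<partial>lborel \<partial>lborel)"
    by (rule lborel_pair.Fubini'[symmetric]) measurable
  also have "\<dots> = (\<integral>\<^sup>+y. (\<integral>\<^sup>+z. ?g y z \<partial>lborel) * ?V \<partial>lborel)"
  proof (rule nn_integral_cong)
    fix y :: 'a
    have "(\<integral>\<^sup>+x. (\<integral>\<^sup>+z. ?g y z \<partial>lborel) * indicator (ball x r) y \<partial>lborel)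
        = (\<integral>\<^sup>+x. (\<integral>\<^sup>+z. ?g y z \<partial>lborel) * indicator (ball y r) x \<partial>lborel)"
      by (intro nn_integral_cong) (auto split: split_indicator simp: dist_commute)
    also have "\<dots> = (\<integral>\<^sup>+z. ?g y z \<partial>lborel) * ?V"
      using \<open>r > 0\<close> by (subst nn_integral_cmult_indicator) (auto simp: emeasure_ball)
    finally show "(\<integral>\<^sup>+x. (\<integral>\<^sup>+z. ?g y z \<partial>lborel) * indicator (ball x r) y \<partial>lborel) = (\<integral>\<^sup>+z. ?g y z \<partial>lborel) * ?V" .
  qed
  also have "\<dots> = ?V * gagliardo s p u"
    unfolding gagliardo_iterated[OF assms(1)] by (subst nn_integral_multc) (measurable, rule mult.commute)
  finally show ?thesis .
qed

lemma nn_integral_pairs_le_local_energy: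
  fixes u :: "'a::euclidean_space \<Rightarrow> real" and s p r :: real
  assumes [measurable]: "u \<in> borel_measurable borel" and "p \<ge> 1" "s > 0" "r > 0"
  shows "(\<integral>\<^sup>+y. \<integral>\<^sup>+z. ennreal (\<bar>u y - u z\<bar> powr p) * (indicator (ball x r) y * indicator (ball x r) z) \<partial>lborel \<partial>lborel)
    \<le> ennreal ((2 * r) powr (real DIM('a) + s * p)) * local_energy s p u r x"
proof -
  let ?e = "real DIM('a) + s * p"
  have e: "?e \<ge> 0" using assms by simp
  have "ennreal (\<bar>u y - u z\<bar> powr p) * (indicator (ball x r) y * indicator (ball x r) z)
    \<le> ennreal ((2 * r) powr ?e) * (ennreal (gagliardo_density s p u y z) *
      (indicator (ball x r) y * indicator (ball x r) z))" for y z
  proof (cases "y \<in> ball x r \<and> z \<in> ball x r")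
    case True
    have "\<bar>u y - u z\<bar> powr p \<le> (2 * r) powr ?e * gagliardo_density s p u y z"
    proof (cases "y = z")
      case False
      have "norm (y - z) \<le> 2 * r"
        using True dist_triangle[of y z x] by (simp add: dist_norm[symmetric] dist_commute)
      then have "norm (y - z) powr ?e \<le> (2 * r) powr ?e" using e by (intro powr_mono2) auto
      then have "\<bar>u y - u z\<bar> powr p * norm (y - z) powr ?e \<le> \<bar>u y - u z\<bar> powr p * (2 * r) powr ?e"
        by (rule mult_left_mono) simp
      then show ?thesis
        using False by (simp add: gagliardo_density_def pos_le_divide_eq mult.commute)
    qed (use assms in \<open>simp add: gagliardo_density_nonneg\<close>)
    then show ?thesis
      using True by (simp add: gagliardo_density_nonneg ennreal_leI flip: ennreal_mult')
  qed (auto split: split_indicator)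
  then have "(\<integral>\<^sup>+y. \<integral>\<^sup>+z. ennreal (\<bar>u y - u z\<bar> powr p) * (indicator (ball x r) y * indicator (ball x r) z) \<partial>lborel \<partial>lborel)
    \<le> (\<integral>\<^sup>+y. \<integral>\<^sup>+z. ennreal ((2 * r) powr ?e) * (ennreal (gagliardo_density s p u y z) *
      (indicator (ball x r) y * indicator (ball x r) z)) \<partial>lborel \<partial>lborel)"
    by (intro nn_integral_mono)
  also have "\<dots> = ennreal ((2 * r) powr ?e) * local_energy s p u r x"
  proof -
    have 1: "(\<integral>\<^sup>+z. ennreal ((2 * r) powr ?e) * (ennreal (gagliardo_density s p u y z) *
          (indicator (ball x r) y * indicator (ball x r) z)) \<partial>lborel)
        = ennreal ((2 * r) powr ?e) * (\<integral>\<^sup>+z. ennreal (gagliardo_density s p u y z) *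
          (indicator (ball x r) y * indicator (ball x r) z) \<partial>lborel)" for y
      by (rule nn_integral_cmult) measurable
    show ?thesis
      unfolding local_energy_def 1 by (rule nn_integral_cmult) measurable
  qed
  finally show ?thesis .
qed

text \<open>Jensen's inequality replaces the average by an average of differences \<open>u y - u z\<close>, and on the ball
  the kernel is at least \<open>(2 * r) powr (- N - s p)\<close>.\<close>

lemma ball_average_Poincare:
  fixes u :: "'a::euclidean_space \<Rightarrow> real" and s p r :: real
  assumes [measurable]: "u \<in> borel_measurable borel" and "\<And>x. \<bar>u x\<bar> \<le> M" "p \<ge> 1" "s > 0" "r > 0"
  shows "ennreal (unit_ball_vol DIM('a) * r ^ DIM('a)) *
      (\<integral>\<^sup>+y. ennreal (\<bar>u y - ball_average u r x\<bar> powr p) * indicator (ball x r) y \<partial>lborel)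
    \<le> ennreal ((2 * r) powr (real DIM('a) + s * p)) * local_energy s p u r x"
proof -
  let ?V = "unit_ball_vol DIM('a) * r ^ DIM('a)"
  have "ennreal ?V * (\<integral>\<^sup>+y. ennreal (\<bar>u y - ball_average u r x\<bar> powr p) * indicator (ball x r) y \<partial>lborel)
      = (\<integral>\<^sup>+y. ennreal (?V * \<bar>u y - ball_average u r x\<bar> powr p) * indicator (ball x r) y \<partial>lborel)"
    using assms(5) by (subst nn_integral_cmult[symmetric]) (measurable, simp add: ennreal_mult mult.assoc)
  also have "\<dots> \<le> (\<integral>\<^sup>+y. (\<integral>\<^sup>+z. ennreal (\<bar>u y - u z\<bar> powr p) * indicator (ball x r) z \<partial>lborel) * indicator (ball x r) y \<partial>lborel)"
    by (intro nn_integral_mono mult_right_mono ball_average_deviation_le[OF assms(1,2,3,5)]) simp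
  also have "\<dots> = (\<integral>\<^sup>+y. \<integral>\<^sup>+z. ennreal (\<bar>u y - u z\<bar> powr p) * (indicator (ball x r) y * indicator (ball x r) z) \<partial>lborel \<partial>lborel)"
  proof (intro nn_integral_cong)
    fix y
    have "(\<integral>\<^sup>+z. ennreal (\<bar>u y - u z\<bar> powr p) * indicator (ball x r) z \<partial>lborel) * indicator (ball x r) y
        = (\<integral>\<^sup>+z. ennreal (\<bar>u y - u z\<bar> powr p) * indicator (ball x r) z * indicator (ball x r) y \<partial>lborel)"
      by (rule nn_integral_multc[symmetric]) measurable
    also have "\<dots> = (\<integral>\<^sup>+z. ennreal (\<bar>u y - u z\<bar> powr p) * (indicator (ball x r) y * indicator (ball x r) z) \<partial>lborel)"
      by (intro nn_integral_cong) (auto split: split_indicator)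
    finally show "(\<integral>\<^sup>+z. ennreal (\<bar>u y - u z\<bar> powr p) * indicator (ball x r) z \<partial>lborel) * indicator (ball x r) y
        = (\<integral>\<^sup>+z. ennreal (\<bar>u y - u z\<bar> powr p) * (indicator (ball x r) y * indicator (ball x r) z) \<partial>lborel)" .
  qed
  also have "\<dots> \<le> ennreal ((2 * r) powr (real DIM('a) + s * p)) * local_energy s p u r x"
    by (rule nn_integral_pairs_le_local_energy[OF assms(1,3,4,5)])
  finally show ?thesis .
qed

text \<open>The difference of the two averages is the average, over the smaller ball, of the deviation of \<open>u\<close>
  from its average over the larger one.\<close>

lemma ball_average_halving:
  fixes u :: "'a::euclidean_space \<Rightarrow> real" and s p r :: real
  assumes [measurable]: "u \<in> borel_measurable borel" and "\<And>x. \<bar>u x\<bar> \<le> M" "p \<ge> 1" "s > 0" "r > 0"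
  shows "ennreal (unit_ball_vol DIM('a) * r ^ DIM('a)) * ennreal (unit_ball_vol DIM('a) * (r / 2) ^ DIM('a)) *
      ennreal (\<bar>ball_average u (r / 2) x - ball_average u r x\<bar> powr p)
    \<le> ennreal ((2 * r) powr (real DIM('a) + s * p)) * local_energy s p u r x"
proof -
  let ?V = "unit_ball_vol DIM('a) * r ^ DIM('a)" and ?W = "unit_ball_vol DIM('a) * (r / 2) ^ DIM('a)"
  have "ennreal (?W * \<bar>ball_average u r x - ball_average u (r / 2) x\<bar> powr p)
      \<le> (\<integral>\<^sup>+y. ennreal (\<bar>ball_average u r x - u y\<bar> powr p) * indicator (ball x (r / 2)) y \<partial>lborel)"
    using assms(5) by (intro ball_average_deviation_le[OF assms(1,2,3)]) simp
  also have "\<dots> \<le> (\<integral>\<^sup>+y. ennreal (\<bar>u y - ball_average u r x\<bar> powr p) * indicator (ball x r) y \<partial>lborel)"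
    using assms(5) by (intro nn_integral_mono) (auto split: split_indicator simp: abs_minus_commute)
  finally have "ennreal ?V * ennreal (?W * \<bar>ball_average u r x - ball_average u (r / 2) x\<bar> powr p)
      \<le> ennreal ?V * (\<integral>\<^sup>+y. ennreal (\<bar>u y - ball_average u r x\<bar> powr p) * indicator (ball x r) y \<partial>lborel)"
    by (rule mult_left_mono) simp
  also have "\<dots> \<le> ennreal ((2 * r) powr (real DIM('a) + s * p)) * local_energy s p u r x"
    by (rule ball_average_Poincare[OF assms])
  finally show ?thesis
    using assms(5) by (simp add: ennreal_mult' mult.assoc abs_minus_commute)
qed

text \<open>Since \<open>q \<ge> p\<close>, the local energy may be raised to the power \<open>q / p\<close> by bounding all but one factor by
  the total energy \<open>G\<close>; the remaining factor is integrated over the centres.\<close>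

lemma nn_integral_powr_le_local_energy:
  fixes u :: "'a::euclidean_space \<Rightarrow> real" and f :: "'a \<Rightarrow> real" and s p q c r G :: real
  assumes [measurable]: "u \<in> borel_measurable borel" and "r > 0" "p \<ge> 1" "p \<le> q" "c \<ge> 0"
    and G: "gagliardo s p u = ennreal G" "G \<ge> 0"
    and f: "\<And>x. ennreal (\<bar>f x\<bar> powr p) \<le> ennreal c * local_energy s p u r x"
  shows "(\<integral>\<^sup>+x. ennreal (\<bar>f x\<bar> powr q) \<partial>lborel)
    \<le> ennreal (c powr (q / p) * (unit_ball_vol DIM('a) * r ^ DIM('a)) * G powr (q / p))"
proof -
  let ?V = "unit_ball_vol DIM('a) * r ^ DIM('a)"
  have V: "?V \<ge> 0" using assms(2) by simp
  have pw: "ennreal (\<bar>f x\<bar> powr q) \<le> ennreal (c powr (q / p) * G powr (q / p - 1)) * local_energy s p u r x" for x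
  proof -
    have le: "local_energy s p u r x \<le> ennreal G" using local_energy_le[OF assms(1)] G(1) by metis
    then obtain d where d: "local_energy s p u r x = ennreal d" "d \<ge> 0" "d \<le> G"
      using G(2) by (cases "local_energy s p u r x") (auto simp: top_unique)
    have "\<bar>f x\<bar> powr p \<le> c * d"
      using f[of x] d assms(5) by (simp add: ennreal_le_iff flip: ennreal_mult)
    then have "(\<bar>f x\<bar> powr p) powr (q / p) \<le> (c * d) powr (q / p)"
      using assms(3,4) by (intro powr_mono2) auto
    then have "\<bar>f x\<bar> powr q \<le> c powr (q / p) * d powr (q / p)"
      using assms(3,5) d by (simp add: powr_powr powr_mult)
    also have "d powr (q / p) = d powr (q / p - 1) * d"
      using d by (cases "d = 0") (auto simp: powr_diff)
    also have "\<dots> \<le> G powr (q / p - 1) * d"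
      using d assms(3,4) by (intro mult_right_mono powr_mono2) auto
    finally have "\<bar>f x\<bar> powr q \<le> c powr (q / p) * G powr (q / p - 1) * d"
      by (simp add: mult_left_mono mult.assoc)
    then show ?thesis
      unfolding d(1) using d(2) by (subst ennreal_mult[symmetric]) (auto intro!: ennreal_leI)
  qed
  have "(\<integral>\<^sup>+x. ennreal (\<bar>f x\<bar> powr q) \<partial>lborel)
      \<le> (\<integral>\<^sup>+x. ennreal (c powr (q / p) * G powr (q / p - 1)) * local_energy s p u r x \<partial>lborel)"
    by (intro nn_integral_mono pw)
  also have "\<dots> = ennreal (c powr (q / p) * G powr (q / p - 1)) * (\<integral>\<^sup>+x. local_energy s p u r x \<partial>lborel)"
    by (rule nn_integral_cmult) measurable
  also have "\<dots> \<le> ennreal (c powr (q / p) * G powr (q / p - 1)) * (ennreal ?V * ennreal G)"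
    using nn_integral_local_energy_le[OF assms(1,2), of s p] G(1) by (intro mult_left_mono) auto
  also have "\<dots> = ennreal (c powr (q / p) * G powr (q / p - 1) * (?V * G))"
    using V G(2) by (simp add: ennreal_mult)
  also have "c powr (q / p) * G powr (q / p - 1) * (?V * G) = c powr (q / p) * ?V * G powr (q / p)"
    using G(2) assms(3,4) by (cases "G = 0") (auto simp: powr_diff)
  finally show ?thesis .
qed

section \<open>A Sobolev inequality from control of the averages\<close>

text \<open>Jensen's inequality for \<open>t i / w i\<close> with weights \<open>w i\<close>: a substitute for Minkowski's inequality in
  \<open>L\<^sup>q\<close> that can be integrated term by term.\<close>

lemma powr_sum_le_weighted:
  fixes t w :: "nat \<Rightarrow> real" and q :: real
  assumes "q \<ge> 1" "\<And>i. t i \<ge> 0" "\<And>i. w i > 0"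
  shows "(\<Sum>i\<le>n. t i) powr q \<le> (\<Sum>i\<le>n. w i) powr (q - 1) * (\<Sum>i\<le>n. w i powr (1 - q) * t i powr q)"
proof (induction n)
  case 0
  then show ?case using assms(3)[of 0] by (simp flip: powr_add mult.assoc)
next
  case (Suc n)
  let ?S = "\<Sum>i\<le>n. t i" and ?W = "\<Sum>i\<le>n. w i" and ?Q = "\<Sum>i\<le>n. w i powr (1 - q) * t i powr q"
  have W: "?W > 0" using assms(3) by (intro sum_pos) auto
  have w: "w (Suc n) > 0" by (rule assms(3))
  have "(?S + t (Suc n)) powr q \<le> (?W + w (Suc n)) powr q *
      (?W / (?W + w (Suc n)) * (?S powr q / ?W powr q) +
       w (Suc n) / (?W + w (Suc n)) * (t (Suc n) powr q / w (Suc n) powr q))"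
    using assms by (intro powr_convex_combination[OF assms(1) _ _ W w] sum_nonneg) auto
  also have "\<dots> = (?W + w (Suc n)) powr (q - 1) *
      (?W powr (1 - q) * ?S powr q + w (Suc n) powr (1 - q) * t (Suc n) powr q)"
  proof -
    have A: "B powr q * (a / B * (b / a powr q)) = B powr (q - 1) * (a powr (1 - q) * b)"
      if "B > 0" "a > 0" for a b B :: real
      using that by (simp add: powr_diff)
    show ?thesis
      unfolding distrib_left using W w by (simp only: A add_pos_pos)
  qed
  also have "\<dots> \<le> (?W + w (Suc n)) powr (q - 1) * (?Q + w (Suc n) powr (1 - q) * t (Suc n) powr q)"
  proof (intro mult_left_mono add_right_mono)
    have "?W powr (1 - q) * ?S powr q \<le> ?W powr (1 - q) * (?W powr (q - 1) * ?Q)"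
      by (intro mult_left_mono Suc) simp
    also have "\<dots> = ?Q" using W by (simp flip: powr_add mult.assoc)
    finally show "?W powr (1 - q) * ?S powr q \<le> ?Q" .
  qed simp
  finally show ?case by simp
qed

text \<open>The function is the limit of its averages over balls of radius \<open>R / 2 ^ k\<close>, and each
  difference of consecutive averages is controlled pointwise by the local energy. Integrated, the
  \<open>k\<close>-th difference contributes \<open>(R / 2 ^ k) powr ((s p - N) q / p + N)\<close>; this exponent is positive
  precisely for subcritical \<open>q\<close>, so that the contributions form a convergent geometric series.\<close>

lemma Lq_le_gagliardo_if_average_le:
  fixes s p q R c0 :: real
  assumes ps: "1 \<le> p" "0 < s" "s < 1" and pq: "p \<le> q" and sub: "0 < s * p - real DIM('a) + real DIM('a) * p / q"
    and R: "R > 0" and c0: "c0 \<ge> 0"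
  obtains C where "C \<ge> 0"
    "\<And>u :: 'a::euclidean_space \<Rightarrow> real. u \<in> test_functions UNIV \<Longrightarrow>
      (\<And>x. ennreal (\<bar>ball_average u R x\<bar> powr p) \<le> ennreal c0 * local_energy s p u R x) \<Longrightarrow>
      (\<integral>\<^sup>+x. ennreal (\<bar>u x\<bar> powr q) \<partial>lborel) \<le> ennreal (C * enn2real (gagliardo s p u) powr (q / p))"
proof -
  let ?N = "real DIM('a)"
  define V where "V = unit_ball_vol ?N"
  have V: "V > 0" by (simp add: V_def)
  have q: "q \<ge> 1" "q > 0" using ps pq by auto
  define \<theta> where "\<theta> = (s * p - ?N + ?N * p / q) / p"
  have \<theta>: "\<theta> > 0" using sub ps by (simp add: \<theta>_def)
  have \<theta>q: "(s * p - ?N) * (q / p) + ?N = \<theta> * q"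
  proof -
    have "\<theta> * q = (s * p - ?N + ?N * p / q) * (q / p)" by (simp add: \<theta>_def)
    also have "\<dots> = (s * p - ?N) * (q / p) + ?N * p / q * (q / p)" by (rule distrib_right)
    also have "?N * p / q * (q / p) = ?N" using ps q by simp
    finally show ?thesis by simp
  qed
  define \<rho> where "\<rho> k = R * 2 powr (- real k)" for k :: nat
  have \<rho>: "\<rho> k > 0" "\<rho> (Suc k) = \<rho> k / 2" "\<rho> 0 = R" for k
  proof -
    show "\<rho> k > 0" "\<rho> 0 = R" using R by (simp_all add: \<rho>_def)
    have "- real (Suc k) = - real k - 1" by simp
    then show "\<rho> (Suc k) = \<rho> k / 2" by (simp only: \<rho>_def powr_diff) simp
  qed
  have \<rho>0: "\<rho> \<longlonglongrightarrow> 0"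
  proof -
    have "(\<lambda>k. R * (1 / 2) ^ k) \<longlonglongrightarrow> R * 0"
      by (intro tendsto_mult tendsto_const LIMSEQ_power_zero) simp
    moreover have "\<rho> = (\<lambda>k. R * (1 / 2) ^ k)"
      by (rule ext) (simp add: \<rho>_def powr_minus powr_realpow power_one_over inverse_eq_divide)
    ultimately show ?thesis by simp
  qed
  define K where "K = 2 powr (?N + s * p) * 2 ^ DIM('a) / V\<^sup>2"
  have K: "K \<ge> 0" using V by (simp add: K_def)
  define w where "w k = (case k of 0 \<Rightarrow> 1 | Suc j \<Rightarrow> 2 powr (- \<theta> * real j))" for k
  have w: "w k > 0" for k by (simp add: w_def split: nat.split)
  define b where "b k = (case k of 0 \<Rightarrow> c0 powr (q / p) * (V * R ^ DIM('a))
      | Suc j \<Rightarrow> (K * \<rho> j powr (s * p - ?N)) powr (q / p) * (V * \<rho> j ^ DIM('a)))" for k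
  have b: "b k \<ge> 0" for k using V R \<rho>(1) by (simp add: b_def less_imp_le split: nat.split)
  have sw: "summable w"
    by (subst summable_Suc_iff[symmetric]) (use summable_powr2[of "-\<theta>" 1] \<theta> in \<open>simp add: w_def\<close>)
  define B where "B = K powr (q / p) * V * R powr (\<theta> * q)"
  have bS: "b (Suc j) = B * 2 powr (- \<theta> * q * real j)" for j
  proof -
    have "(K * \<rho> j powr (s * p - ?N)) powr (q / p) * (V * \<rho> j ^ DIM('a))
        = K powr (q / p) * V * (\<rho> j powr ((s * p - ?N) * (q / p)) * \<rho> j powr ?N)"
      using K \<rho>(1)[of j] by (simp add: powr_mult powr_powr powr_realpow)
    also have "\<rho> j powr ((s * p - ?N) * (q / p)) * \<rho> j powr ?N = \<rho> j powr (\<theta> * q)"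
      by (simp only: powr_add[symmetric] \<theta>q)
    also have "\<rho> j powr (\<theta> * q) = R powr (\<theta> * q) * 2 powr (- \<theta> * q * real j)"
      using R by (simp add: \<rho>_def powr_mult powr_powr mult_ac)
    finally show ?thesis by (simp add: b_def B_def)
  qed
  have sb: "summable (\<lambda>k. w k powr (1 - q) * b k)"
  proof (subst summable_Suc_iff[symmetric])
    have "w (Suc j) powr (1 - q) * b (Suc j) = B * 2 powr (- \<theta> * real j)" for j
    proof -
      have "w (Suc j) powr (1 - q) * b (Suc j)
          = B * (2 powr ((- \<theta> * real j) * (1 - q)) * 2 powr (- \<theta> * q * real j))"
        by (simp add: bS w_def powr_powr)
      also have "2 powr ((- \<theta> * real j) * (1 - q)) * 2 powr (- \<theta> * q * real j) = (2::real) powr (- \<theta> * real j)"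
        by (simp add: powr_add[symmetric] algebra_simps)
      finally show ?thesis .
    qed
    then show "summable (\<lambda>j. w (Suc j) powr (1 - q) * b (Suc j))"
      by (simp only:) (rule summable_powr2, use \<theta> in simp)
  qed
  define C where "C = (\<Sum>k. w k) powr (q - 1) * (\<Sum>k. w k powr (1 - q) * b k)"
  show ?thesis
  proof (rule that[of C])
    show "C \<ge> 0" unfolding C_def using b by (intro mult_nonneg_nonneg suminf_nonneg sb) auto
  next
    fix u :: "'a \<Rightarrow> real"
    assume u: "u \<in> test_functions UNIV"
      and av: "\<And>x. ennreal (\<bar>ball_average u R x\<bar> powr p) \<le> ennreal c0 * local_energy s p u R x"
    note [measurable] = test_functions_borel[OF u]
    obtain M where M: "M \<ge> 0" "\<And>x. \<bar>u x\<bar> \<le> M" using test_functions_bounded[OF u] by blast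
    define G where "G = enn2real (gagliardo s p u)"
    have G: "gagliardo s p u = ennreal G" "G \<ge> 0"
      using gagliardo_finite[OF ps u] by (auto simp: G_def)
    define t where "t x k = (case k of 0 \<Rightarrow> \<bar>ball_average u R x\<bar>
        | Suc j \<Rightarrow> \<bar>ball_average u (\<rho> (Suc j)) x - ball_average u (\<rho> j) x\<bar>)" for x k
    have [measurable]: "(\<lambda>x. t x k) \<in> borel_measurable borel" for k
      by (cases k) (auto simp: t_def)
    have t0: "t x k \<ge> 0" for x k by (simp add: t_def split: nat.split)
    have tsum: "\<bar>ball_average u (\<rho> n) x\<bar> \<le> (\<Sum>k\<le>n. t x k)" for n x
    proof (induction n)
      case (Suc n)
      then show ?case by (simp add: t_def)
    qed (simp add: t_def \<rho>)
    have tint: "(\<integral>\<^sup>+x. ennreal (t x k powr q) \<partial>lborel) \<le> ennreal (b k * G powr (q / p))" for k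
    proof (cases k)
      case 0
      show ?thesis
        unfolding 0 t_def b_def V_def nat.case
        by (rule nn_integral_powr_le_local_energy[OF _ R ps(1) pq c0 G av]) measurable
    next
      case (Suc j)
      have "ennreal (\<bar>ball_average u (\<rho> (Suc j)) x - ball_average u (\<rho> j) x\<bar> powr p)
          \<le> ennreal (K * \<rho> j powr (s * p - ?N)) * local_energy s p u (\<rho> j) x" for x
      proof -
        let ?d = "ennreal (\<bar>ball_average u (\<rho> (Suc j)) x - ball_average u (\<rho> j) x\<bar> powr p)"
        define E where "E = (V * \<rho> j ^ DIM('a)) * (V * (\<rho> j / 2) ^ DIM('a))"
        have E: "E > 0" using V \<rho>(1)[of j] by (simp add: E_def)
        have "ennreal E * ?d \<le> ennreal ((2 * \<rho> j) powr (?N + s * p)) * local_energy s p u (\<rho> j) x"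
          using ball_average_halving[OF test_functions_borel[OF u] M(2) ps(1,2) \<rho>(1)[of j], where x=x] V \<rho>(1)[of j]
          by (simp add: E_def V_def \<rho>(2) ennreal_mult)
        then have "ennreal (1 / E) * (ennreal E * ?d)
            \<le> ennreal (1 / E) * (ennreal ((2 * \<rho> j) powr (?N + s * p)) * local_energy s p u (\<rho> j) x)"
          by (rule mult_left_mono) simp
        moreover have "ennreal (1 / E) * (ennreal E * ?d) = ?d"
          using E by (simp flip: ennreal_mult mult.assoc)
        moreover have "ennreal (1 / E) * (ennreal ((2 * \<rho> j) powr (?N + s * p)) * local_energy s p u (\<rho> j) x)
            = ennreal (1 / E * (2 * \<rho> j) powr (?N + s * p)) * local_energy s p u (\<rho> j) x"
          using E by (subst ennreal_mult) (auto simp: mult.assoc)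
        moreover have "1 / E * (2 * \<rho> j) powr (?N + s * p) = K * \<rho> j powr (s * p - ?N)"
        proof -
          have "E = V\<^sup>2 / 2 ^ DIM('a) * \<rho> j powr (2 * ?N)"
          proof -
            have "\<rho> j powr (2 * ?N) = \<rho> j powr (?N + ?N)" by simp
            also have "\<dots> = \<rho> j ^ DIM('a) * \<rho> j ^ DIM('a)"
              unfolding powr_add using \<rho>(1)[of j] by (simp add: powr_realpow)
            finally show ?thesis by (simp add: E_def power2_eq_square power_divide)
          qed
          then have "1 / E * (2 * \<rho> j) powr (?N + s * p)
              = K * (\<rho> j powr (?N + s * p) / \<rho> j powr (2 * ?N))"
            using \<rho>(1)[of j] by (simp add: K_def powr_mult)
          also have "\<rho> j powr (?N + s * p) / \<rho> j powr (2 * ?N) = \<rho> j powr (s * p - ?N)"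
            by (simp add: powr_diff[symmetric])
          finally show ?thesis .
        qed
        ultimately show ?thesis by simp
      qed
      then have "(\<integral>\<^sup>+x. ennreal (\<bar>ball_average u (\<rho> (Suc j)) x - ball_average u (\<rho> j) x\<bar> powr q) \<partial>lborel)
          \<le> ennreal ((K * \<rho> j powr (s * p - ?N)) powr (q / p) * (unit_ball_vol ?N * \<rho> j ^ DIM('a)) * G powr (q / p))"
        by (intro nn_integral_powr_le_local_energy[OF _ \<rho>(1) ps(1) pq _ G]) (use K in auto)
      then show ?thesis by (simp add: Suc t_def b_def V_def)
    qed
    have avq: "(\<integral>\<^sup>+x. ennreal (\<bar>ball_average u (\<rho> n) x\<bar> powr q) \<partial>lborel) \<le> ennreal (C * G powr (q / p))" for n
    proof -
      define W where "W = (\<Sum>k\<le>n. w k) powr (q - 1)"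
      have W: "W \<ge> 0" by (simp add: W_def)
      have "(\<integral>\<^sup>+x. ennreal (\<bar>ball_average u (\<rho> n) x\<bar> powr q) \<partial>lborel)
          \<le> (\<integral>\<^sup>+x. (\<Sum>k\<le>n. ennreal (W * w k powr (1 - q)) * ennreal (t x k powr q)) \<partial>lborel)"
      proof (rule nn_integral_mono)
        fix x
        have "\<bar>ball_average u (\<rho> n) x\<bar> powr q \<le> (\<Sum>k\<le>n. t x k) powr q"
          using tsum q by (intro powr_mono2) auto
        also have "\<dots> \<le> W * (\<Sum>k\<le>n. w k powr (1 - q) * t x k powr q)"
          unfolding W_def by (rule powr_sum_le_weighted[OF q(1) t0 w])
        also have "\<dots> = (\<Sum>k\<le>n. W * w k powr (1 - q) * t x k powr q)"
          by (simp add: sum_distrib_left mult.assoc)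
        finally have "ennreal (\<bar>ball_average u (\<rho> n) x\<bar> powr q) \<le> ennreal (\<Sum>k\<le>n. W * w k powr (1 - q) * t x k powr q)"
          by (rule ennreal_leI)
        also have "\<dots> = (\<Sum>k\<le>n. ennreal (W * w k powr (1 - q) * t x k powr q))"
          using W by (intro sum_ennreal[symmetric]) auto
        also have "\<dots> = (\<Sum>k\<le>n. ennreal (W * w k powr (1 - q)) * ennreal (t x k powr q))"
          using W by (intro sum.cong refl ennreal_mult) auto
        finally show "ennreal (\<bar>ball_average u (\<rho> n) x\<bar> powr q)
            \<le> (\<Sum>k\<le>n. ennreal (W * w k powr (1 - q)) * ennreal (t x k powr q))" .
      qed
      also have "\<dots> = (\<Sum>k\<le>n. \<integral>\<^sup>+x. ennreal (W * w k powr (1 - q)) * ennreal (t x k powr q) \<partial>lborel)"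
        by (rule nn_integral_sum) measurable
      also have "\<dots> \<le> (\<Sum>k\<le>n. ennreal (W * w k powr (1 - q) * (b k * G powr (q / p))))"
      proof (rule sum_mono)
        fix k
        have "(\<integral>\<^sup>+x. ennreal (W * w k powr (1 - q)) * ennreal (t x k powr q) \<partial>lborel)
            = ennreal (W * w k powr (1 - q)) * (\<integral>\<^sup>+x. ennreal (t x k powr q) \<partial>lborel)"
          by (rule nn_integral_cmult) measurable
        also have "\<dots> \<le> ennreal (W * w k powr (1 - q)) * ennreal (b k * G powr (q / p))"
          by (rule mult_left_mono[OF tint]) simp
        also have "\<dots> = ennreal (W * w k powr (1 - q) * (b k * G powr (q / p)))"
          using W b by (intro ennreal_mult[symmetric]) auto
        finally show "(\<integral>\<^sup>+x. ennreal (W * w k powr (1 - q)) * ennreal (t x k powr q) \<partial>lborel)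
            \<le> ennreal (W * w k powr (1 - q) * (b k * G powr (q / p)))" .
      qed
      also have "\<dots> = ennreal (\<Sum>k\<le>n. W * w k powr (1 - q) * (b k * G powr (q / p)))"
        using W b by (intro sum_ennreal) auto
      also have "(\<Sum>k\<le>n. W * w k powr (1 - q) * (b k * G powr (q / p)))
          = W * (\<Sum>k\<le>n. w k powr (1 - q) * b k) * G powr (q / p)"
        by (simp add: sum_distrib_left sum_distrib_right mult.assoc)
      also have "\<dots> \<le> C * G powr (q / p)"
      proof (rule mult_right_mono)
        have "(\<Sum>k\<le>n. w k) \<le> (\<Sum>k. w k)"
          using w by (intro sum_le_suminf sw) (auto intro: less_imp_le)
        moreover have "0 \<le> (\<Sum>k\<le>n. w k)" using w by (intro sum_nonneg) (auto intro: less_imp_le)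
        ultimately have "W \<le> (\<Sum>k. w k) powr (q - 1)"
          unfolding W_def using q by (intro powr_mono2) auto
        moreover have "(\<Sum>k\<le>n. w k powr (1 - q) * b k) \<le> (\<Sum>k. w k powr (1 - q) * b k)"
          using b by (intro sum_le_suminf sb) auto
        ultimately show "W * (\<Sum>k\<le>n. w k powr (1 - q) * b k) \<le> C"
          unfolding C_def using b by (intro mult_mono sum_nonneg) auto
      qed simp
      finally show ?thesis by (simp add: ennreal_leI)
    qed
    have lim: "(\<lambda>n. ennreal (\<bar>ball_average u (\<rho> n) x\<bar> powr q)) \<longlonglongrightarrow> ennreal (\<bar>u x\<bar> powr q)" for x
      using q ball_average_tendsto[OF test_functions_continuous[OF u] M(2) \<rho>0 \<rho>(1), of x]
      by (intro tendsto_ennrealI tendsto_powr' tendsto_rabs) auto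
    have "(\<integral>\<^sup>+x. ennreal (\<bar>u x\<bar> powr q) \<partial>lborel)
        = (\<integral>\<^sup>+x. liminf (\<lambda>n. ennreal (\<bar>ball_average u (\<rho> n) x\<bar> powr q)) \<partial>lborel)"
      by (intro nn_integral_cong lim_imp_Liminf[symmetric] lim) simp
    also have "\<dots> \<le> liminf (\<lambda>n. \<integral>\<^sup>+x. ennreal (\<bar>ball_average u (\<rho> n) x\<bar> powr q) \<partial>lborel)"
      by (rule nn_integral_liminf) measurable
    also have "\<dots> \<le> ennreal (C * G powr (q / p))"
      using avq by (intro Liminf_le) auto
    finally show "(\<integral>\<^sup>+x. ennreal (\<bar>u x\<bar> powr q) \<partial>lborel) \<le> ennreal (C * enn2real (gagliardo s p u) powr (q / p))"
      by (simp add: G_def)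
  qed
qed

section \<open>Averages of functions vanishing on a set of large capacity\<close>

lemma cutoff_translate: "cutoff c a b x = cutoff 0 a b (x - c)"
  by (simp add: cutoff_def dist_norm)

lemma cutoff_modulus:
  assumes "0 \<le> a" "a < b"
  obtains L where "L > 0"
    "\<And>(c::'a::euclidean_space) x y. \<bar>cutoff c a b x - cutoff c a b y\<bar> \<le> L * min 1 (norm (x - y))"
proof -
  have "cutoff (0::'a) a b \<in> test_functions UNIV"
    by (rule test_functions_cutoff) (use assms in auto)
  then obtain L where L: "L > 0" "\<And>x y::'a. \<bar>cutoff 0 a b x - cutoff 0 a b y\<bar> \<le> L * norm (x - y)"
    using test_functions_Lipschitz by blast
  have "\<bar>cutoff c a b x - cutoff c a b y\<bar> \<le> (1 + L) * min 1 (norm (x - y))" for c x y :: 'a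
  proof -
    have 1: "\<bar>cutoff c a b x - cutoff c a b y\<bar> \<le> 1"
      using cutoff_range[of c a b x] cutoff_range[of c a b y] by linarith
    have 2: "\<bar>cutoff c a b x - cutoff c a b y\<bar> \<le> L * norm (x - y)"
      using L(2)[of "x - c" "y - c"] by (simp add: cutoff_translate[of c])
    have 3: "L * norm (x - y) \<le> (1 + L) * norm (x - y)" by (intro mult_right_mono) auto
    show ?thesis using 1 2 3 L(1) by (auto simp: min_def)
  qed
  then show ?thesis using that[of "1 + L"] L(1) by auto
qed

lemma powr_add_le: "a \<ge> 0 \<Longrightarrow> b \<ge> 0 \<Longrightarrow> p \<ge> 0 \<Longrightarrow> (a + b) powr p \<le> 2 powr p * (a powr p + b powr p)"
  for a b p :: real
proof -
  assume ab: "a \<ge> 0" "b \<ge> 0" "p \<ge> 0"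
  have "(a + b) powr p \<le> (2 * max a b) powr p" using ab by (intro powr_mono2) auto
  also have "\<dots> = 2 powr p * max a b powr p" using ab by (simp add: powr_mult)
  also have "max a b powr p \<le> a powr p + b powr p" by (auto simp: max_def)
  finally show ?thesis by (simp add: mult_left_mono)
qed

text \<open>Localisation: the energy of \<open>\<eta> v\<close> is controlled by quantities on the ball containing the
  support of \<open>\<eta>\<close>.\<close>

lemma gagliardo_cutoff_mult_le:
  fixes s p r :: real
  assumes ps: "1 \<le> p" "0 < s" "s < 1" and r: "r > 0"
  obtains C where "C \<ge> 0"
    "\<And>(c::'a::euclidean_space) v. v \<in> borel_measurable borel \<Longrightarrow>
      gagliardo s p (\<lambda>x. cutoff c r (3 / 2 * r) x * v x) \<le> ennreal C *
        (local_energy s p v (2 * r) c + (\<integral>\<^sup>+x. ennreal (\<bar>v x\<bar> powr p) * indicator (ball c (2 * r)) x \<partial>lborel))"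
proof -
  obtain L where L: "L > 0"
    "\<And>(c::'a) x y. \<bar>cutoff c r (3 / 2 * r) x - cutoff c r (3 / 2 * r) y\<bar> \<le> L * min 1 (norm (x - y))"
    using cutoff_modulus[of r "3 / 2 * r"] r by auto
  let ?e = "real DIM('a) + s * p"
  obtain m where m: "kernel_mass s p TYPE('a) = ennreal m" "m \<ge> 0"
    using kernel_mass_finite[OF ps, where 'a='a] by (cases "kernel_mass s p TYPE('a)") auto
  define C where "C = 2 powr p * (1 + 2 * (L powr p * m))"
  show ?thesis
  proof (rule that[of C])
    show "C \<ge> 0" using m by (simp add: C_def)
    fix c :: 'a and v :: "'a \<Rightarrow> real"
    assume [measurable]: "v \<in> borel_measurable borel"
    let ?B = "ball c (2 * r)"
    let ?\<eta> = "cutoff c r (3 / 2 * r)"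
    have [measurable]: "?\<eta> \<in> borel_measurable borel"
      using Ck_cutoff[of 0 c] by (intro borel_measurable_continuous_onI) (simp only: Ck.simps)
    have \<eta>0: "?\<eta> x = 0" if "x \<notin> ?B" for x
      using that r by (intro cutoff_eq_0) (auto simp: dist_commute)
    define H where "H x y = ennreal (L powr p) * ennreal (min 1 (norm (x - y)) powr p / norm (x - y) powr ?e)"
      for x y :: 'a
    have [measurable]: "(\<lambda>(x, y). H x y) \<in> borel_measurable (lborel \<Otimes>\<^sub>M lborel)"
      unfolding H_def by measurable
    have Hint: "(\<integral>\<^sup>+y. H x y \<partial>lborel) = ennreal (L powr p * m)" "(\<integral>\<^sup>+y. H y x \<partial>lborel) = ennreal (L powr p * m)" for x
    proof -
      have "(\<integral>\<^sup>+y. H x y \<partial>lborel) = ennreal (L powr p) * kernel_mass s p TYPE('a)"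
        unfolding H_def by (subst nn_integral_cmult; simp add: kernel_mass_translate)
      moreover have "(\<integral>\<^sup>+y. H y x \<partial>lborel) = ennreal (L powr p) * kernel_mass s p TYPE('a)"
        unfolding H_def by (subst nn_integral_cmult; simp add: kernel_mass_translate)
      ultimately show "(\<integral>\<^sup>+y. H x y \<partial>lborel) = ennreal (L powr p * m)" "(\<integral>\<^sup>+y. H y x \<partial>lborel) = ennreal (L powr p * m)"
        using m by (simp_all add: ennreal_mult)
    qed
    have dH: "ennreal (\<bar>?\<eta> x - ?\<eta> y\<bar> powr p / norm (x - y) powr ?e) \<le> H x y" for x y
    proof -
      have "\<bar>?\<eta> x - ?\<eta> y\<bar> powr p \<le> (L * min 1 (norm (x - y))) powr p"
        using L(2)[of c x y] ps by (intro powr_mono2) auto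
      also have "\<dots> = L powr p * min 1 (norm (x - y)) powr p" using L(1) by (simp add: powr_mult)
      finally have "\<bar>?\<eta> x - ?\<eta> y\<bar> powr p / norm (x - y) powr ?e
          \<le> L powr p * (min 1 (norm (x - y)) powr p / norm (x - y) powr ?e)"
        unfolding times_divide_eq_right by (rule divide_right_mono) simp
      then show ?thesis
        unfolding H_def by (subst ennreal_mult[symmetric]) (auto intro: ennreal_leI)
    qed
    define P where "P x y = ennreal (gagliardo_density s p v x y) * (indicator ?B x * indicator ?B y)" for x y
    define Q where "Q x = ennreal (\<bar>v x\<bar> powr p) * indicator ?B x" for x
    have [measurable]: "(\<lambda>(x, y). P x y) \<in> borel_measurable (lborel \<Otimes>\<^sub>M lborel)"
      "Q \<in> borel_measurable borel"
      unfolding P_def Q_def by measurable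
    let ?d = "gagliardo_density s p (\<lambda>x. ?\<eta> x * v x)"
    \<comment> \<open>the product rule; \<open>y\<close> is the point at which \<open>v\<close> is not evaluated in the second term\<close>
    have prod: "ennreal (?d x y) \<le> ennreal (2 powr p) * (P x y + Q x * H x y)" if "x \<in> ?B" for x y
    proof -
      have "\<bar>?\<eta> x * v x - ?\<eta> y * v y\<bar> \<le> ?\<eta> y * \<bar>v x - v y\<bar> + \<bar>v x\<bar> * \<bar>?\<eta> x - ?\<eta> y\<bar>"
      proof -
        have "?\<eta> x * v x - ?\<eta> y * v y = ?\<eta> y * (v x - v y) + v x * (?\<eta> x - ?\<eta> y)"
          by (simp add: algebra_simps)
        then show ?thesis
          using cutoff_range(1)[of c r _ y] by (metis abs_mult abs_of_nonneg abs_triangle_ineq)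
      qed
      also have "?\<eta> y * \<bar>v x - v y\<bar> \<le> indicator ?B y * \<bar>v x - v y\<bar>"
        using cutoff_range(2)[of c r _ y] \<eta>0[of y] by (intro mult_right_mono) (auto split: split_indicator)
      finally have "\<bar>?\<eta> x * v x - ?\<eta> y * v y\<bar> powr p
          \<le> (indicator ?B y * \<bar>v x - v y\<bar> + \<bar>v x\<bar> * \<bar>?\<eta> x - ?\<eta> y\<bar>) powr p"
        using ps by (intro powr_mono2) auto
      also have "\<dots> \<le> 2 powr p * ((indicator ?B y * \<bar>v x - v y\<bar>) powr p + (\<bar>v x\<bar> * \<bar>?\<eta> x - ?\<eta> y\<bar>) powr p)"
        using ps by (intro powr_add_le) auto
      also have "(indicator ?B y * \<bar>v x - v y\<bar>) powr p = indicator ?B y * \<bar>v x - v y\<bar> powr p"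
        using ps by (auto split: split_indicator)
      also have "(\<bar>v x\<bar> * \<bar>?\<eta> x - ?\<eta> y\<bar>) powr p = \<bar>v x\<bar> powr p * \<bar>?\<eta> x - ?\<eta> y\<bar> powr p"
        by (simp add: powr_mult)
      finally have "?d x y \<le> 2 powr p * (indicator ?B y * \<bar>v x - v y\<bar> powr p + \<bar>v x\<bar> powr p * \<bar>?\<eta> x - ?\<eta> y\<bar> powr p)
          / norm (x - y) powr ?e"
        unfolding gagliardo_density_def by (rule divide_right_mono) simp
      also have "\<dots> = 2 powr p * (indicator ?B y * gagliardo_density s p v x y
          + \<bar>v x\<bar> powr p * (\<bar>?\<eta> x - ?\<eta> y\<bar> powr p / norm (x - y) powr ?e))"
        unfolding gagliardo_density_def
        by (simp only: add_divide_distrib[symmetric] times_divide_eq_right)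
      finally have "ennreal (?d x y) \<le> ennreal (2 powr p * (indicator ?B y * gagliardo_density s p v x y
          + \<bar>v x\<bar> powr p * (\<bar>?\<eta> x - ?\<eta> y\<bar> powr p / norm (x - y) powr ?e)))"
        by (rule ennreal_leI)
      also have "\<dots> = ennreal (2 powr p) * (ennreal (indicator ?B y * gagliardo_density s p v x y)
          + ennreal (\<bar>v x\<bar> powr p) * ennreal (\<bar>?\<eta> x - ?\<eta> y\<bar> powr p / norm (x - y) powr ?e))"
        by (subst ennreal_mult, simp, simp add: gagliardo_density_nonneg, subst ennreal_plus)
           (simp_all add: gagliardo_density_nonneg ennreal_mult[symmetric])
      also have "\<dots> \<le> ennreal (2 powr p) * (P x y + Q x * H x y)"
      proof (intro mult_left_mono add_mono)
        show "ennreal (indicator ?B y * gagliardo_density s p v x y) \<le> P x y"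
          using that by (auto simp: P_def split: split_indicator)
        show "ennreal (\<bar>v x\<bar> powr p) * ennreal (\<bar>?\<eta> x - ?\<eta> y\<bar> powr p / norm (x - y) powr ?e) \<le> Q x * H x y"
          using that dH[of x y] by (auto simp: Q_def intro: mult_left_mono)
      qed simp
      finally show ?thesis .
    qed
    have sym: "?d x y = ?d y x" "P x y = P y x" "H x y = H y x" for x y
      by (simp_all add: gagliardo_density_def P_def H_def abs_minus_commute norm_minus_commute mult.commute)
    have le: "ennreal (?d x y) \<le> ennreal (2 powr p) * (P x y + Q x * H x y + Q y * H x y)" for x y
    proof -
      consider "x \<in> ?B" | "y \<in> ?B" | "x \<notin> ?B" "y \<notin> ?B" by blast
      then show ?thesis
      proof cases
        case 1
        show ?thesis by (rule order_trans[OF prod[OF 1]]) (intro mult_left_mono; simp)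
      next
        case 2
        have "ennreal (?d x y) \<le> ennreal (2 powr p) * (P x y + Q y * H x y)"
          using prod[OF 2, of x] by (simp only: sym(1)[of x y] sym(2)[of x y] sym(3)[of x y])
        also have "\<dots> \<le> ennreal (2 powr p) * (P x y + Q x * H x y + Q y * H x y)"
          by (intro mult_left_mono add_right_mono) auto
        finally show ?thesis .
      next
        case 3
        then show ?thesis using \<eta>0 ps by (simp add: gagliardo_density_def)
      qed
    qed
    have iP: "(\<integral>\<^sup>+x. \<integral>\<^sup>+y. P x y \<partial>lborel \<partial>lborel) = local_energy s p v (2 * r) c"
      by (simp add: P_def local_energy_def)
    have iQ1: "(\<integral>\<^sup>+x. \<integral>\<^sup>+y. Q x * H x y \<partial>lborel \<partial>lborel) = (\<integral>\<^sup>+x. Q x \<partial>lborel) * ennreal (L powr p * m)"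
    proof -
      have "(\<integral>\<^sup>+y. Q x * H x y \<partial>lborel) = Q x * ennreal (L powr p * m)" for x
        by (subst nn_integral_cmult) (measurable, simp only: Hint)
      then show ?thesis by (simp only:) (rule nn_integral_multc, measurable)
    qed
    have "(\<integral>\<^sup>+x. \<integral>\<^sup>+y. Q y * H x y \<partial>lborel \<partial>lborel) = (\<integral>\<^sup>+y. \<integral>\<^sup>+x. Q y * H x y \<partial>lborel \<partial>lborel)"
      by (rule lborel_pair.Fubini'[symmetric]) measurable
    also have "\<dots> = (\<integral>\<^sup>+x. Q x \<partial>lborel) * ennreal (L powr p * m)"
      unfolding iQ1[symmetric] by (simp only: sym(3)[symmetric])
    finally have iQ2: "(\<integral>\<^sup>+x. \<integral>\<^sup>+y. Q y * H x y \<partial>lborel \<partial>lborel) = (\<integral>\<^sup>+x. Q x \<partial>lborel) * ennreal (L powr p * m)" .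
    define q0 where "q0 = (\<integral>\<^sup>+x. Q x \<partial>lborel)"
    have "gagliardo s p (\<lambda>x. ?\<eta> x * v x)
        \<le> (\<integral>\<^sup>+x. \<integral>\<^sup>+y. ennreal (2 powr p) * (P x y + Q x * H x y + Q y * H x y) \<partial>lborel \<partial>lborel)"
      by (subst gagliardo_iterated) (measurable, intro nn_integral_mono le)
    also have "\<dots> = ennreal (2 powr p) * (\<integral>\<^sup>+x. \<integral>\<^sup>+y. P x y + Q x * H x y + Q y * H x y \<partial>lborel \<partial>lborel)"
    proof -
      have "(\<integral>\<^sup>+y. ennreal (2 powr p) * (P x y + Q x * H x y + Q y * H x y) \<partial>lborel)
          = ennreal (2 powr p) * (\<integral>\<^sup>+y. P x y + Q x * H x y + Q y * H x y \<partial>lborel)" for x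
        by (rule nn_integral_cmult) measurable
      then show ?thesis by (simp only:) (rule nn_integral_cmult, measurable)
    qed
    also have "(\<integral>\<^sup>+x. \<integral>\<^sup>+y. P x y + Q x * H x y + Q y * H x y \<partial>lborel \<partial>lborel)
        = local_energy s p v (2 * r) c + q0 * ennreal (L powr p * m) + q0 * ennreal (L powr p * m)"
    proof -
      have "(\<integral>\<^sup>+y. P x y + Q x * H x y + Q y * H x y \<partial>lborel)
          = (\<integral>\<^sup>+y. P x y \<partial>lborel) + (\<integral>\<^sup>+y. Q x * H x y \<partial>lborel) + (\<integral>\<^sup>+y. Q y * H x y \<partial>lborel)" for x
        by (subst nn_integral_add, measurable)+
      then have "(\<integral>\<^sup>+x. \<integral>\<^sup>+y. P x y + Q x * H x y + Q y * H x y \<partial>lborel \<partial>lborel)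
        = (\<integral>\<^sup>+x. \<integral>\<^sup>+y. P x y \<partial>lborel \<partial>lborel) + (\<integral>\<^sup>+x. \<integral>\<^sup>+y. Q x * H x y \<partial>lborel \<partial>lborel)
          + (\<integral>\<^sup>+x. \<integral>\<^sup>+y. Q y * H x y \<partial>lborel \<partial>lborel)"
        by (simp only:) (subst nn_integral_add, measurable)+
      then show ?thesis by (simp only: iP iQ1 iQ2 q0_def)
    qed
    also have "ennreal (2 powr p) * (local_energy s p v (2 * r) c + q0 * ennreal (L powr p * m) + q0 * ennreal (L powr p * m))
        \<le> ennreal C * (local_energy s p v (2 * r) c + q0)"
    proof -
      define l where "l = local_energy s p v (2 * r) c"
      define k where "k = ennreal (L powr p * m)"
      have C: "ennreal C = ennreal (2 powr p) * (1 + (k + k))"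
      proof -
        define x where "x = L powr p * m"
        have x: "x \<ge> 0" using m by (simp add: x_def)
        have "C = 2 powr p * (1 + (x + x))" by (simp add: C_def x_def)
        then have "ennreal C = ennreal (2 powr p) * ennreal (1 + (x + x))"
          using x by (simp only:) (rule ennreal_mult, simp_all)
        also have "ennreal (1 + (x + x)) = 1 + (ennreal x + ennreal x)"
          using x by (simp only: ennreal_plus add_nonneg_nonneg zero_le_one ennreal_1)
        finally show ?thesis by (simp only: k_def x_def)
      qed
      have "l + q0 * k + q0 * k \<le> (1 + (k + k)) * (l + q0)"
      proof -
        have "(1 + (k + k)) * (l + q0) = (l + q0 * k + q0 * k) + (q0 + (k + k) * l)"
          by (simp only: distrib_left distrib_right mult.commute[of q0] mult_1 add_ac)
        then show ?thesis by simp
      qed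
      then show ?thesis
        unfolding C l_def[symmetric] k_def[symmetric] mult.assoc by (rule mult_left_mono) simp
    qed
    finally show "gagliardo s p (\<lambda>x. ?\<eta> x * v x) \<le> ennreal C *
        (local_energy s p v (2 * r) c + (\<integral>\<^sup>+x. ennreal (\<bar>v x\<bar> powr p) * indicator ?B x \<partial>lborel))"
      by (simp only: q0_def Q_def)
  qed
qed

text \<open>If the average \<open>a\<close> of \<open>u\<close> does not vanish, then \<open>1 - u / a\<close>, cut off outside the ball of
  radius \<open>r\<close>, is admissible for the capacity of the part of that ball where \<open>u\<close> has to
  vanish. By the Poincare inequality its energy is at most of order \<open>|a| powr (- p)\<close> times the
  local energy of \<open>u\<close>.\<close>

lemma ball_average_le_local_energy:
  fixes s p r \<kappa> :: real
  assumes ps: "1 \<le> p" "0 < s" "s < 1" and r: "r > 0" and \<kappa>: "\<kappa> > 0"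
  obtains C where "C \<ge> 0"
    "\<And>(\<Omega> :: 'a::euclidean_space set) c u. u \<in> test_functions \<Omega> \<Longrightarrow>
      ennreal \<kappa> \<le> frac_cap s p (cball c r - \<Omega>) (ball c (2 * r)) \<Longrightarrow>
      ennreal (\<bar>ball_average u (2 * r) c\<bar> powr p) \<le> ennreal C * local_energy s p u (2 * r) c"
proof -
  obtain C1 where C1: "C1 \<ge> 0"
    "\<And>(c::'a) v. v \<in> borel_measurable borel \<Longrightarrow>
      gagliardo s p (\<lambda>x. cutoff c r (3 / 2 * r) x * v x) \<le> ennreal C1 *
        (local_energy s p v (2 * r) c + (\<integral>\<^sup>+x. ennreal (\<bar>v x\<bar> powr p) * indicator (ball c (2 * r)) x \<partial>lborel))"
    using gagliardo_cutoff_mult_le[OF ps r, where 'a='a] by blast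
  define V where "V = unit_ball_vol DIM('a) * (2 * r) ^ DIM('a)"
  have V: "V > 0" using r by (simp add: V_def)
  define k where "k = (2 * (2 * r)) powr (real DIM('a) + s * p) / V"
  have k: "k \<ge> 0" using V by (simp add: k_def)
  define C where "C = C1 * (1 + k) / \<kappa>"
  show ?thesis
  proof (rule that[of C])
    show "C \<ge> 0" using C1(1) k \<kappa> by (simp add: C_def)
    fix \<Omega> :: "'a set" and c u
    assume u: "u \<in> test_functions \<Omega>" and cap: "ennreal \<kappa> \<le> frac_cap s p (cball c r - \<Omega>) (ball c (2 * r))"
    note [measurable] = test_functions_borel[OF u]
    obtain M where M: "\<And>x. \<bar>u x\<bar> \<le> M" using test_functions_bounded[OF u] by blast
    define a where "a = ball_average u (2 * r) c"
    have "local_energy s p u (2 * r) c < \<infinity>"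
      using local_energy_le[OF test_functions_borel[OF u]] gagliardo_finite[OF ps u] by (rule le_less_trans)
    then obtain d where d: "local_energy s p u (2 * r) c = ennreal d" "d \<ge> 0"
      by (cases "local_energy s p u (2 * r) c") auto
    have "\<bar>a\<bar> powr p \<le> C * d"
    proof (cases "a = 0")
      case True
      then show ?thesis using ps C1(1) k \<kappa> d by (simp add: C_def)
    next
      case False
      define v where "v x = 1 + (- 1 / a) * u x" for x
      have [measurable]: "v \<in> borel_measurable borel" unfolding v_def by measurable
      define A where "A = \<bar>1 / a\<bar> powr p"
      have A: "A > 0" "A * \<bar>a\<bar> powr p = 1" using False by (auto simp: A_def powr_divide)
      have le1: "local_energy s p v (2 * r) c = ennreal (A * d)"
      proof -
        have 1: "ennreal (gagliardo_density s p v x y) * (indicator (ball c (2 * r)) x * indicator (ball c (2 * r)) y)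
          = ennreal A * (ennreal (gagliardo_density s p u x y) *
            (indicator (ball c (2 * r)) x * indicator (ball c (2 * r)) y))" for x y
        proof -
          have "v x - v y = (- 1 / a) * (u x - u y)" by (simp add: v_def diff_divide_distrib)
          then have "\<bar>v x - v y\<bar> powr p = A * \<bar>u x - u y\<bar> powr p"
            by (simp only: abs_mult powr_mult A_def) simp
          then have "gagliardo_density s p v x y = A * gagliardo_density s p u x y"
            by (simp add: gagliardo_density_def)
          then have "ennreal (gagliardo_density s p v x y) = ennreal A * ennreal (gagliardo_density s p u x y)"
            using A by (simp only:) (intro ennreal_mult gagliardo_density_nonneg less_imp_le)
          then show ?thesis by (simp only: mult.assoc)
        qed
        have 2: "(\<integral>\<^sup>+y. ennreal A * (ennreal (gagliardo_density s p u x y) *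
            (indicator (ball c (2 * r)) x * indicator (ball c (2 * r)) y)) \<partial>lborel)
          = ennreal A * (\<integral>\<^sup>+y. ennreal (gagliardo_density s p u x y) *
            (indicator (ball c (2 * r)) x * indicator (ball c (2 * r)) y) \<partial>lborel)" for x
          by (rule nn_integral_cmult) measurable
        have "local_energy s p v (2 * r) c = ennreal A * local_energy s p u (2 * r) c"
          unfolding local_energy_def 1 2 by (rule nn_integral_cmult) measurable
        then show ?thesis using A d by (simp add: ennreal_mult)
      qed
      have le2: "(\<integral>\<^sup>+x. ennreal (\<bar>v x\<bar> powr p) * indicator (ball c (2 * r)) x \<partial>lborel) \<le> ennreal (A * (k * d))"
      proof -
        define I where "I = (\<integral>\<^sup>+x. ennreal (\<bar>u x - a\<bar> powr p) * indicator (ball c (2 * r)) x \<partial>lborel)"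
        have "ennreal V * I \<le> ennreal ((2 * (2 * r)) powr (real DIM('a) + s * p)) * ennreal d"
          unfolding V_def I_def a_def d(1)[symmetric]
          by (rule ball_average_Poincare[OF _ M ps(1,2)]) (use r in auto)
        then have "ennreal (1 / V) * (ennreal V * I)
            \<le> ennreal (1 / V) * (ennreal ((2 * (2 * r)) powr (real DIM('a) + s * p)) * ennreal d)"
          by (rule mult_left_mono) simp
        moreover have "ennreal (1 / V) * (ennreal V * I) = I"
          using V by (simp flip: ennreal_mult mult.assoc)
        moreover have "ennreal (1 / V) * (ennreal ((2 * (2 * r)) powr (real DIM('a) + s * p)) * ennreal d) = ennreal (k * d)"
          using V d by (simp add: k_def flip: ennreal_mult)
        ultimately have I: "I \<le> ennreal (k * d)" by simp
        have "(\<integral>\<^sup>+x. ennreal (\<bar>v x\<bar> powr p) * indicator (ball c (2 * r)) x \<partial>lborel)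
            = (\<integral>\<^sup>+x. ennreal A * (ennreal (\<bar>u x - a\<bar> powr p) * indicator (ball c (2 * r)) x) \<partial>lborel)"
        proof (rule nn_integral_cong)
          fix x
          have "v x = (- 1 / a) * (u x - a)" using False by (simp add: v_def field_simps)
          then have "\<bar>v x\<bar> powr p = A * \<bar>u x - a\<bar> powr p"
            by (simp only: abs_mult powr_mult A_def) simp
          then have "ennreal (\<bar>v x\<bar> powr p) = ennreal A * ennreal (\<bar>u x - a\<bar> powr p)"
            using A by (simp only:) (intro ennreal_mult less_imp_le powr_ge_zero)
          then show "ennreal (\<bar>v x\<bar> powr p) * indicator (ball c (2 * r)) x
              = ennreal A * (ennreal (\<bar>u x - a\<bar> powr p) * indicator (ball c (2 * r)) x)"
            by (simp only: mult.assoc)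
        qed
        also have "\<dots> = ennreal A * I" unfolding I_def by (rule nn_integral_cmult) measurable
        also have "\<dots> \<le> ennreal A * ennreal (k * d)" by (rule mult_left_mono[OF I]) simp
        also have "\<dots> = ennreal (A * (k * d))" using A k d by (intro ennreal_mult[symmetric]) auto
        finally show ?thesis .
      qed
      define \<phi> where "\<phi> x = cutoff c r (3 / 2 * r) x * v x" for x
      have "cutoff c r (3 / 2 * r) \<in> test_functions (ball c (2 * r))"
        using r by (intro test_functions_cutoff) auto
      then have "\<phi> \<in> test_functions (ball c (2 * r))"
        unfolding \<phi>_def v_def
        by (rule test_functions_mult_smooth) (intro Ck_add Ck_const Ck_cmult test_functions_Ck[OF u])
      moreover have "\<forall>x\<in>cball c r - \<Omega>. 1 \<le> \<phi> x"
        using r test_functions_outside[OF u] by (auto simp: \<phi>_def v_def cutoff_eq_1 dist_commute)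
      ultimately have "frac_cap s p (cball c r - \<Omega>) (ball c (2 * r)) \<le> gagliardo s p \<phi>"
        unfolding frac_cap_def by (intro Inf_lower) auto
      with cap have "ennreal \<kappa> \<le> gagliardo s p \<phi>" by (rule order_trans)
      also have "\<dots> \<le> ennreal C1 * (ennreal (A * d) + ennreal (A * (k * d)))"
        unfolding \<phi>_def
        by (rule order_trans[OF C1(2)]) (measurable, intro mult_left_mono add_mono le2, simp_all add: le1)
      also have "\<dots> = ennreal (C1 * (A * d + A * (k * d)))"
        using A k d C1(1) by (simp flip: ennreal_plus ennreal_mult)
      finally have "\<kappa> \<le> C1 * (A * d + A * (k * d))"
        by (rule ennreal_le_iff[THEN iffD1, rotated]) (use A k d C1(1) in simp)
      then have "\<bar>a\<bar> powr p * \<kappa> \<le> \<bar>a\<bar> powr p * (C1 * (A * d + A * (k * d)))"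
        by (rule mult_left_mono) simp
      also have "\<dots> = (A * \<bar>a\<bar> powr p) * (C1 * (1 + k) * d)" by (simp add: algebra_simps)
      also have "\<dots> = C1 * (1 + k) * d" by (simp only: A mult_1)
      finally show ?thesis using \<kappa> by (simp add: C_def field_simps)
    qed
    then show "ennreal (\<bar>ball_average u (2 * r) c\<bar> powr p) \<le> ennreal C * local_energy s p u (2 * r) c"
      using C1(1) k \<kappa> d by (simp add: a_def C_def ennreal_leI flip: ennreal_mult)
  qed
qed

text \<open>Any \<open>r\<close> above the inradius works: no ball of that radius meets the complement of \<open>\<Omega>\<close> in a negligible
  set only.\<close>

theorem Lq_le_gagliardo_if_inradius_finite:
  fixes s p q \<gamma> :: real and \<Omega> :: "'a::euclidean_space set"
  assumes ps: "1 \<le> p" "0 < s" "s < 1" and pq: "p \<le> q" and sub: "0 < s * p - real DIM('a) + real DIM('a) * p / q"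
    and \<gamma>: "\<gamma> > 0" and "open \<Omega>" and fin: "cap_inradius s p \<gamma> \<Omega> < \<infinity>"
  obtains C where "C \<ge> 0"
    "\<And>u. u \<in> test_functions \<Omega> \<Longrightarrow>
      (\<integral>\<^sup>+x. ennreal (\<bar>u x\<bar> powr q) \<partial>lborel) \<le> ennreal (C * enn2real (gagliardo s p u) powr (q / p))"
proof -
  define r where "r = enn2real (cap_inradius s p \<gamma> \<Omega>) + 1"
  have r: "r > 0" by (simp add: r_def add_nonneg_pos)
  have less: "cap_inradius s p \<gamma> \<Omega> < ennreal r"
    using fin by (cases "cap_inradius s p \<gamma> \<Omega>") (auto simp: r_def ennreal_less_iff)
  obtain \<kappa>0 where \<kappa>0: "\<kappa>0 > 0" "\<And>c::'a. ennreal \<kappa>0 \<le> frac_cap s p (cball c r) (ball c (2 * r))"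
    using frac_cap_ball_lower_bound[OF ps(1,2) r, where 'a='a] by blast
  have cap: "ennreal (\<gamma> * \<kappa>0) \<le> frac_cap s p (cball c r - \<Omega>) (ball c (2 * r))" for c
  proof -
    have "\<not> cap_negligible s p \<gamma> c r (cball c r - \<Omega>)"
    proof
      assume "cap_negligible s p \<gamma> c r (cball c r - \<Omega>)"
      then have "ennreal r \<le> cap_inradius s p \<gamma> \<Omega>"
        unfolding cap_inradius_def using r by (intro Sup_upper) auto
      then show False using less by simp
    qed
    then have "ennreal \<gamma> * frac_cap s p (cball c r) (ball c (2 * r)) \<le> frac_cap s p (cball c r - \<Omega>) (ball c (2 * r))"
      using \<open>open \<Omega>\<close> by (auto simp: cap_negligible_def intro!: compact_diff)
    moreover have "ennreal \<gamma> * ennreal \<kappa>0 \<le> ennreal \<gamma> * frac_cap s p (cball c r) (ball c (2 * r))"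
      by (intro mult_left_mono \<kappa>0) simp
    ultimately show ?thesis using \<gamma> \<kappa>0(1) by (simp add: ennreal_mult)
  qed
  have "\<gamma> * \<kappa>0 > 0" using \<gamma> \<kappa>0 by simp
  then obtain c0 where c0: "c0 \<ge> 0" "\<And>(\<Omega> :: 'a set) c u. u \<in> test_functions \<Omega> \<Longrightarrow>
      ennreal (\<gamma> * \<kappa>0) \<le> frac_cap s p (cball c r - \<Omega>) (ball c (2 * r)) \<Longrightarrow>
      ennreal (\<bar>ball_average u (2 * r) c\<bar> powr p) \<le> ennreal c0 * local_energy s p u (2 * r) c"
    using ball_average_le_local_energy[OF ps r, where 'a='a] by blast
  have "2 * r > 0" using r by simp
  then obtain C where C: "C \<ge> 0"
    "\<And>u :: 'a \<Rightarrow> real. u \<in> test_functions UNIV \<Longrightarrow>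
      (\<And>x. ennreal (\<bar>ball_average u (2 * r) x\<bar> powr p) \<le> ennreal c0 * local_energy s p u (2 * r) x) \<Longrightarrow>
      (\<integral>\<^sup>+x. ennreal (\<bar>u x\<bar> powr q) \<partial>lborel) \<le> ennreal (C * enn2real (gagliardo s p u) powr (q / p))"
    using Lq_le_gagliardo_if_average_le[OF ps pq sub _ c0(1)] by metis
  show ?thesis
    by (rule that[OF C(1)], rule C(2)) (auto intro: test_functions_subset c0(2) cap)
qed

section \<open>The completion and its embedding\<close>

subsection \<open>Powers and norms\<close>

lemma ennpowr_ennreal: "a \<ge> 0 \<Longrightarrow> ennpowr (ennreal a) b = ennreal (a powr b)"
  by (simp add: ennpowr_def)

lemma powr_le_imp_le:
  fixes x y p :: real
  assumes "0 < p" "0 \<le> x" "0 \<le> y" "x powr p \<le> y powr p"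
  shows "x \<le> y"
  using powr_mono2[of "1 / p" "x powr p" "y powr p"] assms by (simp add: powr_powr)

lemma nn_integral_powr_add_le:
  fixes f g :: "'b \<Rightarrow> real" and q :: real
  assumes [measurable]: "f \<in> borel_measurable M" "g \<in> borel_measurable M" and "q \<ge> 0"
  shows "(\<integral>\<^sup>+x. ennreal (\<bar>f x + g x\<bar> powr q) \<partial>M)
    \<le> ennreal (2 powr q) * ((\<integral>\<^sup>+x. ennreal (\<bar>f x\<bar> powr q) \<partial>M) + (\<integral>\<^sup>+x. ennreal (\<bar>g x\<bar> powr q) \<partial>M))"
proof -
  have "(\<integral>\<^sup>+x. ennreal (\<bar>f x + g x\<bar> powr q) \<partial>M)
      \<le> (\<integral>\<^sup>+x. ennreal (2 powr q) * (ennreal (\<bar>f x\<bar> powr q) + ennreal (\<bar>g x\<bar> powr q)) \<partial>M)"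
  proof (rule nn_integral_mono)
    fix x
    have "\<bar>f x + g x\<bar> powr q \<le> (\<bar>f x\<bar> + \<bar>g x\<bar>) powr q"
      using assms(3) by (intro powr_mono2) auto
    also have "\<dots> \<le> 2 powr q * (\<bar>f x\<bar> powr q + \<bar>g x\<bar> powr q)"
      using assms(3) by (intro powr_add_le) auto
    finally have "ennreal (\<bar>f x + g x\<bar> powr q) \<le> ennreal (2 powr q * (\<bar>f x\<bar> powr q + \<bar>g x\<bar> powr q))"
      by (rule ennreal_leI)
    also have "\<dots> = ennreal (2 powr q) * ennreal (\<bar>f x\<bar> powr q + \<bar>g x\<bar> powr q)"
      by (rule ennreal_mult) auto
    also have "ennreal (\<bar>f x\<bar> powr q + \<bar>g x\<bar> powr q) = ennreal (\<bar>f x\<bar> powr q) + ennreal (\<bar>g x\<bar> powr q)"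
      by (rule ennreal_plus) auto
    finally show "ennreal (\<bar>f x + g x\<bar> powr q)
        \<le> ennreal (2 powr q) * (ennreal (\<bar>f x\<bar> powr q) + ennreal (\<bar>g x\<bar> powr q))" .
  qed
  also have "\<dots> = ennreal (2 powr q) * (\<integral>\<^sup>+x. ennreal (\<bar>f x\<bar> powr q) + ennreal (\<bar>g x\<bar> powr q) \<partial>M)"
    by (rule nn_integral_cmult) measurable
  also have "(\<integral>\<^sup>+x. ennreal (\<bar>f x\<bar> powr q) + ennreal (\<bar>g x\<bar> powr q) \<partial>M)
      = (\<integral>\<^sup>+x. ennreal (\<bar>f x\<bar> powr q) \<partial>M) + (\<integral>\<^sup>+x. ennreal (\<bar>g x\<bar> powr q) \<partial>M)"
    by (rule nn_integral_add) measurable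
  finally show ?thesis .
qed

lemma AE_lebesgue_on_iff:
  fixes \<Omega> :: "'a::euclidean_space set"
  assumes "open \<Omega>"
  shows "(AE x in lebesgue_on \<Omega>. P x) \<longleftrightarrow> (AE x in lborel. x \<in> \<Omega> \<longrightarrow> P x)"
proof -
  have "\<Omega> \<in> sets lebesgue" using assms by (simp add: borel_open)
  then show ?thesis
    by (subst AE_restrict_space_iff) (auto simp: AE_completion_iff)
qed

lemma Lq_norm_eq:
  fixes f :: "'a::euclidean_space \<Rightarrow> real"
  assumes "open \<Omega>" and [measurable]: "f \<in> borel_measurable borel" and "q > 0" and off: "\<And>x. x \<notin> \<Omega> \<Longrightarrow> f x = 0"
  shows "Lq_norm q \<Omega> f = ennpowr (\<integral>\<^sup>+x. ennreal (\<bar>f x\<bar> powr q) \<partial>lborel) (1 / q)"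
proof -
  have "\<Omega> \<in> sets lebesgue" using assms by (simp add: borel_open)
  then have "(\<integral>\<^sup>+x. ennreal (\<bar>f x\<bar> powr q) \<partial>lebesgue_on \<Omega>)
      = (\<integral>\<^sup>+x. ennreal (\<bar>f x\<bar> powr q) * indicator \<Omega> x \<partial>lebesgue)"
    by (subst nn_integral_restrict_space) auto
  also have "\<dots> = (\<integral>\<^sup>+x. ennreal (\<bar>f x\<bar> powr q) \<partial>lebesgue)"
    using off assms(3) by (intro nn_integral_cong) (auto split: split_indicator)
  also have "\<dots> = (\<integral>\<^sup>+x. ennreal (\<bar>f x\<bar> powr q) \<partial>lborel)"
    by (rule nn_integral_completion)
  finally show ?thesis by (simp add: Lq_norm_def)
qed

lemma borel_measurable_lebesgue_on:
  fixes f :: "'a::euclidean_space \<Rightarrow> real"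
  assumes "f \<in> borel_measurable borel"
  shows "f \<in> borel_measurable (lebesgue_on \<Omega>)"
  using assms by (intro measurable_restrict_space1 measurable_completion) simp

lemma test_functions_Lq_finite:
  fixes u :: "'a::euclidean_space \<Rightarrow> real"
  assumes u: "u \<in> test_functions \<Omega>" and q: "q > 0"
  shows "(\<integral>\<^sup>+x. ennreal (\<bar>u x\<bar> powr q) \<partial>lborel) < \<infinity>"
proof -
  obtain M where M: "M \<ge> 0" "\<And>x. \<bar>u x\<bar> \<le> M" using test_functions_bounded[OF u] by blast
  obtain K where K: "compact K" "\<And>x. x \<notin> K \<Longrightarrow> u x = 0"
    by (rule test_functionsE[OF u]) blast
  have "(\<integral>\<^sup>+x. ennreal (\<bar>u x\<bar> powr q) \<partial>lborel) \<le> (\<integral>\<^sup>+x. ennreal (M powr q) * indicator K x \<partial>lborel)"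
    using K(2) M q by (intro nn_integral_mono) (auto split: split_indicator intro!: ennreal_leI powr_mono2)
  also have "\<dots> = ennreal (M powr q) * emeasure lborel K"
    using K(1) by (intro nn_integral_cmult_indicator) (simp add: borel_compact)
  also have "\<dots> < \<infinity>"
    using emeasure_compact_finite[OF K(1)] by (intro ennreal_mult_less_top[THEN iffD2, folded infinity_ennreal_def]) auto
  finally show ?thesis .
qed

text \<open>A real-valued seminorm, for use with limits of real sequences. An infinite energy is sent to \<open>0\<close>, so
  that it is meaningful for functions of finite energy only.\<close>

definition gagliardo_rnorm :: "real \<Rightarrow> real \<Rightarrow> ('a::euclidean_space \<Rightarrow> real) \<Rightarrow> real" where
  "gagliardo_rnorm s p u = enn2real (gagliardo s p u) powr (1 / p)"

lemma gagliardo_rnorm_nonneg: "0 \<le> gagliardo_rnorm s p u"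
  by (simp add: gagliardo_rnorm_def)

context
  fixes s p :: real
  assumes ps: "1 \<le> p" "0 < s" "s < 1"
begin

lemma gagliardo_norm_eq:
  assumes "u \<in> test_functions \<Omega>"
  shows "gagliardo_norm s p u = ennreal (gagliardo_rnorm s p u)"
  using gagliardo_finite[OF ps assms] by (simp add: gagliardo_norm_def ennpowr_def gagliardo_rnorm_def)

lemma gagliardo_eq_rnorm:
  assumes "u \<in> test_functions \<Omega>"
  shows "gagliardo s p u = ennreal (gagliardo_rnorm s p u powr p)"
  using gagliardo_finite[OF ps assms] ps(1) by (simp add: gagliardo_rnorm_def powr_powr)

lemma gagliardo_rnorm_power:
  "gagliardo_rnorm s p u powr q = enn2real (gagliardo s p u) powr (q / p)"
  by (simp add: gagliardo_rnorm_def powr_powr)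

lemma gagliardo_rnorm_triangle:
  fixes u v :: "'a::euclidean_space \<Rightarrow> real"
  assumes u: "u \<in> test_functions \<Omega>" and v: "v \<in> test_functions \<Omega>"
  shows "gagliardo_rnorm s p (\<lambda>x. u x + v x) \<le> gagliardo_rnorm s p u + gagliardo_rnorm s p v"
proof -
  note [measurable] = test_functions_borel[OF u] test_functions_borel[OF v]
  let ?M = "lborel \<Otimes>\<^sub>M lborel :: ('a \<times> 'a) measure"
  define e where "e = real DIM('a) + s * p"
  define F where "F w z = \<bar>w (fst z) - w (snd z)\<bar> / norm (fst z - snd z) powr (e / p)" for w :: "'a \<Rightarrow> real" and z :: "'a \<times> 'a"
  have F: "F w z powr p = gagliardo_density s p w (fst z) (snd z)" for w z
    using ps(1) by (simp add: F_def gagliardo_density_def e_def powr_divide powr_powr)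
  have [measurable]: "F w \<in> borel_measurable ?M" if [measurable]: "w \<in> borel_measurable borel" for w
    unfolding F_def by measurable
  have uv: "(\<lambda>x. u x + v x) \<in> test_functions \<Omega>" using test_functions_lincomb[OF u v, of 1 1] by simp
  have "gagliardo s p (\<lambda>x. u x + v x) \<le> (\<integral>\<^sup>+z. ennreal ((F u z + F v z) powr p) \<partial>?M)"
    unfolding gagliardo_eq F[symmetric]
  proof (intro nn_integral_mono ennreal_leI powr_mono2)
    fix z
    have "\<bar>(u (fst z) + v (fst z)) - (u (snd z) + v (snd z))\<bar> \<le> \<bar>u (fst z) - u (snd z)\<bar> + \<bar>v (fst z) - v (snd z)\<bar>"
      by linarith
    then show "F (\<lambda>x. u x + v x) z \<le> F u z + F v z"
      unfolding F_def add_divide_distrib[symmetric] by (rule divide_right_mono) simp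
  qed (use ps in \<open>auto simp: F_def\<close>)
  also have "\<dots> \<le> ennreal ((gagliardo_rnorm s p u + gagliardo_rnorm s p v) powr p)"
  proof (rule nn_integral_Minkowski[OF _ _ ps(1)])
    show "(\<integral>\<^sup>+z. ennreal (F u z powr p) \<partial>?M) \<le> ennreal (gagliardo_rnorm s p u powr p)"
      unfolding F gagliardo_eq[symmetric] gagliardo_eq_rnorm[OF u] by simp
    show "(\<integral>\<^sup>+z. ennreal (F v z powr p) \<partial>?M) \<le> ennreal (gagliardo_rnorm s p v powr p)"
      unfolding F gagliardo_eq[symmetric] gagliardo_eq_rnorm[OF v] by simp
  qed (auto simp: F_def gagliardo_rnorm_nonneg)
  finally have "gagliardo_rnorm s p (\<lambda>x. u x + v x) powr p \<le> (gagliardo_rnorm s p u + gagliardo_rnorm s p v) powr p"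
    unfolding gagliardo_eq_rnorm[OF uv] by (simp add: ennreal_le_iff)
  then show ?thesis
    by (rule powr_le_imp_le[rotated -1]) (use ps(1) in \<open>auto simp: gagliardo_rnorm_nonneg\<close>)
qed

lemma gagliardo_rnorm_cmult:
  assumes "u \<in> test_functions \<Omega>"
  shows "gagliardo_rnorm s p (\<lambda>x. c * u x) = \<bar>c\<bar> * gagliardo_rnorm s p u"
  using ps(1) unfolding gagliardo_rnorm_def gagliardo_cmult[OF test_functions_borel[OF assms]]
  by (simp add: enn2real_mult powr_mult powr_powr)

lemma gagliardo_rnorm_diff_bound:
  fixes u v :: "'a::euclidean_space \<Rightarrow> real"
  assumes u: "u \<in> test_functions \<Omega>" and v: "v \<in> test_functions \<Omega>"
  shows "\<bar>gagliardo_rnorm s p u - gagliardo_rnorm s p v\<bar> \<le> gagliardo_rnorm s p (\<lambda>x. u x - v x)"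
proof -
  have *: "gagliardo_rnorm s p u \<le> gagliardo_rnorm s p (\<lambda>x. u x - v x) + gagliardo_rnorm s p v"
    if u: "u \<in> test_functions \<Omega>" and v: "v \<in> test_functions \<Omega>" for u v :: "'a \<Rightarrow> real"
    using gagliardo_rnorm_triangle[OF test_functions_diff[OF u v] v] by simp
  have "gagliardo_rnorm s p (\<lambda>x. v x - u x) = gagliardo_rnorm s p (\<lambda>x. u x - v x)"
    using gagliardo_rnorm_cmult[OF test_functions_diff[OF u v], of "-1"] by simp
  then show ?thesis using *[OF u v] *[OF v u] by linarith
qed

end

subsection \<open>Limits of Cauchy sequences in \<open>L\<^sup>q\<close>\<close>

text \<open>A rapidly converging subsequence converges almost everywhere, and Fatou's lemma turns the Cauchy
  condition into convergence to its limit.\<close>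

lemma Lq_cauchy_limit:
  fixes X :: "nat \<Rightarrow> 'b \<Rightarrow> real" and q :: real
  assumes [measurable]: "\<And>n. X n \<in> borel_measurable M" and q: "q \<ge> 1"
    and cauchy: "\<And>e. e > 0 \<Longrightarrow> \<exists>N. \<forall>m\<ge>N. \<forall>n\<ge>N. (\<integral>\<^sup>+x. ennreal (\<bar>X m x - X n x\<bar> powr q) \<partial>M) \<le> ennreal e"
  obtains f r where "f \<in> borel_measurable M" "strict_mono (r :: nat \<Rightarrow> nat)"
    "AE x in M. (\<lambda>k. X (r k) x) \<longlonglongrightarrow> f x"
    "(\<lambda>n. \<integral>\<^sup>+x. ennreal (\<bar>X n x - f x\<bar> powr q) \<partial>M) \<longlonglongrightarrow> 0"
proof -
  define I where "I m n = (\<integral>\<^sup>+x. ennreal (\<bar>X m x - X n x\<bar> powr q) \<partial>M)" for m n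
  \<comment> \<open>consecutive terms of the subsequence are \<open>4 powr (- k)\<close>-close, which leaves room for the
     weights \<open>2 powr k\<close> that force pointwise summability\<close>
  have "\<exists>N. \<forall>m\<ge>N. \<forall>n\<ge>N. I m n \<le> ennreal (4 powr (- q * real k))" for k
    unfolding I_def by (rule cauchy) simp
  then obtain N where N: "\<And>k m n. m \<ge> N k \<Longrightarrow> n \<ge> N k \<Longrightarrow> I m n \<le> ennreal (4 powr (- q * real k))"
    by metis
  define r where "r = rec_nat (N 0) (\<lambda>k j. max (Suc j) (N (Suc k)))"
  have r: "r (Suc k) = max (Suc (r k)) (N (Suc k))" "r 0 = N 0" for k by (simp_all add: r_def)
  have mono: "strict_mono r" by (rule strict_mono_Suc_iff[THEN iffD2]) (simp add: r less_max_iff_disj)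
  have rN: "r k \<ge> N k" for k by (cases k) (simp_all add: r)
  define D where "D k x = \<bar>X (r (Suc k)) x - X (r k) x\<bar>" for k x
  have [measurable]: "D k \<in> borel_measurable M" for k unfolding D_def by measurable
  have "(\<integral>\<^sup>+x. (\<Sum>k. ennreal (2 powr (q * real k)) * ennreal (D k x powr q)) \<partial>M)
      = (\<Sum>k. \<integral>\<^sup>+x. ennreal (2 powr (q * real k)) * ennreal (D k x powr q) \<partial>M)"
    by (rule nn_integral_suminf) measurable
  also have "\<dots> \<le> (\<Sum>k. ennreal (1 * 2 powr (- q * real k)))"
  proof (intro suminf_le summableI)
    fix k
    have "(\<integral>\<^sup>+x. ennreal (2 powr (q * real k)) * ennreal (D k x powr q) \<partial>M)
        = ennreal (2 powr (q * real k)) * I (r (Suc k)) (r k)"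
      unfolding I_def D_def by (rule nn_integral_cmult) measurable
    also have "\<dots> \<le> ennreal (2 powr (q * real k)) * ennreal (4 powr (- q * real k))"
      using rN[of k] strict_monoD[OF mono, of k "Suc k"] by (intro mult_left_mono N) auto
    also have "\<dots> = ennreal (2 powr (q * real k) * 4 powr (- q * real k))"
      by (rule ennreal_mult[symmetric]) auto
    also have "(4::real) powr (- q * real k) = 2 powr (2 * (- q * real k))"
      by (subst powr_powr[symmetric]) simp
    also have "(2::real) powr (q * real k) * 2 powr (2 * (- q * real k)) = 1 * 2 powr (- q * real k)"
      by (simp add: powr_add[symmetric])
    finally show "(\<integral>\<^sup>+x. ennreal (2 powr (q * real k)) * ennreal (D k x powr q) \<partial>M) \<le> ennreal (1 * 2 powr (- q * real k))" .
  qed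
  also have "\<dots> < \<infinity>"
    using q unfolding infinity_ennreal_def less_top[symmetric]
    by (intro ennreal_suminf_neq_top summable_powr2) auto
  finally have fin: "(\<integral>\<^sup>+x. (\<Sum>k. ennreal (2 powr (q * real k)) * ennreal (D k x powr q)) \<partial>M) < \<infinity>" .
  have "AE x in M. (\<Sum>k. ennreal (2 powr (q * real k)) * ennreal (D k x powr q)) \<noteq> \<infinity>"
    by (rule nn_integral_PInf_AE) (measurable, rule less_imp_neq[OF fin])
  then have conv: "AE x in M. convergent (\<lambda>k. X (r k) x)"
  proof eventually_elim
    fix x assume fin: "(\<Sum>k. ennreal (2 powr (q * real k)) * ennreal (D k x powr q)) \<noteq> \<infinity>"
    then obtain S where S: "(\<Sum>k. ennreal (2 powr (q * real k)) * ennreal (D k x powr q)) = ennreal S" "S \<ge> 0"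
      by (cases "\<Sum>k. ennreal (2 powr (q * real k)) * ennreal (D k x powr q)") auto
    have "D k x \<le> S powr (1 / q) * 2 powr (- 1 * real k)" for k
    proof -
      have "ennreal (2 powr (q * real k)) * ennreal (D k x powr q) \<le> ennreal S"
        unfolding S(1)[symmetric] by (rule le_suminf_ennreal)
      then have "2 powr (q * real k) * D k x powr q \<le> S"
        using S(2) by (simp add: ennreal_le_iff flip: ennreal_mult)
      also have "S = (S powr (1 / q)) powr q" using S(2) q by (simp add: powr_powr)
      also have "2 powr (q * real k) * D k x powr q = (2 powr real k * D k x) powr q"
        by (simp add: powr_mult powr_powr D_def mult.commute)
      finally have "2 powr real k * D k x \<le> S powr (1 / q)"
        by (rule powr_le_imp_le[rotated -1]) (use q in \<open>auto simp: D_def\<close>)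
      then have "2 powr real k * D k x * 2 powr (- 1 * real k) \<le> S powr (1 / q) * 2 powr (- 1 * real k)"
        by (rule mult_right_mono) simp
      moreover have "2 powr real k * D k x * 2 powr (- 1 * real k) = D k x"
        by (simp add: powr_minus)
      ultimately show ?thesis by (simp only:)
    qed
    then have "summable (\<lambda>k. X (r (Suc k)) x - X (r k) x)"
      by (intro summable_comparison_test'[where N=0, OF summable_powr2[of "-1" "S powr (1 / q)"]])
         (auto simp: D_def)
    then have "convergent (\<lambda>n. \<Sum>k<n. X (r (Suc k)) x - X (r k) x)"
      by (simp add: summable_iff_convergent)
    then have "convergent (\<lambda>n. X (r n) x - X (r 0) x)" by (simp only: sum_lessThan_telescope[of "\<lambda>k. X (r k) x"])
    from convergent_add[OF this convergent_const[of "X (r 0) x"]]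
    show "convergent (\<lambda>k. X (r k) x)" by simp
  qed
  define f where "f x = lim (\<lambda>k. X (r k) x)" for x
  have [measurable]: "f \<in> borel_measurable M" unfolding f_def[abs_def] by measurable
  have lim: "AE x in M. (\<lambda>k. X (r k) x) \<longlonglongrightarrow> f x"
    using conv by eventually_elim (simp add: f_def convergent_LIMSEQ_iff)
  have "(\<lambda>n. \<integral>\<^sup>+x. ennreal (\<bar>X n x - f x\<bar> powr q) \<partial>M) \<longlonglongrightarrow> 0"
  proof (rule order_tendstoI)
    fix a :: ennreal assume "0 < a"
    then obtain b where b: "0 < b" "b < a" using dense by blast
    define e where "e = enn2real b"
    have "b < top" using b(2) by (rule less_le_trans) simp
    then have "b = ennreal e" by (simp add: e_def)
    then have e: "0 < e" "ennreal e < a" using b by (auto simp: ennreal_less_zero_iff)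
    obtain N where N: "\<And>m n. m \<ge> N \<Longrightarrow> n \<ge> N \<Longrightarrow> I m n \<le> ennreal e"
      using cauchy[OF e(1)] unfolding I_def by blast
    show "eventually (\<lambda>n. (\<integral>\<^sup>+x. ennreal (\<bar>X n x - f x\<bar> powr q) \<partial>M) < a) sequentially"
      unfolding eventually_sequentially
    proof (intro exI[of _ N] allI impI)
      fix n assume "N \<le> n"
      have "(\<integral>\<^sup>+x. ennreal (\<bar>X n x - f x\<bar> powr q) \<partial>M)
          = (\<integral>\<^sup>+x. liminf (\<lambda>k. ennreal (\<bar>X n x - X (r k) x\<bar> powr q)) \<partial>M)"
      proof (rule nn_integral_cong_AE, use lim in eventually_elim)
        fix x assume "(\<lambda>k. X (r k) x) \<longlonglongrightarrow> f x"
        then have "(\<lambda>k. ennreal (\<bar>X n x - X (r k) x\<bar> powr q)) \<longlonglongrightarrow> ennreal (\<bar>X n x - f x\<bar> powr q)"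
          using q by (intro tendsto_ennrealI tendsto_powr' tendsto_rabs tendsto_diff tendsto_const) auto
        then show "ennreal (\<bar>X n x - f x\<bar> powr q) = liminf (\<lambda>k. ennreal (\<bar>X n x - X (r k) x\<bar> powr q))"
          by (rule lim_imp_Liminf[OF sequentially_bot, symmetric])
      qed
      also have "\<dots> \<le> liminf (\<lambda>k. I n (r k))"
        unfolding I_def by (rule nn_integral_liminf) measurable
      also have "\<dots> \<le> ennreal e"
      proof (rule Liminf_le)
        have "I n (r k) \<le> ennreal e" if "k \<ge> N" for k
          using N[OF \<open>N \<le> n\<close>, of "r k"] seq_suble[OF mono, of k] that by simp
        then show "eventually (\<lambda>k. I n (r k) \<le> ennreal e) sequentially"
          by (auto simp: eventually_sequentially)
      qed simp
      finally show "(\<integral>\<^sup>+x. ennreal (\<bar>X n x - f x\<bar> powr q) \<partial>M) < a" using e(2) by simp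
    qed
  qed simp
  then show ?thesis using that[of f r] mono lim by simp
qed

text \<open>Fatou's lemma, applied in each of the two variables.\<close>

lemma gagliardo_le_liminf:
  fixes Y :: "nat \<Rightarrow> 'a::euclidean_space \<Rightarrow> real" and s p :: real
  assumes Y [measurable]: "\<And>k. Y k \<in> borel_measurable borel" and g [measurable]: "g \<in> borel_measurable borel" and p: "p > 0"
    and lim: "AE x in lborel. (\<lambda>k. Y k x) \<longlonglongrightarrow> g x"
  shows "gagliardo s p g \<le> liminf (\<lambda>k. gagliardo s p (Y k))"
proof -
  have dens: "ennreal (gagliardo_density s p g x y) = liminf (\<lambda>k. ennreal (gagliardo_density s p (Y k) x y))"
    if "(\<lambda>k. Y k x) \<longlonglongrightarrow> g x" "(\<lambda>k. Y k y) \<longlonglongrightarrow> g y" for x y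
  proof (rule lim_imp_Liminf[symmetric])
    have d: "gagliardo_density s p w x y = inverse (norm (x - y) powr (real DIM('a) + s * p)) * \<bar>w x - w y\<bar> powr p" for w
      by (simp add: gagliardo_density_def divide_inverse)
    show "(\<lambda>k. ennreal (gagliardo_density s p (Y k) x y)) \<longlonglongrightarrow> ennreal (gagliardo_density s p g x y)"
      unfolding d using that p
      by (intro tendsto_ennrealI tendsto_mult tendsto_powr' tendsto_rabs tendsto_diff tendsto_const) auto
  qed simp
  have "gagliardo s p g = (\<integral>\<^sup>+x. \<integral>\<^sup>+y. liminf (\<lambda>k. ennreal (gagliardo_density s p (Y k) x y)) \<partial>lborel \<partial>lborel)"
    unfolding gagliardo_iterated[OF g]
  proof (rule nn_integral_cong_AE, use lim in eventually_elim)
    fix x assume x: "(\<lambda>k. Y k x) \<longlonglongrightarrow> g x"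
    show "(\<integral>\<^sup>+y. ennreal (gagliardo_density s p g x y) \<partial>lborel)
        = (\<integral>\<^sup>+y. liminf (\<lambda>k. ennreal (gagliardo_density s p (Y k) x y)) \<partial>lborel)"
      by (rule nn_integral_cong_AE, use lim in eventually_elim) (rule dens[OF x])
  qed
  also have "\<dots> \<le> (\<integral>\<^sup>+x. liminf (\<lambda>k. \<integral>\<^sup>+y. ennreal (gagliardo_density s p (Y k) x y) \<partial>lborel) \<partial>lborel)"
    by (intro nn_integral_mono nn_integral_liminf) measurable
  also have "\<dots> \<le> liminf (\<lambda>k. \<integral>\<^sup>+x. \<integral>\<^sup>+y. ennreal (gagliardo_density s p (Y k) x y) \<partial>lborel \<partial>lborel)"
    by (intro nn_integral_liminf) measurable
  also have "\<dots> = liminf (\<lambda>k. gagliardo s p (Y k))"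
    by (simp only: gagliardo_iterated[OF Y])
  finally show ?thesis .
qed

subsection \<open>Cauchy sequences of test functions\<close>

locale completion =
  fixes s p :: real and \<Omega> :: "'a::euclidean_space set"
  assumes ps: "1 \<le> p" "0 < s" "s < 1" and open_\<Omega>: "open \<Omega>"
begin

abbreviation "nrm \<equiv> gagliardo_rnorm s p :: ('a \<Rightarrow> real) \<Rightarrow> real"

lemma p_pos: "p > 0" using ps by simp

lemma nrm_triangle3:
  assumes "u \<in> test_functions \<Omega>" "v \<in> test_functions \<Omega>" "w \<in> test_functions \<Omega>"
  shows "nrm (\<lambda>x. u x - w x) \<le> nrm (\<lambda>x. u x - v x) + nrm (\<lambda>x. v x - w x)"
  using gagliardo_rnorm_triangle[OF ps test_functions_diff[OF assms(1,2)] test_functions_diff[OF assms(2,3)]]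
  by simp

lemma nrm_lincomb_le:
  assumes "u \<in> test_functions \<Omega>" "v \<in> test_functions \<Omega>"
  shows "nrm (\<lambda>x. a * u x + b * v x) \<le> \<bar>a\<bar> * nrm u + \<bar>b\<bar> * nrm v"
  using gagliardo_rnorm_triangle[OF ps test_functions_cmult[OF assms(1), of a] test_functions_cmult[OF assms(2), of b]]
  by (simp add: gagliardo_rnorm_cmult[OF ps assms(1)] gagliardo_rnorm_cmult[OF ps assms(2)])

lemma nrm_zero: "nrm (\<lambda>x. 0) = 0"
  using gagliardo_rnorm_cmult[OF ps test_functions_zero[of \<Omega>], where c=0] by simp

lemma D0_cauchy_iff:
  "X \<in> D0_cauchy s p \<Omega> \<longleftrightarrow> (\<forall>n. X n \<in> test_functions \<Omega>) \<and>
      (\<forall>e>0. \<exists>M. \<forall>m\<ge>M. \<forall>n\<ge>M. nrm (\<lambda>x. X m x - X n x) < e)"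
proof (cases "\<forall>n. X n \<in> test_functions \<Omega>")
  case True
  have "gagliardo_norm s p (\<lambda>x. X m x - X n x) < ennreal e \<longleftrightarrow> nrm (\<lambda>x. X m x - X n x) < e" for m n e
    using gagliardo_norm_eq[OF ps test_functions_diff[OF True[rule_format, of m] True[rule_format, of n]]]
    by (simp add: ennreal_less_iff gagliardo_rnorm_nonneg)
  then show ?thesis using True by (simp add: D0_cauchy_def)
next
  case False
  then show ?thesis unfolding D0_cauchy_def by blast
qed

lemma D0_class_iff:
  assumes "X \<in> D0_cauchy s p \<Omega>"
  shows "Y \<in> D0_class s p \<Omega> X \<longleftrightarrow> Y \<in> D0_cauchy s p \<Omega> \<and> (\<lambda>n. nrm (\<lambda>x. X n x - Y n x)) \<longlonglongrightarrow> 0"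
proof (cases "Y \<in> D0_cauchy s p \<Omega>")
  case True
  have "gagliardo_norm s p (\<lambda>x. X n x - Y n x) = ennreal (nrm (\<lambda>x. X n x - Y n x))" for n
    using assms True by (intro gagliardo_norm_eq[OF ps test_functions_diff]) (auto simp: D0_cauchy_def)
  then show ?thesis
    using True tendsto_ennreal_iff[where F=sequentially and f="\<lambda>n. nrm (\<lambda>x. X n x - Y n x)" and x=0]
    by (simp add: D0_class_def gagliardo_rnorm_nonneg)
qed (simp add: D0_class_def)

lemma D0_class_refl: "X \<in> D0_cauchy s p \<Omega> \<Longrightarrow> X \<in> D0_class s p \<Omega> X"
  by (simp add: D0_class_iff nrm_zero)

lemma D0_class_eqI:
  assumes X: "X \<in> D0_cauchy s p \<Omega>" and Y: "Y \<in> D0_cauchy s p \<Omega>"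
    and lim: "(\<lambda>n. nrm (\<lambda>x. X n x - Y n x)) \<longlonglongrightarrow> 0"
  shows "D0_class s p \<Omega> X = D0_class s p \<Omega> Y"
proof -
  have sym: "nrm (\<lambda>x. v x - u x) = nrm (\<lambda>x. u x - v x)"
    if "u \<in> test_functions \<Omega>" "v \<in> test_functions \<Omega>" for u v
    using gagliardo_rnorm_cmult[OF ps test_functions_diff[OF that], of "-1"] by simp
  have t: "X n \<in> test_functions \<Omega>" "Y n \<in> test_functions \<Omega>" for n
    using X Y by (auto simp: D0_cauchy_def)
  have sub: "Z \<in> D0_class s p \<Omega> V"
    if U: "U \<in> D0_cauchy s p \<Omega>" and V: "V \<in> D0_cauchy s p \<Omega>" and Z: "Z \<in> D0_class s p \<Omega> U"
      and l: "(\<lambda>n. nrm (\<lambda>x. V n x - U n x)) \<longlonglongrightarrow> 0" for U V Z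
  proof -
    have Z': "Z \<in> D0_cauchy s p \<Omega>" "(\<lambda>n. nrm (\<lambda>x. U n x - Z n x)) \<longlonglongrightarrow> 0"
      using Z U by (auto simp: D0_class_iff)
    have "(\<lambda>n. nrm (\<lambda>x. V n x - Z n x)) \<longlonglongrightarrow> 0"
    proof (rule tendsto_sandwich[OF _ _ tendsto_const])
      show "(\<lambda>n. nrm (\<lambda>x. V n x - U n x) + nrm (\<lambda>x. U n x - Z n x)) \<longlonglongrightarrow> 0"
        using tendsto_add[OF l Z'(2)] by simp
      show "eventually (\<lambda>n. nrm (\<lambda>x. V n x - Z n x) \<le> nrm (\<lambda>x. V n x - U n x) + nrm (\<lambda>x. U n x - Z n x)) sequentially"
        using U V Z'(1) by (intro always_eventually allI nrm_triangle3) (auto simp: D0_cauchy_def)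
    qed (simp add: gagliardo_rnorm_nonneg)
    then show ?thesis using V Z'(1) by (simp add: D0_class_iff)
  qed
  have "(\<lambda>n. nrm (\<lambda>x. Y n x - X n x)) \<longlonglongrightarrow> 0" using lim by (simp add: sym[OF t])
  then show ?thesis using sub[OF X Y] sub[OF Y X] lim by blast
qed

lemma D0_cauchy_const: "u \<in> test_functions \<Omega> \<Longrightarrow> (\<lambda>_. u) \<in> D0_cauchy s p \<Omega>"
  by (simp add: D0_cauchy_iff nrm_zero)

lemma D0_cauchy_lincomb:
  assumes X: "X \<in> D0_cauchy s p \<Omega>" and Y: "Y \<in> D0_cauchy s p \<Omega>"
  shows "(\<lambda>n x. a * X n x + b * Y n x) \<in> D0_cauchy s p \<Omega>"
  unfolding D0_cauchy_iff
proof (intro conjI allI impI)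
  have t: "X n \<in> test_functions \<Omega>" "Y n \<in> test_functions \<Omega>" for n
    using X Y by (auto simp: D0_cauchy_def)
  show "(\<lambda>x. a * X n x + b * Y n x) \<in> test_functions \<Omega>" for n
    by (rule test_functions_lincomb[OF t])
  fix e :: real assume "e > 0"
  define e' where "e' = e / (\<bar>a\<bar> + \<bar>b\<bar> + 1)"
  have e': "e' > 0" "(\<bar>a\<bar> + \<bar>b\<bar> + 1) * e' = e" using \<open>e > 0\<close> by (auto simp: e'_def add_nonneg_pos)
  obtain M1 where M1: "\<And>m n. m \<ge> M1 \<Longrightarrow> n \<ge> M1 \<Longrightarrow> nrm (\<lambda>x. X m x - X n x) < e'"
    using X e'(1) unfolding D0_cauchy_iff by metis
  obtain M2 where M2: "\<And>m n. m \<ge> M2 \<Longrightarrow> n \<ge> M2 \<Longrightarrow> nrm (\<lambda>x. Y m x - Y n x) < e'"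
    using Y e'(1) unfolding D0_cauchy_iff by metis
  show "\<exists>M. \<forall>m\<ge>M. \<forall>n\<ge>M. nrm (\<lambda>x. a * X m x + b * Y m x - (a * X n x + b * Y n x)) < e"
  proof (intro exI[of _ "max M1 M2"] allI impI)
    fix m n assume mn: "max M1 M2 \<le> m" "max M1 M2 \<le> n"
    have "(\<lambda>x. a * X m x + b * Y m x - (a * X n x + b * Y n x))
        = (\<lambda>x. a * (X m x - X n x) + b * (Y m x - Y n x))" by (simp add: algebra_simps)
    then have "nrm (\<lambda>x. a * X m x + b * Y m x - (a * X n x + b * Y n x))
        \<le> \<bar>a\<bar> * nrm (\<lambda>x. X m x - X n x) + \<bar>b\<bar> * nrm (\<lambda>x. Y m x - Y n x)"
      using nrm_lincomb_le[OF test_functions_diff[OF t(1)[of m] t(1)[of n]] test_functions_diff[OF t(2)[of m] t(2)[of n]], of a b]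
      by (simp only:)
    also have "\<dots> \<le> \<bar>a\<bar> * e' + \<bar>b\<bar> * e'"
      using M1[of m n] M2[of m n] mn by (intro add_mono mult_left_mono) auto
    also have "\<dots> < (\<bar>a\<bar> + \<bar>b\<bar> + 1) * e'" using e'(1) by (simp add: distrib_right)
    finally show "nrm (\<lambda>x. a * X m x + b * Y m x - (a * X n x + b * Y n x)) < e" using e'(2) by simp
  qed
qed

text \<open>The seminorms along a Cauchy sequence form a Cauchy sequence of reals, and equivalent sequences
  have the same limit; the definite description therefore denotes it.\<close>

lemma D0_norm_eq:
  assumes X: "X \<in> D0_cauchy s p \<Omega>"
  obtains l where "l \<ge> 0" "(\<lambda>n. nrm (X n)) \<longlonglongrightarrow> l" "D0_norm s p (D0_class s p \<Omega> X) = ennreal l"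
proof -
  have t: "X n \<in> test_functions \<Omega>" for n using X by (auto simp: D0_cauchy_def)
  have "Cauchy (\<lambda>n. nrm (X n))"
  proof (rule metric_CauchyI)
    fix e :: real assume "e > 0"
    then obtain M where "\<And>m n. m \<ge> M \<Longrightarrow> n \<ge> M \<Longrightarrow> nrm (\<lambda>x. X m x - X n x) < e"
      using X unfolding D0_cauchy_iff by metis
    then have "dist (nrm (X m)) (nrm (X n)) < e" if "m \<ge> M" "n \<ge> M" for m n
      using gagliardo_rnorm_diff_bound[OF ps t[of m] t[of n]] that unfolding dist_real_def
      by (meson le_less_trans)
    then show "\<exists>M. \<forall>m\<ge>M. \<forall>n\<ge>M. dist (nrm (X m)) (nrm (X n)) < e" by blast
  qed
  then obtain l where l: "(\<lambda>n. nrm (X n)) \<longlonglongrightarrow> l" using real_Cauchy_convergent convergentD by blast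
  have l0: "l \<ge> 0" by (rule LIMSEQ_le_const[OF l]) (auto simp: gagliardo_rnorm_nonneg)
  have lim: "(\<lambda>n. gagliardo_norm s p (Y n)) \<longlonglongrightarrow> ennreal l" if Y: "Y \<in> D0_class s p \<Omega> X" for Y
  proof -
    have Y': "Y \<in> D0_cauchy s p \<Omega>" "(\<lambda>n. nrm (\<lambda>x. X n x - Y n x)) \<longlonglongrightarrow> 0"
      using Y X by (auto simp: D0_class_iff)
    have tY: "Y n \<in> test_functions \<Omega>" for n using Y'(1) by (auto simp: D0_cauchy_def)
    have "(\<lambda>n. nrm (X n) - nrm (Y n)) \<longlonglongrightarrow> 0"
      by (rule Lim_null_comparison[OF _ Y'(2)])
         (auto intro!: always_eventually gagliardo_rnorm_diff_bound[OF ps t tY])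
    from tendsto_diff[OF l this] have "(\<lambda>n. nrm (Y n)) \<longlonglongrightarrow> l" by simp
    then show ?thesis by (simp add: gagliardo_norm_eq[OF ps tY] tendsto_ennrealI)
  qed
  have "D0_norm s p (D0_class s p \<Omega> X) = ennreal l"
    unfolding D0_norm_def
  proof (rule the_equality)
    show "\<forall>Y\<in>D0_class s p \<Omega> X. (\<lambda>n. gagliardo_norm s p (Y n)) \<longlonglongrightarrow> ennreal l" using lim by blast
    show "l' = ennreal l" if "\<forall>Y\<in>D0_class s p \<Omega> X. (\<lambda>n. gagliardo_norm s p (Y n)) \<longlonglongrightarrow> l'" for l'
      using that lim D0_class_refl[OF X] by (blast intro: LIMSEQ_unique)
  qed
  then show ?thesis using that l0 l by blast
qed

subsection \<open>From an inequality on test functions to the embedding and back\<close>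

lemma inequality_if_embedding:
  assumes q: "q > 0" and emb: "D0_embeds s p q \<Omega>"
  obtains C where "C \<ge> 0"
    "\<And>u. u \<in> test_functions \<Omega> \<Longrightarrow>
      (\<integral>\<^sup>+x. ennreal (\<bar>u x\<bar> powr q) \<partial>lborel) \<le> ennreal (C * enn2real (gagliardo s p u) powr (q / p))"
proof -
  from emb[unfolded D0_embeds_def] obtain J :: "(nat \<Rightarrow> 'a \<Rightarrow> real) set \<Rightarrow> 'a \<Rightarrow> real"
    where J: "\<forall>u\<in>test_functions \<Omega>. AE x in lebesgue_on \<Omega>. J (D0_class s p \<Omega> (\<lambda>_. u)) x = u x"
      and "\<exists>C::real. \<forall>\<xi>\<in>D0_space s p \<Omega>. Lq_norm q \<Omega> (J \<xi>) \<le> ennreal C * D0_norm s p \<xi>"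
    by (elim exE conjE) (rule that, assumption, rule exI, assumption)
  then obtain C :: real where C: "\<And>\<xi>. \<xi> \<in> D0_space s p \<Omega> \<Longrightarrow> Lq_norm q \<Omega> (J \<xi>) \<le> ennreal C * D0_norm s p \<xi>"
    by metis
  define C' where "C' = max C 0"
  show ?thesis
  proof (rule that[of "C' powr q"])
    show "C' powr q \<ge> 0" by simp
    fix u assume u: "u \<in> test_functions \<Omega>"
    note X = D0_cauchy_const[OF u]
    obtain l where l: "(\<lambda>n::nat. nrm u) \<longlonglongrightarrow> l" "D0_norm s p (D0_class s p \<Omega> (\<lambda>_. u)) = ennreal l"
      using D0_norm_eq[OF X] by blast
    then have "l = nrm u" by (simp add: LIMSEQ_const_iff)
    obtain m where m: "(\<integral>\<^sup>+x. ennreal (\<bar>u x\<bar> powr q) \<partial>lborel) = ennreal m" "m \<ge> 0"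
      using test_functions_Lq_finite[OF u q] by (cases "\<integral>\<^sup>+x. ennreal (\<bar>u x\<bar> powr q) \<partial>lborel") auto
    have "ennreal (m powr (1 / q)) = Lq_norm q \<Omega> u"
      using Lq_norm_eq[OF open_\<Omega> test_functions_borel[OF u] q test_functions_outside[OF u]] m
      by (simp add: ennpowr_ennreal)
    also have "\<dots> = Lq_norm q \<Omega> (J (D0_class s p \<Omega> (\<lambda>_. u)))"
      unfolding Lq_norm_def
      by (rule arg_cong[where f="\<lambda>z. ennpowr z (1 / q)"], rule nn_integral_cong_AE, use J[rule_format, OF u] in eventually_elim) simp
    also have "\<dots> \<le> ennreal C * D0_norm s p (D0_class s p \<Omega> (\<lambda>_. u))"
      by (rule C) (auto simp: D0_space_def X)
    also have "\<dots> \<le> ennreal (C' * nrm u)"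
      unfolding l(2) \<open>l = nrm u\<close> C'_def
      by (subst ennreal_mult) (auto simp: gagliardo_rnorm_nonneg intro!: mult_right_mono ennreal_leI)
    finally have "m powr (1 / q) \<le> C' * nrm u"
      by (rule ennreal_le_iff[THEN iffD1, rotated]) (simp add: C'_def gagliardo_rnorm_nonneg)
    then have "(m powr (1 / q)) powr q \<le> (C' * nrm u) powr q"
      using q by (intro powr_mono2) auto
    then have "m \<le> C' powr q * nrm u powr q"
      using m(2) q by (simp add: powr_powr powr_mult)
    then show "(\<integral>\<^sup>+x. ennreal (\<bar>u x\<bar> powr q) \<partial>lborel)
        \<le> ennreal (C' powr q * enn2real (gagliardo s p u) powr (q / p))"
      unfolding m(1) gagliardo_rnorm_power[OF ps, symmetric] by (rule ennreal_leI)
  qed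
qed

text \<open>Limits are normalised to vanish off \<open>\<Omega>\<close>, so that equality almost everywhere in \<open>\<Omega>\<close> and in the whole
  space coincide.\<close>

definition Lq_limit :: "real \<Rightarrow> (nat \<Rightarrow> 'a \<Rightarrow> real) \<Rightarrow> ('a \<Rightarrow> real) \<Rightarrow> bool" where
  "Lq_limit q X f \<longleftrightarrow> f \<in> borel_measurable borel \<and> (\<forall>x. x \<notin> \<Omega> \<longrightarrow> f x = 0) \<and>
     (\<lambda>n. \<integral>\<^sup>+x. ennreal (\<bar>X n x - f x\<bar> powr q) \<partial>lborel) \<longlonglongrightarrow> 0"

lemma Lq_limit_lincomb:
  assumes f: "Lq_limit q X f" and g: "Lq_limit q Y g" and q: "q \<ge> 1"
    and [measurable]: "\<And>n. X n \<in> borel_measurable borel" "\<And>n. Y n \<in> borel_measurable borel"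
  shows "Lq_limit q (\<lambda>n x. a * X n x + b * Y n x) (\<lambda>x. a * f x + b * g x)"
proof -
  have [measurable]: "f \<in> borel_measurable borel" "g \<in> borel_measurable borel"
    using f g by (auto simp: Lq_limit_def)
  let ?F = "\<lambda>n. \<integral>\<^sup>+x. ennreal (\<bar>X n x - f x\<bar> powr q) \<partial>lborel" and ?G = "\<lambda>n. \<integral>\<^sup>+x. ennreal (\<bar>Y n x - g x\<bar> powr q) \<partial>lborel"
  have le: "(\<integral>\<^sup>+x. ennreal (\<bar>a * X n x + b * Y n x - (a * f x + b * g x)\<bar> powr q) \<partial>lborel)
      \<le> ennreal (2 powr q) * (ennreal (\<bar>a\<bar> powr q) * ?F n + ennreal (\<bar>b\<bar> powr q) * ?G n)" for n
  proof -
    have "(\<integral>\<^sup>+x. ennreal (\<bar>a * X n x + b * Y n x - (a * f x + b * g x)\<bar> powr q) \<partial>lborel)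
        = (\<integral>\<^sup>+x. ennreal (\<bar>a * (X n x - f x) + b * (Y n x - g x)\<bar> powr q) \<partial>lborel)"
      by (simp add: algebra_simps)
    also have "\<dots> \<le> ennreal (2 powr q) * ((\<integral>\<^sup>+x. ennreal (\<bar>a * (X n x - f x)\<bar> powr q) \<partial>lborel)
        + (\<integral>\<^sup>+x. ennreal (\<bar>b * (Y n x - g x)\<bar> powr q) \<partial>lborel))"
      using q by (intro nn_integral_powr_add_le) auto
    also have "(\<integral>\<^sup>+x. ennreal (\<bar>a * (X n x - f x)\<bar> powr q) \<partial>lborel) = ennreal (\<bar>a\<bar> powr q) * ?F n"
      by (subst nn_integral_cmult[symmetric]) (measurable, simp add: abs_mult powr_mult ennreal_mult)
    also have "(\<integral>\<^sup>+x. ennreal (\<bar>b * (Y n x - g x)\<bar> powr q) \<partial>lborel) = ennreal (\<bar>b\<bar> powr q) * ?G n"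
      by (subst nn_integral_cmult[symmetric]) (measurable, simp add: abs_mult powr_mult ennreal_mult)
    finally show ?thesis .
  qed
  have F0: "?F \<longlonglongrightarrow> 0" "?G \<longlonglongrightarrow> 0" using f g by (simp_all only: Lq_limit_def)
  have "(\<lambda>n. ennreal (2 powr q) * (ennreal (\<bar>a\<bar> powr q) * ?F n + ennreal (\<bar>b\<bar> powr q) * ?G n))
      \<longlonglongrightarrow> ennreal (2 powr q) * (ennreal (\<bar>a\<bar> powr q) * 0 + ennreal (\<bar>b\<bar> powr q) * 0)"
    by (rule ennreal_tendsto_cmult[OF _ tendsto_add[OF ennreal_tendsto_cmult[OF _ F0(1)] ennreal_tendsto_cmult[OF _ F0(2)]]])
       (rule ennreal_less_top)+
  then have *: "(\<lambda>n. ennreal (2 powr q) * (ennreal (\<bar>a\<bar> powr q) * ?F n + ennreal (\<bar>b\<bar> powr q) * ?G n)) \<longlonglongrightarrow> 0"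
    by (simp only: mult_zero_right add_0)
  have "(\<lambda>n. \<integral>\<^sup>+x. ennreal (\<bar>a * X n x + b * Y n x - (a * f x + b * g x)\<bar> powr q) \<partial>lborel) \<longlonglongrightarrow> 0"
  proof (rule tendsto_sandwich[OF _ _ tendsto_const *])
    show "eventually (\<lambda>n. (\<integral>\<^sup>+x. ennreal (\<bar>a * X n x + b * Y n x - (a * f x + b * g x)\<bar> powr q) \<partial>lborel)
        \<le> ennreal (2 powr q) * (ennreal (\<bar>a\<bar> powr q) * ?F n + ennreal (\<bar>b\<bar> powr q) * ?G n)) sequentially"
      by (intro always_eventually allI le)
  qed (intro always_eventually allI zero_le)
  moreover have "\<forall>x. x \<notin> \<Omega> \<longrightarrow> a * f x + b * g x = 0"
    using f g unfolding Lq_limit_def by simp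
  moreover have "(\<lambda>x. a * f x + b * g x) \<in> borel_measurable borel" by measurable
  ultimately show ?thesis unfolding Lq_limit_def by blast
qed

lemma Lq_limit_unique:
  assumes f: "Lq_limit q X f" and g: "Lq_limit q X g" and q: "q \<ge> 1"
    and [measurable]: "\<And>n. X n \<in> borel_measurable borel"
  shows "AE x in lborel. f x = g x"
proof -
  have [measurable]: "f \<in> borel_measurable borel" "g \<in> borel_measurable borel"
    using f g by (auto simp: Lq_limit_def)
  have "Lq_limit q (\<lambda>n x. 1 * X n x + (-1) * X n x) (\<lambda>x. 1 * f x + (-1) * g x)"
    by (rule Lq_limit_lincomb[OF f g q]) measurable
  then have "(\<lambda>n::nat. \<integral>\<^sup>+x. ennreal (\<bar>g x - f x\<bar> powr q) \<partial>lborel) \<longlonglongrightarrow> 0"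
    by (simp add: Lq_limit_def abs_minus_commute)
  then have "(\<integral>\<^sup>+x. ennreal (\<bar>g x - f x\<bar> powr q) \<partial>lborel) = 0"
    by (simp add: LIMSEQ_const_iff)
  then have "AE x in lborel. ennreal (\<bar>g x - f x\<bar> powr q) = 0"
    by (subst (asm) nn_integral_0_iff_AE) measurable
  then show ?thesis by eventually_elim simp
qed

end

locale completion_inequality = completion s p \<Omega>
  for s p :: real and \<Omega> :: "'a::euclidean_space set" +
  fixes q C :: real
  assumes q: "1 \<le> q" and C: "0 \<le> C"
    and ineq: "\<And>u. u \<in> test_functions \<Omega> \<Longrightarrow>
      (\<integral>\<^sup>+x. ennreal (\<bar>u x\<bar> powr q) \<partial>lborel) \<le> ennreal (C * enn2real (gagliardo s p u) powr (q / p))"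
begin

lemma Lq_le_nrm:
  "u \<in> test_functions \<Omega> \<Longrightarrow> (\<integral>\<^sup>+x. ennreal (\<bar>u x\<bar> powr q) \<partial>lborel) \<le> ennreal (C * nrm u powr q)"
  using ineq[of u] by (simp only: gagliardo_rnorm_power[OF ps])

lemma Lq_limit_exists:
  assumes X: "X \<in> D0_cauchy s p \<Omega>"
  obtains f and r :: "nat \<Rightarrow> nat" where "Lq_limit q X f" "strict_mono r"
    "AE x in lborel. (\<lambda>k. X (r k) x) \<longlonglongrightarrow> f x"
proof -
  have t: "X n \<in> test_functions \<Omega>" for n using X by (auto simp: D0_cauchy_def)
  note tb [measurable] = test_functions_borel[OF t]
  have cauchy: "\<exists>N. \<forall>m\<ge>N. \<forall>n\<ge>N. (\<integral>\<^sup>+x. ennreal (\<bar>X m x - X n x\<bar> powr q) \<partial>lborel) \<le> ennreal e"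
    if e: "e > 0" for e
  proof -
    define d where "d = (e / (C + 1)) powr (1 / q)"
    have d: "d > 0" "d powr q = e / (C + 1)" using e C q by (auto simp: d_def powr_powr)
    obtain N where N: "\<And>m n. m \<ge> N \<Longrightarrow> n \<ge> N \<Longrightarrow> nrm (\<lambda>x. X m x - X n x) < d"
      using X d(1) unfolding D0_cauchy_iff by metis
    have "(\<integral>\<^sup>+x. ennreal (\<bar>X m x - X n x\<bar> powr q) \<partial>lborel) \<le> ennreal e" if "m \<ge> N" "n \<ge> N" for m n
    proof -
      have "nrm (\<lambda>x. X m x - X n x) powr q \<le> d powr q"
        using N[OF that] q by (intro powr_mono2) (auto simp: gagliardo_rnorm_nonneg)
      then have "C * nrm (\<lambda>x. X m x - X n x) powr q \<le> C * (e / (C + 1))"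
        unfolding d(2) by (rule mult_left_mono[OF _ C])
      also have "\<dots> \<le> (C + 1) * (e / (C + 1))" using e C by (intro mult_right_mono) auto
      also have "\<dots> = e" using C by simp
      finally show ?thesis
        using Lq_le_nrm[OF test_functions_diff[OF t[of m] t[of n]]] by (meson ennreal_leI order_trans)
    qed
    then show ?thesis by blast
  qed
  obtain f and r :: "nat \<Rightarrow> nat" where f: "f \<in> borel_measurable lborel" "strict_mono r"
    "AE x in lborel. (\<lambda>k. X (r k) x) \<longlonglongrightarrow> f x"
    "(\<lambda>n. \<integral>\<^sup>+x. ennreal (\<bar>X n x - f x\<bar> powr q) \<partial>lborel) \<longlonglongrightarrow> 0"
    using Lq_cauchy_limit[of X lborel q, OF _ q cauchy] tb by auto
  have [measurable]: "f \<in> borel_measurable borel" "\<Omega> \<in> sets borel" using f(1) open_\<Omega> by auto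
  define g where "g x = indicator \<Omega> x * f x" for x
  have [measurable]: "g \<in> borel_measurable borel" unfolding g_def by measurable
  have off: "X n x = 0" if "x \<notin> \<Omega>" for n x using test_functions_outside[OF t that] .
  have "(\<lambda>n. \<integral>\<^sup>+x. ennreal (\<bar>X n x - g x\<bar> powr q) \<partial>lborel) \<longlonglongrightarrow> 0"
  proof (rule tendsto_sandwich[OF _ _ tendsto_const f(4)])
    have "(\<integral>\<^sup>+x. ennreal (\<bar>X n x - g x\<bar> powr q) \<partial>lborel) \<le> (\<integral>\<^sup>+x. ennreal (\<bar>X n x - f x\<bar> powr q) \<partial>lborel)" for n
      using off q by (intro nn_integral_mono ennreal_leI powr_mono2) (auto simp: g_def split: split_indicator)
    then show "eventually (\<lambda>n. (\<integral>\<^sup>+x. ennreal (\<bar>X n x - g x\<bar> powr q) \<partial>lborel)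
        \<le> (\<integral>\<^sup>+x. ennreal (\<bar>X n x - f x\<bar> powr q) \<partial>lborel)) sequentially"
      by (intro always_eventually allI)
  qed (intro always_eventually allI zero_le)
  moreover have "\<forall>x. x \<notin> \<Omega> \<longrightarrow> g x = 0" by (simp add: g_def)
  moreover have "g \<in> borel_measurable borel" by measurable
  ultimately have 1: "Lq_limit q X g" unfolding Lq_limit_def by blast
  have "AE x in lborel. (\<lambda>k. X (r k) x) \<longlonglongrightarrow> g x"
    using f(3)
  proof eventually_elim
    fix x assume "(\<lambda>k. X (r k) x) \<longlonglongrightarrow> f x"
    then show "(\<lambda>k. X (r k) x) \<longlonglongrightarrow> g x" by (cases "x \<in> \<Omega>") (auto simp: g_def off)
  qed
  then show ?thesis using that[OF 1 f(2)] by blast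
qed

text \<open>By the inequality, a null sequence of the seminorm is a null sequence in \<open>L\<^sup>q\<close>.\<close>

lemma Lq_limit_class:
  assumes X: "X \<in> D0_cauchy s p \<Omega>" and Y: "Y \<in> D0_class s p \<Omega> X" and f: "Lq_limit q Y f"
  shows "Lq_limit q X f"
proof -
  have Y': "Y \<in> D0_cauchy s p \<Omega>" "(\<lambda>n. nrm (\<lambda>x. X n x - Y n x)) \<longlonglongrightarrow> 0"
    using Y X by (auto simp: D0_class_iff)
  have t: "X n \<in> test_functions \<Omega>" "Y n \<in> test_functions \<Omega>" for n
    using X Y'(1) by (auto simp: D0_cauchy_def)
  note [measurable] = test_functions_borel[OF t(1)] test_functions_borel[OF t(2)]
  have Z: "Lq_limit q (\<lambda>n x. X n x - Y n x) (\<lambda>x. 0)"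
    unfolding Lq_limit_def
  proof (intro conjI)
    have "(\<lambda>n. C * nrm (\<lambda>x. X n x - Y n x) powr q) \<longlonglongrightarrow> C * 0 powr q"
      using Y'(2) q by (intro tendsto_mult tendsto_const tendsto_powr') (auto simp: gagliardo_rnorm_nonneg)
    then have "(\<lambda>n. ennreal (C * nrm (\<lambda>x. X n x - Y n x) powr q)) \<longlonglongrightarrow> ennreal (C * 0 powr q)"
      by (rule tendsto_ennrealI)
    then have "(\<lambda>n. ennreal (C * nrm (\<lambda>x. X n x - Y n x) powr q)) \<longlonglongrightarrow> 0" by simp
    then show "(\<lambda>n. \<integral>\<^sup>+x. ennreal (\<bar>(X n x - Y n x) - 0\<bar> powr q) \<partial>lborel) \<longlonglongrightarrow> 0"
      by (rule tendsto_sandwich[OF _ _ tendsto_const, rotated -1])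
         (use Lq_le_nrm[OF test_functions_diff[OF t]] in \<open>auto intro!: always_eventually\<close>)
  qed auto
  have "Lq_limit q (\<lambda>n x. 1 * Y n x + 1 * (X n x - Y n x)) (\<lambda>x. 1 * f x + 1 * 0)"
    by (rule Lq_limit_lincomb[OF f Z q]) measurable
  then show ?thesis by simp
qed

definition embedding :: "(nat \<Rightarrow> 'a \<Rightarrow> real) set \<Rightarrow> 'a \<Rightarrow> real" where
  "embedding \<xi> = (SOME f. \<exists>X\<in>\<xi>. Lq_limit q X f)"

lemma Lq_limit_embedding:
  assumes X: "X \<in> D0_cauchy s p \<Omega>"
  shows "Lq_limit q X (embedding (D0_class s p \<Omega> X))"
proof -
  have "\<exists>f. \<exists>Y\<in>D0_class s p \<Omega> X. Lq_limit q Y f"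
    using Lq_limit_exists[OF X] D0_class_refl[OF X] by blast
  then have "\<exists>Y\<in>D0_class s p \<Omega> X. Lq_limit q Y (embedding (D0_class s p \<Omega> X))"
    unfolding embedding_def by (rule someI_ex)
  then show ?thesis using Lq_limit_class[OF X] by blast
qed

text \<open>The difference \<open>Z\<close> of two sequences with the same limit tends to \<open>0\<close> in \<open>L\<^sup>q\<close>, hence almost
  everywhere along a subsequence. Lower semicontinuity, applied to \<open>Z n - Z m\<close> as \<open>m\<close> grows along it,
  bounds the energy of \<open>Z n\<close> by the Cauchy condition.\<close>

lemma embedding_inj:
  assumes X: "X \<in> D0_cauchy s p \<Omega>" and Y: "Y \<in> D0_cauchy s p \<Omega>"
    and eq: "AE x in lebesgue_on \<Omega>. embedding (D0_class s p \<Omega> X) x = embedding (D0_class s p \<Omega> Y) x"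
  shows "D0_class s p \<Omega> X = D0_class s p \<Omega> Y"
proof (rule D0_class_eqI[OF X Y])
  let ?f = "embedding (D0_class s p \<Omega> X)" and ?g = "embedding (D0_class s p \<Omega> Y)"
  have t: "X n \<in> test_functions \<Omega>" "Y n \<in> test_functions \<Omega>" for n
    using X Y by (auto simp: D0_cauchy_def)
  note [measurable] = test_functions_borel[OF t(1)] test_functions_borel[OF t(2)]
  note f = Lq_limit_embedding[OF X] and g = Lq_limit_embedding[OF Y]
  have fg: "AE x in lborel. ?f x = ?g x"
    using eq[unfolded AE_lebesgue_on_iff[OF open_\<Omega>]]
  proof eventually_elim
    fix x assume "x \<in> \<Omega> \<longrightarrow> ?f x = ?g x"
    then show "?f x = ?g x" using f g unfolding Lq_limit_def by metis
  qed
  define Z where "Z n x = 1 * X n x + (-1) * Y n x" for n x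
  have Z: "Z \<in> D0_cauchy s p \<Omega>" unfolding Z_def by (rule D0_cauchy_lincomb[OF X Y])
  have tZ: "Z n \<in> test_functions \<Omega>" for n using Z by (auto simp: D0_cauchy_def)
  note tbZ [measurable] = test_functions_borel[OF tZ]
  have Zl: "Lq_limit q Z (\<lambda>x. 1 * ?f x + (-1) * ?g x)"
    unfolding Z_def[abs_def] by (rule Lq_limit_lincomb[OF f g q]) measurable
  obtain h and r :: "nat \<Rightarrow> nat" where h: "Lq_limit q Z h" "strict_mono r"
    "AE x in lborel. (\<lambda>k. Z (r k) x) \<longlonglongrightarrow> h x"
    using Lq_limit_exists[OF Z] .
  have lim: "AE x in lborel. (\<lambda>k. Z (r k) x) \<longlonglongrightarrow> 0"
    using h(3) Lq_limit_unique[OF h(1) Zl q tbZ] fg by eventually_elim simp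
  have "(\<lambda>n. nrm (Z n)) \<longlonglongrightarrow> 0"
  proof (rule LIMSEQ_I)
    fix e :: real assume "e > 0"
    define d where "d = e / 2"
    have d: "d > 0" "d < e" using \<open>e > 0\<close> by (auto simp: d_def)
    obtain N where N: "\<And>m n. m \<ge> N \<Longrightarrow> n \<ge> N \<Longrightarrow> nrm (\<lambda>x. Z m x - Z n x) < d"
      using Z d(1) unfolding D0_cauchy_iff by metis
    have "nrm (Z n) \<le> d" if n: "n \<ge> N" for n
    proof -
      have "gagliardo s p (Z n) \<le> liminf (\<lambda>k. gagliardo s p (\<lambda>x. Z n x - Z (r k) x))"
      proof (rule gagliardo_le_liminf[OF _ _ p_pos])
        show "AE x in lborel. (\<lambda>k. Z n x - Z (r k) x) \<longlonglongrightarrow> Z n x"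
          using lim
        proof eventually_elim
          fix x assume "(\<lambda>k. Z (r k) x) \<longlonglongrightarrow> 0"
          from tendsto_diff[OF tendsto_const this] show "(\<lambda>k. Z n x - Z (r k) x) \<longlonglongrightarrow> Z n x" by simp
        qed
      qed measurable
      also have "\<dots> \<le> ennreal (d powr p)"
      proof (rule Liminf_le)
        have "gagliardo s p (\<lambda>x. Z n x - Z (r k) x) \<le> ennreal (d powr p)" if "k \<ge> N" for k
        proof -
          have "r k \<ge> N" using seq_suble[OF h(2), of k] that by simp
          then have "nrm (\<lambda>x. Z n x - Z (r k) x) powr p \<le> d powr p"
            using N[OF n, of "r k"] p_pos by (intro powr_mono2) (auto simp: gagliardo_rnorm_nonneg)
          then show ?thesis
            unfolding gagliardo_eq_rnorm[OF ps test_functions_diff[OF tZ tZ]] by (rule ennreal_leI)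
        qed
        then show "eventually (\<lambda>k. gagliardo s p (\<lambda>x. Z n x - Z (r k) x) \<le> ennreal (d powr p)) sequentially"
          by (auto simp: eventually_sequentially)
      qed simp
      finally have "nrm (Z n) powr p \<le> d powr p"
        unfolding gagliardo_eq_rnorm[OF ps tZ] by (simp add: ennreal_le_iff)
      then show ?thesis
        by (rule powr_le_imp_le[rotated -1]) (use p_pos d in \<open>auto simp: gagliardo_rnorm_nonneg\<close>)
    qed
    then have "\<forall>n\<ge>N. norm (nrm (Z n) - 0) < e"
      using d(2) by (auto simp: gagliardo_rnorm_nonneg intro: le_less_trans)
    then show "\<exists>N. \<forall>n\<ge>N. norm (nrm (Z n) - 0) < e" by blast
  qed
  then show "(\<lambda>n. nrm (\<lambda>x. X n x - Y n x)) \<longlonglongrightarrow> 0"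
    by (simp add: Z_def[abs_def])
qed

text \<open>Minkowski's inequality for \<open>f = (f - X n) + X n\<close>, with \<open>n\<close> tending to infinity.\<close>

lemma embedding_bound:
  assumes X: "X \<in> D0_cauchy s p \<Omega>"
  shows "Lq_norm q \<Omega> (embedding (D0_class s p \<Omega> X)) \<le> ennreal (C powr (1 / q)) * D0_norm s p (D0_class s p \<Omega> X)"
    and "Lq_norm q \<Omega> (embedding (D0_class s p \<Omega> X)) < \<infinity>"
proof -
  have t: "X n \<in> test_functions \<Omega>" for n using X by (auto simp: D0_cauchy_def)
  note [measurable] = test_functions_borel[OF t]
  obtain l where l: "l \<ge> 0" "(\<lambda>n. nrm (X n)) \<longlonglongrightarrow> l" "D0_norm s p (D0_class s p \<Omega> X) = ennreal l"
    using D0_norm_eq[OF X] .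
  define f where "f = embedding (D0_class s p \<Omega> X)"
  have lim: "Lq_limit q X f" unfolding f_def by (rule Lq_limit_embedding[OF X])
  then have [measurable]: "f \<in> borel_measurable borel" and off: "\<And>x. x \<notin> \<Omega> \<Longrightarrow> f x = 0"
    unfolding Lq_limit_def by blast+
  define A where "A n = (\<integral>\<^sup>+x. ennreal (\<bar>X n x - f x\<bar> powr q) \<partial>lborel)" for n
  have A0: "A \<longlonglongrightarrow> 0" using lim unfolding Lq_limit_def A_def[abs_def] by blast
  have Afin: "eventually (\<lambda>n. A n < 1) sequentially" by (rule order_tendstoD(2)[OF A0]) simp
  define a where "a n = enn2real (A n)" for n
  have "((\<lambda>n. enn2real (A n)) \<longlongrightarrow> enn2real 0) sequentially"
    by (rule tendsto_enn2real[OF _ _]) (use A0 in simp_all)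
  then have a0: "a \<longlonglongrightarrow> 0" by (simp add: a_def[abs_def])
  have anonneg: "a n \<ge> 0" for n by (simp add: a_def)
  define B where "B n = a n powr (1 / q) + C powr (1 / q) * nrm (X n)" for n
  have le: "eventually (\<lambda>n. (\<integral>\<^sup>+x. ennreal (\<bar>f x\<bar> powr q) \<partial>lborel) \<le> ennreal (B n powr q)) sequentially"
    using Afin
  proof eventually_elim
    fix n assume "A n < 1"
    then have "A n < top" by (rule less_le_trans) simp
    then have An: "A n = ennreal (a n)" by (simp add: a_def)
    have a: "a n \<ge> 0" by (simp add: a_def)
    have "(\<integral>\<^sup>+x. ennreal (\<bar>f x\<bar> powr q) \<partial>lborel) \<le> (\<integral>\<^sup>+x. ennreal ((\<bar>X n x - f x\<bar> + \<bar>X n x\<bar>) powr q) \<partial>lborel)"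
      using q by (intro nn_integral_mono ennreal_leI powr_mono2) auto
    also have "\<dots> \<le> ennreal ((a n powr (1 / q) + C powr (1 / q) * nrm (X n)) powr q)"
    proof (rule nn_integral_Minkowski[OF _ _ q])
      show "(\<integral>\<^sup>+x. ennreal (\<bar>X n x - f x\<bar> powr q) \<partial>lborel) \<le> ennreal ((a n powr (1 / q)) powr q)"
        using a q An unfolding A_def by (simp add: powr_powr)
      show "(\<integral>\<^sup>+x. ennreal (\<bar>X n x\<bar> powr q) \<partial>lborel) \<le> ennreal ((C powr (1 / q) * nrm (X n)) powr q)"
        using Lq_le_nrm[OF t, of n] C q by (simp add: powr_mult powr_powr)
    qed (auto simp: gagliardo_rnorm_nonneg)
    finally show "(\<integral>\<^sup>+x. ennreal (\<bar>f x\<bar> powr q) \<partial>lborel) \<le> ennreal (B n powr q)" by (simp add: B_def)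
  qed
  have "B \<longlonglongrightarrow> 0 powr (1 / q) + C powr (1 / q) * l"
    unfolding B_def[abs_def] using a0 l(2) q
    by (intro tendsto_add tendsto_mult tendsto_const tendsto_powr') (auto simp: anonneg)
  then have B: "B \<longlonglongrightarrow> C powr (1 / q) * l" by simp
  have Bn: "B n \<ge> 0" for n by (simp add: B_def gagliardo_rnorm_nonneg)
  have "(\<lambda>n. B n powr q) \<longlonglongrightarrow> (C powr (1 / q) * l) powr q"
    using B q by (intro tendsto_powr' tendsto_const) (auto simp: Bn)
  then have "(\<lambda>n. ennreal (B n powr q)) \<longlonglongrightarrow> ennreal ((C powr (1 / q) * l) powr q)"
    by (rule tendsto_ennrealI)
  then have fle: "(\<integral>\<^sup>+x. ennreal (\<bar>f x\<bar> powr q) \<partial>lborel) \<le> ennreal ((C powr (1 / q) * l) powr q)"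
    by (rule tendsto_lowerbound[OF _ le]) simp
  then obtain m where m: "(\<integral>\<^sup>+x. ennreal (\<bar>f x\<bar> powr q) \<partial>lborel) = ennreal m" "m \<ge> 0" "m \<le> (C powr (1 / q) * l) powr q"
    by (cases "\<integral>\<^sup>+x. ennreal (\<bar>f x\<bar> powr q) \<partial>lborel") (auto simp: ennreal_le_iff top_unique)
  have "m powr (1 / q) \<le> ((C powr (1 / q) * l) powr q) powr (1 / q)"
    using m q by (intro powr_mono2) auto
  also have "\<dots> = C powr (1 / q) * l" using q l(1) by (simp add: powr_powr)
  finally have mle: "m powr (1 / q) \<le> C powr (1 / q) * l" .
  have "Lq_norm q \<Omega> f = ennreal (m powr (1 / q))"
    using q Lq_norm_eq[OF open_\<Omega> _ _ off, where q=q] m by (simp add: ennpowr_ennreal)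
  then have "Lq_norm q \<Omega> f \<le> ennreal (C powr (1 / q)) * ennreal l" "Lq_norm q \<Omega> f < \<infinity>"
    using ennreal_leI[OF mle] l(1) by (simp_all add: ennreal_mult)
  then show "Lq_norm q \<Omega> (embedding (D0_class s p \<Omega> X)) \<le> ennreal (C powr (1 / q)) * D0_norm s p (D0_class s p \<Omega> X)"
    "Lq_norm q \<Omega> (embedding (D0_class s p \<Omega> X)) < \<infinity>"
    by (simp_all only: f_def l(3))
qed

lemma embedding_if_inequality: "D0_embeds s p q \<Omega>"
  unfolding D0_embeds_def
proof (rule exI[of _ embedding], intro conjI)
  show "\<forall>\<xi>\<in>D0_space s p \<Omega>. embedding \<xi> \<in> Lq_space q \<Omega>"
  proof
    fix \<xi> assume "\<xi> \<in> D0_space s p \<Omega>"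
    then obtain X where X: "X \<in> D0_cauchy s p \<Omega>" "\<xi> = D0_class s p \<Omega> X" by (auto simp: D0_space_def)
    have "embedding \<xi> \<in> borel_measurable borel"
      using Lq_limit_embedding[OF X(1)] unfolding X(2) Lq_limit_def by blast
    then show "embedding \<xi> \<in> Lq_space q \<Omega>"
      using embedding_bound(2)[OF X(1)] unfolding X(2) Lq_space_def by (blast intro: borel_measurable_lebesgue_on)
  qed
  have AE: "AE x in lebesgue_on \<Omega>. P x" if "AE x in lborel. P x" for P
    unfolding AE_lebesgue_on_iff[OF open_\<Omega>] using that by eventually_elim blast
  show "\<forall>u\<in>test_functions \<Omega>. AE x in lebesgue_on \<Omega>. embedding (D0_class s p \<Omega> (\<lambda>_. u)) x = u x"
  proof
    fix u assume u: "u \<in> test_functions \<Omega>"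
    have "Lq_limit q (\<lambda>_. u) u"
      unfolding Lq_limit_def using test_functions_borel[OF u] test_functions_outside[OF u] q by simp
    then show "AE x in lebesgue_on \<Omega>. embedding (D0_class s p \<Omega> (\<lambda>_. u)) x = u x"
      by (intro AE Lq_limit_unique[OF Lq_limit_embedding[OF D0_cauchy_const[OF u]] _ q] test_functions_borel[OF u])
  qed
  show "\<forall>X\<in>D0_cauchy s p \<Omega>. \<forall>Y\<in>D0_cauchy s p \<Omega>. \<forall>a b.
      AE x in lebesgue_on \<Omega>. embedding (D0_class s p \<Omega> (\<lambda>n x. a * X n x + b * Y n x)) x
        = a * embedding (D0_class s p \<Omega> X) x + b * embedding (D0_class s p \<Omega> Y) x"
  proof (intro ballI allI)
    fix X Y and a b :: real assume X: "X \<in> D0_cauchy s p \<Omega>" and Y: "Y \<in> D0_cauchy s p \<Omega>"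
    have t: "X n \<in> borel_measurable borel" "Y n \<in> borel_measurable borel" for n
      using X Y by (auto simp: D0_cauchy_def intro: test_functions_borel)
    note [measurable] = t
    show "AE x in lebesgue_on \<Omega>. embedding (D0_class s p \<Omega> (\<lambda>n x. a * X n x + b * Y n x)) x
        = a * embedding (D0_class s p \<Omega> X) x + b * embedding (D0_class s p \<Omega> Y) x"
      by (rule AE, rule Lq_limit_unique[OF Lq_limit_embedding[OF D0_cauchy_lincomb[OF X Y]]
            Lq_limit_lincomb[OF Lq_limit_embedding[OF X] Lq_limit_embedding[OF Y] q t] q]) measurable
  qed
  show "\<forall>\<xi>\<in>D0_space s p \<Omega>. \<forall>\<eta>\<in>D0_space s p \<Omega>.
      (AE x in lebesgue_on \<Omega>. embedding \<xi> x = embedding \<eta> x) \<longrightarrow> \<xi> = \<eta>"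
    using embedding_inj by (auto simp: D0_space_def)
  show "\<exists>K::real. \<forall>\<xi>\<in>D0_space s p \<Omega>. Lq_norm q \<Omega> (embedding \<xi>) \<le> ennreal K * D0_norm s p \<xi>"
    using embedding_bound(1) by (auto simp: D0_space_def)
qed

end

section \<open>The upper bound for the Rayleigh quotient\<close>

subsection \<open>Scaling\<close>

lemma frac_cap_affine_le:
  fixes E S :: "'a::euclidean_space set" and s p c :: real
  assumes "c > 0"
  shows "frac_cap s p ((\<lambda>x. c *\<^sub>R x + a) -` S) ((\<lambda>x. c *\<^sub>R x + a) -` E)
    \<le> ennreal (c powr (s * p - real DIM('a))) * frac_cap s p S E"
proof -
  let ?K = "c powr (s * p - real DIM('a))"
  let ?L = "frac_cap s p ((\<lambda>x. c *\<^sub>R x + a) -` S) ((\<lambda>x. c *\<^sub>R x + a) -` E)"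
  have K: "?K > 0" using assms by simp
  have inv: "ennreal (1 / ?K) * ennreal ?K = 1" "ennreal ?K * ennreal (1 / ?K) = 1"
    using K by (simp_all flip: ennreal_mult)
  have "ennreal (1 / ?K) * ?L \<le> gagliardo s p \<phi>"
    if \<phi>: "\<phi> \<in> test_functions E" "\<forall>x\<in>S. 1 \<le> \<phi> x" for \<phi>
  proof -
    have "?L \<le> gagliardo s p (\<lambda>x. \<phi> (c *\<^sub>R x + a))"
      unfolding frac_cap_def using assms \<phi>
      by (intro Inf_lower) (auto intro!: test_functions_affine[OF \<phi>(1)])
    also have "\<dots> = ennreal ?K * gagliardo s p \<phi>"
      by (rule gagliardo_affine[OF test_functions_borel[OF \<phi>(1)] assms])
    finally have "ennreal (1 / ?K) * ?L \<le> ennreal (1 / ?K) * (ennreal ?K * gagliardo s p \<phi>)"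
      by (rule mult_left_mono) simp
    then show ?thesis by (simp only: mult.assoc[symmetric] inv mult_1)
  qed
  then have "ennreal (1 / ?K) * ?L \<le> frac_cap s p S E"
    unfolding frac_cap_def[of s p S E] by (intro Inf_greatest) auto
  then have "ennreal ?K * (ennreal (1 / ?K) * ?L) \<le> ennreal ?K * frac_cap s p S E"
    by (rule mult_left_mono) simp
  then show ?thesis by (simp only: mult.assoc[symmetric] inv mult_1)
qed

lemma lambda_spq_le:
  fixes v :: "'a::euclidean_space \<Rightarrow> real" and s p q m :: real
  assumes v: "v \<in> test_functions \<Omega>" and "open \<Omega>" "p > 0" "q > 0"
    and m: "(\<integral>\<^sup>+x. ennreal (\<bar>v x\<bar> powr q) \<partial>lborel) = ennreal m" "m > 0"
  shows "lambda_spq s p q \<Omega> \<le> ennreal (m powr (- p / q)) * gagliardo s p v"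
proof -
  define c where "c = m powr (- 1 / q)"
  have c: "c > 0" "c powr q = 1 / m" "c powr p = m powr (- p / q)"
  proof -
    show "c > 0" using m(2) by (simp add: c_def)
    have "c powr q = m powr (- 1 / q * q)" by (simp only: c_def powr_powr)
    also have "- 1 / q * q = - 1" using assms(4) by simp
    finally show "c powr q = 1 / m" using m(2) by (simp add: powr_neg_one)
    have "c powr p = m powr (- 1 / q * p)" by (simp only: c_def powr_powr)
    also have "- 1 / q * p = - p / q" by simp
    finally show "c powr p = m powr (- p / q)" .
  qed
  note [measurable] = test_functions_borel[OF v]
  have w: "(\<lambda>x. c * v x) \<in> test_functions \<Omega>" by (rule test_functions_cmult[OF v])
  have "(\<integral>\<^sup>+x. ennreal (\<bar>c * v x\<bar> powr q) \<partial>lborel) = (\<integral>\<^sup>+x. ennreal (c powr q) * ennreal (\<bar>v x\<bar> powr q) \<partial>lborel)"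
    using c(1) by (intro nn_integral_cong) (simp add: abs_mult powr_mult ennreal_mult)
  also have "\<dots> = ennreal (1 / m) * ennreal m"
    unfolding c(2) m(1)[symmetric] by (rule nn_integral_cmult) measurable
  also have "\<dots> = 1" using m(2) by (simp flip: ennreal_mult)
  finally have "Lq_norm q \<Omega> (\<lambda>x. c * v x) = 1"
    using Lq_norm_eq[OF assms(2) test_functions_borel[OF w] assms(4) test_functions_outside[OF w]]
    by (simp add: ennpowr_def)
  then have "lambda_spq s p q \<Omega> \<le> gagliardo s p (\<lambda>x. c * v x)"
    unfolding lambda_spq_def using w by (intro Inf_lower) auto
  also have "\<dots> = ennreal (m powr (- p / q)) * gagliardo s p v"
    using gagliardo_cmult[OF test_functions_borel[OF v], of s p c] c by simp
  finally show ?thesis .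
qed

subsection \<open>A competitor built from a capacitary function\<close>

text \<open>Truncation: functions competing for the capacity may be assumed to take values in \<open>[0, 1]\<close>
  and to equal \<open>1\<close> in a neighbourhood of the set.\<close>

lemma truncated_capacitary_function:
  fixes S E :: "'a::euclidean_space set" and s p M :: real
  assumes ps: "1 \<le> p" "0 < s" "s < 1" and less: "frac_cap s p S E < ennreal M"
  obtains \<psi> U where "\<psi> \<in> test_functions E" "\<And>x. 0 \<le> \<psi> x" "\<And>x. \<psi> x \<le> 1" "gagliardo s p \<psi> \<le> ennreal M"
    "open U" "S \<subseteq> U" "\<And>x. x \<in> U \<Longrightarrow> \<psi> x = 1"
proof -
  obtain \<phi> where \<phi>: "\<phi> \<in> test_functions E" "\<forall>x\<in>S. 1 \<le> \<phi> x" "gagliardo s p \<phi> < ennreal M"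
    using less unfolding frac_cap_def Inf_less_iff by blast
  obtain g where g: "gagliardo s p \<phi> = ennreal g" "g \<ge> 0"
    using gagliardo_finite[OF ps \<phi>(1)] by (cases "gagliardo s p \<phi>") auto
  have gM: "g < M" using \<phi>(3) g by (simp add: ennreal_less_iff)
  obtain d where d: "d > 0" "exp (2 * d) powr p * g \<le> M"
  proof (cases "g = 0")
    case True
    then show ?thesis using that[of 1] gM by simp
  next
    case False
    define d where "d = ln (M / g) / (2 * p)"
    have "g > 0" "M / g > 1" using False g gM by auto
    then have "d > 0" using ps by (simp add: d_def)
    moreover have "exp (2 * d) powr p = M / g"
      using \<open>M / g > 1\<close> ps \<open>g > 0\<close> gM by (simp add: d_def powr_def)
    ultimately show ?thesis using that[of d] \<open>g > 0\<close> by simp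
  qed
  define e where "e = (exp d - 1) / 2"
  have "exp d > 1" using d(1) by simp
  then have e: "e > 0" "exp d - e > 1" by (simp_all add: e_def field_simps)
  define w where "w x = soft_abs e (exp d * \<phi> x)" for x
  define \<psi> where "\<psi> x = soft_step d (w x)" for x
  have w: "w \<in> test_functions E"
    unfolding w_def[abs_def] by (rule test_functions_soft_abs[OF test_functions_cmult[OF \<phi>(1)] e(1)])
  have \<psi>: "\<psi> \<in> test_functions E"
    unfolding \<psi>_def[abs_def] by (rule test_functions_soft_step[OF w d(1)])
  have w0: "0 \<le> w x" for x using soft_abs_bounds(1)[of e] e(1) by (simp add: w_def)
  have "gagliardo s p \<psi> \<le> ennreal (exp (2 * d) powr p) * gagliardo s p \<phi>"
  proof (rule gagliardo_le_cmult[OF test_functions_borel[OF \<phi>(1)]])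
    fix x y
    have "\<bar>\<psi> x - \<psi> y\<bar> \<le> exp d * \<bar>w x - w y\<bar>"
      unfolding \<psi>_def by (rule soft_step_Lipschitz[OF d(1)])
    also have "\<bar>w x - w y\<bar> \<le> \<bar>exp d * \<phi> x - exp d * \<phi> y\<bar>"
      unfolding w_def by (rule soft_abs_Lipschitz)
    also have "\<dots> = exp d * \<bar>\<phi> x - \<phi> y\<bar>"
      by (simp only: right_diff_distrib[symmetric] abs_mult abs_exp_cancel)
    also have "exp d * (exp d * \<bar>\<phi> x - \<phi> y\<bar>) = exp (2 * d) * \<bar>\<phi> x - \<phi> y\<bar>"
      by (simp only: mult_2 exp_add mult.assoc)
    finally show "\<bar>\<psi> x - \<psi> y\<bar> \<le> exp (2 * d) * \<bar>\<phi> x - \<phi> y\<bar>" by simp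
  qed (use ps in auto)
  also have "\<dots> = ennreal (exp (2 * d) powr p * g)" using g by (simp add: ennreal_mult)
  also have "\<dots> \<le> ennreal M" using d(2) by (rule ennreal_leI)
  finally have gag: "gagliardo s p \<psi> \<le> ennreal M" .
  have U: "open {x. 1 < w x}"
    by (rule open_Collect_less[OF continuous_on_const test_functions_continuous[OF w]])
  have S: "S \<subseteq> {x. 1 < w x}"
  proof
    fix x assume "x \<in> S"
    then have "1 \<le> \<phi> x" using \<phi>(2) by blast
    then have "exp d * 1 \<le> exp d * \<phi> x" by (intro mult_left_mono) auto
    then have "1 < \<bar>exp d * \<phi> x\<bar> - e" using e(2) by linarith
    then show "x \<in> {x. 1 < w x}"
      using soft_abs_bounds(2)[of e "exp d * \<phi> x"] e(1) by (simp add: w_def)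
  qed
  have one: "\<psi> x = 1" if "x \<in> {x. 1 < w x}" for x
    using that by (simp add: \<psi>_def soft_step_ge_1)
  have "0 \<le> \<psi> x" "\<psi> x \<le> 1" for x
    using soft_step_nonneg[OF d(1) w0] soft_step_le_1[OF d(1)] by (simp_all add: \<psi>_def)
  from that[OF \<psi> this gag U S one] show ?thesis .
qed

lemma gagliardo_le_add:
  fixes u v w :: "'a::euclidean_space \<Rightarrow> real" and p s :: real
  assumes [measurable]: "v \<in> borel_measurable borel" "w \<in> borel_measurable borel" and "p \<ge> 1"
    and le: "\<And>x y. \<bar>u x - u y\<bar> \<le> \<bar>v x - v y\<bar> + \<bar>w x - w y\<bar>"
  shows "gagliardo s p u \<le> ennreal (2 powr p) * (gagliardo s p v + gagliardo s p w)"
proof -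
  let ?M = "lborel \<Otimes>\<^sub>M lborel :: ('a \<times> 'a) measure"
  have pw: "ennreal (gagliardo_density s p u x y)
      \<le> ennreal (2 powr p) * (ennreal (gagliardo_density s p v x y) + ennreal (gagliardo_density s p w x y))" for x y
  proof -
    have "\<bar>u x - u y\<bar> powr p \<le> (\<bar>v x - v y\<bar> + \<bar>w x - w y\<bar>) powr p"
      using assms(3) le by (intro powr_mono2) auto
    also have "\<dots> \<le> 2 powr p * (\<bar>v x - v y\<bar> powr p + \<bar>w x - w y\<bar> powr p)"
      using assms(3) by (intro powr_add_le) auto
    finally have "gagliardo_density s p u x y \<le> 2 powr p * (gagliardo_density s p v x y + gagliardo_density s p w x y)"
      unfolding gagliardo_density_def add_divide_distrib[symmetric] times_divide_eq_right
      by (rule divide_right_mono) simp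
    then have "ennreal (gagliardo_density s p u x y)
        \<le> ennreal (2 powr p * (gagliardo_density s p v x y + gagliardo_density s p w x y))" by (rule ennreal_leI)
    also have "\<dots> = ennreal (2 powr p) * ennreal (gagliardo_density s p v x y + gagliardo_density s p w x y)"
      by (rule ennreal_mult) (simp_all add: gagliardo_density_nonneg)
    also have "ennreal (gagliardo_density s p v x y + gagliardo_density s p w x y)
        = ennreal (gagliardo_density s p v x y) + ennreal (gagliardo_density s p w x y)"
      by (rule ennreal_plus) (simp_all add: gagliardo_density_nonneg)
    finally show ?thesis .
  qed
  have "gagliardo s p u \<le> (\<integral>\<^sup>+z. ennreal (2 powr p) * (ennreal (gagliardo_density s p v (fst z) (snd z))
      + ennreal (gagliardo_density s p w (fst z) (snd z))) \<partial>?M)"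
    unfolding gagliardo_eq by (intro nn_integral_mono pw)
  also have "\<dots> = ennreal (2 powr p) * (\<integral>\<^sup>+z. ennreal (gagliardo_density s p v (fst z) (snd z))
      + ennreal (gagliardo_density s p w (fst z) (snd z)) \<partial>?M)"
    by (rule nn_integral_cmult) measurable
  also have "(\<integral>\<^sup>+z. ennreal (gagliardo_density s p v (fst z) (snd z))
      + ennreal (gagliardo_density s p w (fst z) (snd z)) \<partial>?M) = gagliardo s p v + gagliardo s p w"
    unfolding gagliardo_eq by (rule nn_integral_add) measurable
  finally show ?thesis .
qed

text \<open>The deficit of \<open>\<psi>\<close> in the unit ball is its distance, in the \<open>L\<^sup>1\<close> sense, from being an
  admissible function for the capacity of the whole ball. If it is bounded below, then
  \<open>1 - \<psi>\<close>, cut off near the boundary of the ball, is a test function with controlled Rayleigh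
  quotient.\<close>

definition ball_deficit :: "('a::euclidean_space \<Rightarrow> real) \<Rightarrow> ennreal" where
  "ball_deficit \<psi> = (\<integral>\<^sup>+x. ennreal (1 - \<psi> x) * indicator (ball 0 1) x \<partial>lborel)"

lemma competitor_from_deficit:
  fixes s p q \<delta> G :: real
  assumes ps: "1 \<le> p" "0 < s" "s < 1" and q: "q \<ge> 1" and \<delta>: "\<delta> > 0" and G: "G \<ge> 0"
  obtains K1 K2 where "K1 \<ge> 0" "K2 > 0"
    "\<And>(\<Omega> :: 'a::euclidean_space set) \<psi> U. \<psi> \<in> test_functions (ball 0 2) \<Longrightarrow> (\<And>x. 0 \<le> \<psi> x) \<Longrightarrow> (\<And>x. \<psi> x \<le> 1) \<Longrightarrow>
      gagliardo s p \<psi> \<le> ennreal G \<Longrightarrow> open U \<Longrightarrow> cball 0 1 - \<Omega> \<subseteq> U \<Longrightarrow> (\<And>x. x \<in> U \<Longrightarrow> \<psi> x = 1) \<Longrightarrow>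
      ennreal \<delta> \<le> ball_deficit \<psi> \<Longrightarrow>
      \<exists>u\<in>test_functions \<Omega>. gagliardo s p u \<le> ennreal K1 \<and>
        ennreal K2 \<le> (\<integral>\<^sup>+x. ennreal (\<bar>u x\<bar> powr q) \<partial>lborel)"
proof -
  define V where "V = unit_ball_vol (real DIM('a))"
  have V: "V > 0" by (simp add: V_def)
  \<comment> \<open>a radius \<open>a < 1\<close> for which the annulus outside it has measure at most \<open>\<delta> / 2\<close>\<close>
  obtain a where a: "0 < a" "a < 1" "V * (1 - a ^ DIM('a)) \<le> \<delta> / 2"
  proof -
    have "((\<lambda>a. V * (1 - a ^ DIM('a))) \<longlongrightarrow> V * (1 - 1 ^ DIM('a))) (at_left (1::real))"
      by (intro tendsto_intros)
    then have "eventually (\<lambda>a. V * (1 - a ^ DIM('a)) < \<delta> / 2) (at_left (1::real))"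
      using \<delta> by (intro order_tendstoD(2)) auto
    moreover have "eventually (\<lambda>a. a \<in> {0<..<1}) (at_left (1::real))"
      by (rule eventually_at_left_real) simp
    ultimately have "eventually (\<lambda>a. a \<in> {0<..<1} \<and> V * (1 - a ^ DIM('a)) < \<delta> / 2) (at_left (1::real))"
      by eventually_elim simp
    then obtain a where "a \<in> {0<..<1}" "V * (1 - a ^ DIM('a)) < \<delta> / 2"
      using eventually_happens'[OF trivial_limit_at_left_real] by blast
    then show ?thesis using that[of a] by auto
  qed
  define b where "b = (a + 1) / 2"
  have b: "a < b" "b < 1" using a by (auto simp: b_def)
  define \<eta> where "\<eta> = cutoff (0::'a) a b"
  have \<eta>: "\<eta> \<in> test_functions (ball 0 1)"
    unfolding \<eta>_def using a b by (intro test_functions_cutoff) auto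
  obtain H where H: "gagliardo s p \<eta> = ennreal H" "H \<ge> 0"
    using gagliardo_finite[OF ps \<eta>] by (cases "gagliardo s p \<eta>") auto
  define \<tau> where "\<tau> = \<delta> / (4 * V)"
  have \<tau>: "\<tau> > 0" using \<delta> V by (simp add: \<tau>_def)
  define K2 where "K2 = \<tau> powr (q - 1) * (\<delta> / 4)"
  show ?thesis
  proof (rule that[of "2 powr p * (H + G)" K2])
    show "2 powr p * (H + G) \<ge> 0" using H G by simp
    show "K2 > 0" using \<tau> \<delta> by (simp add: K2_def)
    fix \<Omega> :: "'a set" and \<psi> :: "'a \<Rightarrow> real" and U
    assume \<psi>: "\<psi> \<in> test_functions (ball 0 2)" "\<And>x. 0 \<le> \<psi> x" "\<And>x. \<psi> x \<le> 1" "gagliardo s p \<psi> \<le> ennreal G"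
      and U: "open U" "cball 0 1 - \<Omega> \<subseteq> U" "\<And>x. x \<in> U \<Longrightarrow> \<psi> x = 1"
      and def: "ennreal \<delta> \<le> ball_deficit \<psi>"
    note [measurable] = test_functions_borel[OF \<psi>(1)] test_functions_borel[OF \<eta>]
    define u where "u x = \<eta> x * (1 - \<psi> x)" for x
    have [measurable]: "u \<in> borel_measurable borel" unfolding u_def[abs_def] by measurable
    have \<eta>r: "0 \<le> \<eta> x" "\<eta> x \<le> 1" for x using cutoff_range[of 0 a b x] by (auto simp: \<eta>_def)
    have ur: "0 \<le> u x" "u x \<le> 1" for x
      using \<eta>r[of x] \<psi>(2,3)[of x] by (auto simp: u_def intro: mult_le_one)
    have u: "u \<in> test_functions \<Omega>"
    proof (rule test_functionsI)
      show "Ck k u" for k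
        unfolding u_def[abs_def] by (intro Ck_mult Ck_diff Ck_const test_functions_Ck[OF \<eta>] test_functions_Ck[OF \<psi>(1)])
      show "compact (cball 0 b - U)" using U(1) by (intro compact_diff compact_cball)
      have "cball (0::'a) b \<subseteq> cball 0 1" using b by (intro subset_cball) simp
      then show "cball 0 b - U \<subseteq> \<Omega>" using U(2) by blast
      show "u x = 0" if "x \<notin> cball 0 b - U" for x
      proof (cases "x \<in> U")
        case False
        then have "b \<le> dist x 0" using that by auto
        then show ?thesis using a b by (simp add: u_def \<eta>_def cutoff_eq_0)
      qed (simp add: u_def U(3))
    qed
    have gu: "gagliardo s p u \<le> ennreal (2 powr p * (H + G))"
    proof -
      have "gagliardo s p u \<le> ennreal (2 powr p) * (gagliardo s p \<eta> + gagliardo s p \<psi>)"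
      proof (rule gagliardo_le_add[OF _ _ ps(1)])
        fix x y
        have "u x - u y = (1 - \<psi> x) * (\<eta> x - \<eta> y) - \<eta> y * (\<psi> x - \<psi> y)"
          by (simp add: u_def algebra_simps)
        then have "\<bar>u x - u y\<bar> \<le> \<bar>(1 - \<psi> x) * (\<eta> x - \<eta> y)\<bar> + \<bar>\<eta> y * (\<psi> x - \<psi> y)\<bar>" by linarith
        also have "\<dots> \<le> 1 * \<bar>\<eta> x - \<eta> y\<bar> + 1 * \<bar>\<psi> x - \<psi> y\<bar>"
          unfolding abs_mult using \<eta>r[of y] \<psi>(2,3)[of x] by (intro add_mono mult_right_mono) auto
        finally show "\<bar>u x - u y\<bar> \<le> \<bar>\<eta> x - \<eta> y\<bar> + \<bar>\<psi> x - \<psi> y\<bar>" by simp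
      qed measurable
      also have "\<dots> \<le> ennreal (2 powr p) * (ennreal H + ennreal G)"
        unfolding H(1) by (intro mult_left_mono add_left_mono \<psi>(4)) simp
      also have "\<dots> = ennreal (2 powr p * (H + G))"
        using H(2) G by (simp add: ennreal_mult ennreal_plus)
      finally show ?thesis .
    qed
    define Iq where "Iq = (\<integral>\<^sup>+x. ennreal (\<bar>u x\<bar> powr q) \<partial>lborel)"
    have low: "ennreal K2 \<le> Iq"
    proof (cases "Iq = \<infinity>")
      case False
      then obtain m where m: "Iq = ennreal m" "m \<ge> 0" by (cases Iq) auto
      \<comment> \<open>split \<open>1 - \<psi>\<close> into its part on the annulus, its small values and its large values\<close>
      have "ball_deficit \<psi> \<le> (\<integral>\<^sup>+x. indicator (ball 0 1 - ball 0 a) x + (ennreal \<tau> * indicator (ball 0 1) x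
          + ennreal (\<tau> powr (1 - q)) * ennreal (\<bar>u x\<bar> powr q)) \<partial>lborel)"
        unfolding ball_deficit_def
      proof (rule nn_integral_mono)
        fix x :: 'a
        consider "x \<notin> ball 0 1" | "x \<in> ball 0 1" "x \<notin> ball 0 a" | "x \<in> ball 0 a" "u x \<le> \<tau>" | "x \<in> ball 0 a" "\<tau> < u x"
          by fastforce
        then show "ennreal (1 - \<psi> x) * indicator (ball 0 1) x \<le> indicator (ball 0 1 - ball 0 a) x
          + (ennreal \<tau> * indicator (ball 0 1) x + ennreal (\<tau> powr (1 - q)) * ennreal (\<bar>u x\<bar> powr q))"
        proof cases
          case 2
          have "ennreal (1 - \<psi> x) \<le> 1" using \<psi>(2)[of x] by (simp add: ennreal_le_1)
          also have "1 \<le> 1 + (ennreal \<tau> * 1 + ennreal (\<tau> powr (1 - q)) * ennreal (\<bar>u x\<bar> powr q))" by simp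
          finally show ?thesis using 2 by simp
        next
          case 3
          then have "u x = 1 - \<psi> x" using a b by (simp add: u_def \<eta>_def cutoff_eq_1)
          then have "ennreal (1 - \<psi> x) \<le> ennreal \<tau>" using 3 by (intro ennreal_leI) simp
          moreover have "x \<in> ball 0 1" using 3 a by auto
          ultimately show ?thesis using 3 by (simp add: add_increasing2)
        next
          case 4
          then have eq: "u x = 1 - \<psi> x" using a b by (simp add: u_def \<eta>_def cutoff_eq_1)
          have "u x = u x powr (1 - q) * u x powr q" using 4 \<tau> by (simp flip: powr_add)
          also have "\<dots> \<le> \<tau> powr (1 - q) * u x powr q"
            using 4 \<tau> q by (intro mult_right_mono powr_mono2') auto
          finally have "ennreal (1 - \<psi> x) \<le> ennreal (\<tau> powr (1 - q) * \<bar>u x\<bar> powr q)"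
            using ur(1)[of x] eq by (intro ennreal_leI) simp
          also have "\<dots> = ennreal (\<tau> powr (1 - q)) * ennreal (\<bar>u x\<bar> powr q)" by (rule ennreal_mult) auto
          finally have *: "ennreal (1 - \<psi> x) \<le> ennreal (\<tau> powr (1 - q)) * ennreal (\<bar>u x\<bar> powr q)" .
          have "x \<in> ball 0 1" using 4 a by auto
          then show ?thesis using * 4 by (simp add: add_increasing)
        qed simp
      qed
      also have "\<dots> = emeasure lborel (ball 0 1 - ball (0::'a) a) + (ennreal \<tau> * emeasure lborel (ball (0::'a) 1)
          + ennreal (\<tau> powr (1 - q)) * Iq)"
      proof -
        have [measurable]: "ball 0 1 - ball 0 a \<in> sets (borel :: 'a measure)" "ball 0 1 \<in> sets (borel :: 'a measure)"
          by (intro sets.Diff borel_open open_ball)+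
        let ?X = "\<lambda>x::'a. indicator (ball 0 1 - ball 0 a) x :: ennreal"
        let ?Y = "\<lambda>x::'a. ennreal \<tau> * indicator (ball 0 1) x"
        let ?Z = "\<lambda>x. ennreal (\<tau> powr (1 - q)) * ennreal (\<bar>u x\<bar> powr q)"
        have "(\<integral>\<^sup>+x. ?X x + (?Y x + ?Z x) \<partial>lborel) = (\<integral>\<^sup>+x. ?X x \<partial>lborel) + (\<integral>\<^sup>+x. ?Y x + ?Z x \<partial>lborel)"
          by (rule nn_integral_add) measurable
        also have "(\<integral>\<^sup>+x. ?Y x + ?Z x \<partial>lborel) = (\<integral>\<^sup>+x. ?Y x \<partial>lborel) + (\<integral>\<^sup>+x. ?Z x \<partial>lborel)"
          by (rule nn_integral_add) measurable
        also have "(\<integral>\<^sup>+x. ?X x \<partial>lborel) = emeasure lborel (ball 0 1 - ball (0::'a) a)"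
          by (rule nn_integral_indicator) measurable
        also have "(\<integral>\<^sup>+x. ?Y x \<partial>lborel) = ennreal \<tau> * emeasure lborel (ball (0::'a) 1)"
          by (rule nn_integral_cmult_indicator) measurable
        also have "(\<integral>\<^sup>+x. ?Z x \<partial>lborel) = ennreal (\<tau> powr (1 - q)) * Iq"
          unfolding Iq_def by (rule nn_integral_cmult) measurable
        finally show ?thesis .
      qed
      also have "emeasure lborel (ball 0 1 - ball (0::'a) a) = ennreal (V * (1 - a ^ DIM('a)))"
      proof -
        have "emeasure lborel (ball 0 1 - ball (0::'a) a) = emeasure lborel (ball (0::'a) 1) - emeasure lborel (ball (0::'a) a)"
          using a by (intro emeasure_Diff) (auto simp: emeasure_ball)
        also have "\<dots> = ennreal (V * 1) - ennreal (V * a ^ DIM('a))"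
          using a by (simp add: emeasure_ball V_def)
        also have "\<dots> = ennreal (V * 1 - V * a ^ DIM('a))"
          using a V by (intro ennreal_minus) simp
        finally show ?thesis by (simp add: right_diff_distrib)
      qed
      also have "ennreal \<tau> * emeasure lborel (ball (0::'a) 1) = ennreal (\<tau> * V)"
        using \<tau> V by (simp add: emeasure_ball V_def ennreal_mult)
      finally have "ennreal \<delta> \<le> ennreal (V * (1 - a ^ DIM('a))) + (ennreal (\<tau> * V) + ennreal (\<tau> powr (1 - q)) * ennreal m)"
        using def m(1) by (simp add: order_trans)
      also have "\<dots> = ennreal (V * (1 - a ^ DIM('a)) + (\<tau> * V + \<tau> powr (1 - q) * m))"
        using a V \<tau> m(2) by (simp add: ennreal_plus[symmetric] ennreal_mult[symmetric] power_le_one del: ennreal_plus)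
      finally have "\<delta> \<le> V * (1 - a ^ DIM('a)) + (\<tau> * V + \<tau> powr (1 - q) * m)"
        by (rule ennreal_le_iff[THEN iffD1, rotated]) (use a V \<tau> m(2) in \<open>simp add: power_le_one\<close>)
      moreover have "\<tau> * V = \<delta> / 4" using V by (simp add: \<tau>_def)
      ultimately have "\<delta> / 4 \<le> \<tau> powr (1 - q) * m" using a(3) by linarith
      then have "\<tau> powr (q - 1) * (\<delta> / 4) \<le> \<tau> powr (q - 1) * (\<tau> powr (1 - q) * m)"
        by (rule mult_left_mono) simp
      also have "\<dots> = m" using \<tau> by (simp flip: powr_add mult.assoc)
      finally show ?thesis by (simp add: m(1) K2_def ennreal_leI)
    qed simp
    show "\<exists>u\<in>test_functions \<Omega>. gagliardo s p u \<le> ennreal (2 powr p * (H + G)) \<and>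
        ennreal K2 \<le> (\<integral>\<^sup>+x. ennreal (\<bar>u x\<bar> powr q) \<partial>lborel)"
      using u gu low unfolding Iq_def by blast
  qed
qed

subsection \<open>The bound in terms of the capacitary inradius\<close>

text \<open>The number \<open>\<gamma>'\<close> leaves room between the capacity of a negligible set, at most \<open>\<gamma> \<kappa>\<close>, and the
  energy of the functions considered; hence an admissible function of energy at most \<open>\<gamma>' \<kappa>\<close> exists. The
  competitor on the unit ball is transplanted to the given ball, and the powers of the radius that
  arise from the energy and from the \<open>L\<^sup>q\<close> norm combine to \<open>- a\<close>.\<close>

lemma upper_bound_from_deficit:
  fixes s p q \<gamma> \<gamma>' \<kappa> \<delta> :: real
  defines "a \<equiv> s * p - real DIM('a) + real DIM('a) * p / q"
  assumes ps: "1 \<le> p" "0 < s" "s < 1" and pq: "p \<le> q" and a: "0 < a"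
    and \<gamma>: "0 < \<gamma>" "\<gamma> < \<gamma>'" and \<delta>: "\<delta> > 0" and \<kappa>: "\<kappa> > 0"
    and cap: "frac_cap s p (cball (0::'a::euclidean_space) 1) (ball 0 2) = ennreal \<kappa>"
    and deficit: "\<And>\<psi> :: 'a \<Rightarrow> real. \<psi> \<in> test_functions (ball 0 2) \<Longrightarrow> (\<And>x. 0 \<le> \<psi> x) \<Longrightarrow> (\<And>x. \<psi> x \<le> 1) \<Longrightarrow>
      gagliardo s p \<psi> \<le> ennreal (\<gamma>' * \<kappa>) \<Longrightarrow> ennreal \<delta> \<le> ball_deficit \<psi>"
  obtains C where "C > 0"
    "\<And>\<Omega> :: 'a set. open \<Omega> \<Longrightarrow> lambda_spq s p q \<Omega> \<le> ennreal C * ennpowr (1 / cap_inradius s p \<gamma> \<Omega>) a"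
proof -
  have q: "q \<ge> 1" "q > 0" "p > 0" using ps pq by auto
  define e where "e = s * p - real DIM('a)"
  have G: "\<gamma>' * \<kappa> \<ge> 0" using \<gamma> \<kappa> by simp
  obtain K1 K2 where K: "K1 \<ge> 0" "K2 > 0"
    and comp: "\<And>(\<Omega> :: 'a set) \<psi> U. \<psi> \<in> test_functions (ball 0 2) \<Longrightarrow> (\<And>x. 0 \<le> \<psi> x) \<Longrightarrow> (\<And>x. \<psi> x \<le> 1) \<Longrightarrow>
      gagliardo s p \<psi> \<le> ennreal (\<gamma>' * \<kappa>) \<Longrightarrow> open U \<Longrightarrow> cball 0 1 - \<Omega> \<subseteq> U \<Longrightarrow> (\<And>x. x \<in> U \<Longrightarrow> \<psi> x = 1) \<Longrightarrow>
      ennreal \<delta> \<le> ball_deficit \<psi> \<Longrightarrow>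
      \<exists>u\<in>test_functions \<Omega>. gagliardo s p u \<le> ennreal K1 \<and>
        ennreal K2 \<le> (\<integral>\<^sup>+x. ennreal (\<bar>u x\<bar> powr q) \<partial>lborel)"
    using competitor_from_deficit[OF ps q(1) \<delta> G, where 'a='a] by blast
  define C where "C = (K1 + 1) * K2 powr (- p / q)"
  have C: "C > 0" using K by (simp add: C_def add_nonneg_pos)
  have main: "lambda_spq s p q \<Omega> \<le> ennreal (C * r powr (- a))"
    if "open \<Omega>" and r: "r > 0" and neg: "cap_negligible s p \<gamma> x0 r (cball x0 r - \<Omega>)" for \<Omega> :: "'a set" and x0 r
  proof -
    define aff where "aff x = r *\<^sub>R x + x0" for x
    define inv_aff where "inv_aff x = (1 / r) *\<^sub>R x + (- (1 / r)) *\<^sub>R x0" for x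
    have inv: "aff (inv_aff x) = x" "inv_aff (aff x) = x" for x
      using r by (simp_all add: aff_def inv_aff_def scaleR_diff_right scaleR_add_right)
    have dist_aff: "dist x0 (aff x) = r * norm x" for x
      using r by (simp add: aff_def dist_norm)
    have pre: "aff -` cball x0 r = cball 0 1" "aff -` ball x0 (2 * r) = ball 0 2"
      using r by (auto simp: dist_aff)
    have dist_inv: "norm (inv_aff x) = (1 / r) * dist x0 x" for x
      using dist_aff[of "inv_aff x"] r by (simp add: inv(1))
    have pre': "inv_aff -` cball 0 1 = cball x0 r" "inv_aff -` ball 0 2 = ball x0 (2 * r)"
      using r by (auto simp: dist_inv field_simps)
    have capS: "frac_cap s p (cball 0 1 - aff -` \<Omega>) (ball 0 2) < ennreal (\<gamma>' * \<kappa>)"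
    proof -
      have "frac_cap s p (aff -` (cball x0 r - \<Omega>)) (aff -` ball x0 (2 * r))
          \<le> ennreal (r powr e) * frac_cap s p (cball x0 r - \<Omega>) (ball x0 (2 * r))"
        unfolding aff_def e_def by (rule frac_cap_affine_le[OF r])
      also have "\<dots> \<le> ennreal (r powr e) * (ennreal \<gamma> * frac_cap s p (cball x0 r) (ball x0 (2 * r)))"
        using neg by (intro mult_left_mono) (auto simp: cap_negligible_def)
      also have "\<dots> \<le> ennreal (r powr e) * (ennreal \<gamma> * (ennreal ((1 / r) powr e) * ennreal \<kappa>))"
      proof (intro mult_left_mono)
        have "0 < 1 / r" using r by simp
        from frac_cap_affine_le[OF this, of s p "(- (1 / r)) *\<^sub>R x0" "cball 0 1" "ball 0 2"]
        show "frac_cap s p (cball x0 r) (ball x0 (2 * r)) \<le> ennreal ((1 / r) powr e) * ennreal \<kappa>"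
          unfolding inv_aff_def[symmetric] pre' cap e_def .
      qed simp_all
      also have "\<dots> = ennreal (r powr e * (\<gamma> * ((1 / r) powr e * \<kappa>)))"
        using \<gamma> \<kappa> by (simp add: ennreal_mult)
      also have "r powr e * (\<gamma> * ((1 / r) powr e * \<kappa>)) = \<gamma> * \<kappa>"
        using r by (simp add: powr_divide)
      finally have "frac_cap s p (aff -` (cball x0 r - \<Omega>)) (aff -` ball x0 (2 * r)) \<le> ennreal (\<gamma> * \<kappa>)" .
      also have "\<dots> < ennreal (\<gamma>' * \<kappa>)" using \<gamma> \<kappa> by (simp add: ennreal_less_iff)
      finally show ?thesis by (simp only: vimage_Diff pre)
    qed
    obtain \<psi> U where \<psi>: "\<psi> \<in> test_functions (ball 0 2)" "\<And>x. 0 \<le> \<psi> x" "\<And>x. \<psi> x \<le> 1"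
      "gagliardo s p \<psi> \<le> ennreal (\<gamma>' * \<kappa>)" "open U" "cball 0 1 - aff -` \<Omega> \<subseteq> U" "\<And>x. x \<in> U \<Longrightarrow> \<psi> x = 1"
      using truncated_capacitary_function[OF ps capS] by metis
    obtain u where u: "u \<in> test_functions (aff -` \<Omega>)" "gagliardo s p u \<le> ennreal K1"
      "ennreal K2 \<le> (\<integral>\<^sup>+x. ennreal (\<bar>u x\<bar> powr q) \<partial>lborel)"
      using comp[OF \<psi> deficit[OF \<psi>(1-4)]] by blast
    define v where "v x = u (inv_aff x)" for x
    have v: "v \<in> test_functions \<Omega>"
      unfolding v_def[abs_def] inv_aff_def
    proof (rule test_functions_affine[OF u(1)])
      show "1 / r \<noteq> 0" using r by simp
      show "x \<in> \<Omega>" if "(1 / r) *\<^sub>R x + (- (1 / r)) *\<^sub>R x0 \<in> aff -` \<Omega>" for x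
        using that unfolding inv_aff_def[symmetric] by (simp add: inv)
    qed
    note [measurable] = test_functions_borel[OF v]
    have gv: "gagliardo s p v \<le> ennreal ((1 / r) powr e * K1)"
    proof -
      have "0 < 1 / r" using r by simp
      from gagliardo_affine[OF test_functions_borel[OF u(1)] this, of s p "(- (1 / r)) *\<^sub>R x0"]
      have "gagliardo s p v = ennreal ((1 / r) powr e) * gagliardo s p u"
        unfolding v_def[abs_def] inv_aff_def e_def .
      also have "\<dots> \<le> ennreal ((1 / r) powr e) * ennreal K1" by (intro mult_left_mono u(2)) simp
      also have "\<dots> = ennreal ((1 / r) powr e * K1)" using K by (simp add: ennreal_mult)
      finally show ?thesis .
    qed
    obtain m where m: "(\<integral>\<^sup>+x. ennreal (\<bar>u x\<bar> powr q) \<partial>lborel) = ennreal m" "m \<ge> K2"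
      using test_functions_Lq_finite[OF u(1) q(2)] u(3) K(2)
      by (cases "\<integral>\<^sup>+x. ennreal (\<bar>u x\<bar> powr q) \<partial>lborel") (auto simp: ennreal_le_iff)
    have vm: "(\<integral>\<^sup>+x. ennreal (\<bar>v x\<bar> powr q) \<partial>lborel) = ennreal (r ^ DIM('a) * m)"
    proof -
      have "r \<noteq> 0" using r by simp
      have "(\<lambda>x. ennreal (\<bar>v x\<bar> powr q)) \<in> borel_measurable borel" by measurable
      from nn_integral_lborel_affine[OF this \<open>r \<noteq> 0\<close>, of x0]
      have "(\<integral>\<^sup>+x. ennreal (\<bar>v x\<bar> powr q) \<partial>lborel) = ennreal (\<bar>r\<bar> ^ DIM('a)) * (\<integral>\<^sup>+x. ennreal (\<bar>u x\<bar> powr q) \<partial>lborel)"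
        unfolding v_def aff_def[symmetric] inv .
      then show ?thesis using r m K(2) by (simp add: ennreal_mult)
    qed
    have "lambda_spq s p q \<Omega> \<le> ennreal ((r ^ DIM('a) * m) powr (- p / q)) * gagliardo s p v"
      by (rule lambda_spq_le[OF v \<open>open \<Omega>\<close> q(3,2) vm]) (use r m K(2) in simp)
    also have "\<dots> \<le> ennreal ((r ^ DIM('a) * m) powr (- p / q)) * ennreal ((1 / r) powr e * K1)"
      by (intro mult_left_mono gv) simp
    also have "\<dots> = ennreal ((r ^ DIM('a) * m) powr (- p / q) * ((1 / r) powr e * K1))"
      using K by (intro ennreal_mult[symmetric]) auto
    also have "\<dots> \<le> ennreal (C * r powr (- a))"
    proof (rule ennreal_leI)
      have exp_eq: "real DIM('a) * (- p / q) + - e = - a" by (simp add: a_def e_def)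
      have ire: "(1 / r) powr e = r powr (- e)" using r by (simp add: powr_divide powr_minus_divide)
      have "(r ^ DIM('a) * m) powr (- p / q) = r powr (real DIM('a) * (- p / q)) * m powr (- p / q)"
        using r m K(2) by (simp add: powr_mult powr_powr powr_realpow[symmetric])
      also have "\<dots> \<le> r powr (real DIM('a) * (- p / q)) * K2 powr (- p / q)"
        using m K(2) q by (intro mult_left_mono powr_mono2') auto
      finally have "(r ^ DIM('a) * m) powr (- p / q) * ((1 / r) powr e * K1)
          \<le> (r powr (real DIM('a) * (- p / q)) * K2 powr (- p / q)) * ((1 / r) powr e * K1)"
        by (rule mult_right_mono) (use K in simp)
      also have "\<dots> \<le> (r powr (real DIM('a) * (- p / q)) * K2 powr (- p / q)) * ((1 / r) powr e * (K1 + 1))"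
        by (intro mult_left_mono) auto
      also have "\<dots> = C * (r powr (real DIM('a) * (- p / q)) * (1 / r) powr e)"
        by (simp only: C_def mult.assoc mult.commute mult.left_commute)
      also have "r powr (real DIM('a) * (- p / q)) * (1 / r) powr e = r powr (- a)"
        unfolding ire powr_add[symmetric] exp_eq ..
      finally show "(r ^ DIM('a) * m) powr (- p / q) * ((1 / r) powr e * K1) \<le> C * r powr (- a)" .
    qed
    finally show ?thesis .
  qed
  show ?thesis
  proof (rule that[OF C])
    fix \<Omega> :: "'a set" assume "open \<Omega>"
    let ?R = "cap_inradius s p \<gamma> \<Omega>"
    let ?S = "{ennreal r | r. r > 0 \<and> (\<exists>x\<^sub>0. cap_negligible s p \<gamma> x\<^sub>0 r (cball x\<^sub>0 r - \<Omega>))}"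
    show "lambda_spq s p q \<Omega> \<le> ennreal C * ennpowr (1 / ?R) a"
    proof (cases "?R = 0 \<or> lambda_spq s p q \<Omega> = 0")
      case True
      then show ?thesis
      proof
        assume "?R = 0"
        then have "1 / ?R = \<infinity>" by (simp add: ennreal_divide_zero)
        then show ?thesis using C by (simp add: ennpowr_def ennreal_mult_top)
      qed simp
    next
      case False
      then have "?S \<noteq> {}" unfolding cap_inradius_def by (metis Sup_empty bot_ennreal)
      then obtain r0 x0 where "r0 > 0" "cap_negligible s p \<gamma> x0 r0 (cball x0 r0 - \<Omega>)" by blast
      then have "lambda_spq s p q \<Omega> \<le> ennreal (C * r0 powr (- a))" by (rule main[OF \<open>open \<Omega>\<close>])
      then obtain l where l: "lambda_spq s p q \<Omega> = ennreal l" "l > 0"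
        using False by (cases "lambda_spq s p q \<Omega>") (auto simp: top_unique less_le)
      define T where "T = (C / l) powr (1 / a)"
      have "?R \<le> ennreal T"
        unfolding cap_inradius_def
      proof (rule Sup_least, clarify)
        fix r x0 assume r: "r > 0" "cap_negligible s p \<gamma> x0 r (cball x0 r - \<Omega>)"
        have "l \<le> C * r powr (- a)"
          using main[OF \<open>open \<Omega>\<close> r] C l by (simp add: ennreal_le_iff)
        then have "r powr a \<le> C / l"
          using r(1) l(2) by (simp add: powr_minus pos_le_divide_eq divide_inverse[symmetric] mult.commute)
        then have "(r powr a) powr (1 / a) \<le> T" unfolding T_def using a by (intro powr_mono2) auto
        then show "ennreal r \<le> ennreal T" using r(1) a by (intro ennreal_leI) (simp add: powr_powr)
      qed
      then obtain \<rho> where \<rho>: "?R = ennreal \<rho>" "\<rho> > 0" "\<rho> \<le> T"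
        using False by (cases ?R) (auto simp: top_unique ennreal_le_iff2 less_le)
      have "\<rho> powr a \<le> T powr a" using \<rho> a by (intro powr_mono2) auto
      also have "\<dots> = C / l" using C l a by (simp add: T_def powr_powr)
      finally have "l \<le> C * (1 / \<rho>) powr a"
        using \<rho>(2) l(2) by (simp add: powr_divide pos_le_divide_eq mult.commute)
      moreover have "1 / ?R = ennreal (1 / \<rho>)"
        using \<rho> by (simp add: divide_ennreal[symmetric])
      ultimately show ?thesis
        using C \<rho>(2) by (simp add: l(1) ennpowr_ennreal ennreal_leI flip: ennreal_mult)
    qed
  qed
qed

text \<open>For small energies the Poincare inequality prevents \<open>\<psi>\<close> from being close to \<open>1\<close> on more
  than a fraction of the unit ball.\<close>

lemma deficit_of_small_energy:
  fixes s p \<kappa> :: real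
  assumes ps: "1 \<le> p" "0 < s" and \<kappa>: "\<kappa> > 0"
  obtains \<gamma>0 \<delta> where "0 < \<gamma>0" "\<gamma>0 \<le> 1" "\<delta> > 0"
    "\<And>\<psi> :: 'a::euclidean_space \<Rightarrow> real. \<psi> \<in> test_functions (ball 0 2) \<Longrightarrow> (\<And>x. 0 \<le> \<psi> x) \<Longrightarrow> (\<And>x. \<psi> x \<le> 1) \<Longrightarrow>
      gagliardo s p \<psi> \<le> ennreal (\<gamma>0 * \<kappa>) \<Longrightarrow> ennreal \<delta> \<le> ball_deficit \<psi>"
proof -
  define V where "V = unit_ball_vol (real DIM('a))"
  have V: "V > 0" by (simp add: V_def)
  define c where "c = V * 2 ^ DIM('a) / (5 * 2) powr (real DIM('a) + s * p)"
  have c: "c > 0" using V by (simp add: c_def)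
  define B where "B = 2 powr (p - 1)"
  have B: "B > 0" by (simp add: B_def)
  define \<gamma>0 where "\<gamma>0 = min 1 (V / 4 * c / (B * \<kappa>))"
  have \<gamma>0: "0 < \<gamma>0" "\<gamma>0 \<le> 1" "\<gamma>0 \<le> V / 4 * c / (B * \<kappa>)" using V c B \<kappa> by (auto simp: \<gamma>0_def)
  show ?thesis
  proof (rule that[OF \<gamma>0(1,2), of "V / 4"])
    show "V / 4 > 0" using V by simp
    fix \<psi> :: "'a \<Rightarrow> real"
    assume \<psi>: "\<psi> \<in> test_functions (ball 0 2)" "\<And>x. 0 \<le> \<psi> x" "\<And>x. \<psi> x \<le> 1" "gagliardo s p \<psi> \<le> ennreal (\<gamma>0 * \<kappa>)"
    note [measurable] = test_functions_borel[OF \<psi>(1)]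
    have [measurable]: "ball 0 1 \<in> sets (borel :: 'a measure)" by simp
    define I where "I = (\<integral>\<^sup>+x. ennreal (\<bar>\<psi> x\<bar> powr p) \<partial>lborel)"
    have "ennreal c * I \<le> gagliardo s p \<psi>"
      unfolding c_def V_def I_def
      by (rule gagliardo_ge_Lp_of_bounded_support[where ?x0.0=0])
         (use ps test_functions_outside[OF \<psi>(1)] in auto)
    also note \<psi>(4)
    finally have "ennreal (1 / c) * (ennreal c * I) \<le> ennreal (1 / c) * ennreal (\<gamma>0 * \<kappa>)" by (rule mult_left_mono) simp
    moreover have "ennreal (1 / c) * (ennreal c * I) = I" using c by (simp flip: mult.assoc ennreal_mult)
    ultimately have I: "I \<le> ennreal (1 / c) * ennreal (\<gamma>0 * \<kappa>)" by simp
    have BI: "ennreal B * I \<le> ennreal (V / 4)"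
    proof -
      have "ennreal B * I \<le> ennreal B * (ennreal (1 / c) * ennreal (\<gamma>0 * \<kappa>))" by (rule mult_left_mono[OF I]) simp
      also have "\<dots> = ennreal (B * (1 / c * (\<gamma>0 * \<kappa>)))" using B c \<gamma>0 \<kappa> by (simp flip: ennreal_mult)
      also have "\<dots> \<le> ennreal (V / 4)"
      proof (rule ennreal_leI)
        have "\<gamma>0 * (B * \<kappa>) \<le> V / 4 * c" using \<gamma>0(3) B \<kappa> by (simp add: pos_le_divide_eq)
        then have "\<gamma>0 * (B * \<kappa>) / c \<le> V / 4" using c by (simp add: pos_divide_le_eq)
        then show "B * (1 / c * (\<gamma>0 * \<kappa>)) \<le> V / 4" by (simp add: mult_ac)
      qed
      finally show ?thesis .
    qed
    have "ennreal V = (\<integral>\<^sup>+x. indicator (ball (0::'a) 1) x \<partial>lborel)"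
      by (simp add: emeasure_ball V_def)
    also have "\<dots> \<le> (\<integral>\<^sup>+x. ennreal (1 - \<psi> x) * indicator (ball 0 1) x
        + (ennreal (1 / 2) * indicator (ball 0 1) x + ennreal B * ennreal (\<bar>\<psi> x\<bar> powr p)) \<partial>lborel)"
    proof (rule nn_integral_mono)
      fix x
      have "1 \<le> (1 - \<psi> x) + (1 / 2 + B * \<bar>\<psi> x\<bar> powr p)"
      proof (cases "\<psi> x \<le> 1 / 2")
        case True
        have "0 \<le> B * \<bar>\<psi> x\<bar> powr p" using B by simp
        then show ?thesis using True by linarith
      next
        case False
        have "\<psi> x = \<psi> x powr (1 - p) * \<psi> x powr p" using False by (simp flip: powr_add)
        also have "\<dots> \<le> (1 / 2) powr (1 - p) * \<psi> x powr p"
          using False ps by (intro mult_right_mono powr_mono2') auto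
        also have "(1 / 2) powr (1 - p) = B"
          by (simp add: B_def powr_divide powr_diff)
        finally show ?thesis using \<psi>(2)[of x] by simp
      qed
      then have "ennreal 1 \<le> ennreal ((1 - \<psi> x) + (1 / 2 + B * \<bar>\<psi> x\<bar> powr p))" by (rule ennreal_leI)
      also have "\<dots> = ennreal (1 - \<psi> x) + (ennreal (1 / 2) + ennreal B * ennreal (\<bar>\<psi> x\<bar> powr p))"
      proof -
        define b where "b = \<bar>\<psi> x\<bar> powr p"
        have "ennreal ((1 - \<psi> x) + (1 / 2 + B * b)) = ennreal (1 - \<psi> x) + ennreal (1 / 2 + B * b)"
          by (rule ennreal_plus) (use \<psi>(3)[of x] B in \<open>simp_all add: b_def\<close>)
        also have "ennreal (1 / 2 + B * b) = ennreal (1 / 2) + ennreal (B * b)"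
          by (rule ennreal_plus) (use B in \<open>simp_all add: b_def\<close>)
        also have "ennreal (B * b) = ennreal B * ennreal b"
          by (rule ennreal_mult) (use B in \<open>simp_all add: b_def\<close>)
        finally show ?thesis by (simp only: b_def)
      qed
      finally show "indicator (ball 0 1) x \<le> ennreal (1 - \<psi> x) * indicator (ball 0 1) x
        + (ennreal (1 / 2) * indicator (ball 0 1) x + ennreal B * ennreal (\<bar>\<psi> x\<bar> powr p))"
        by (cases "x \<in> ball 0 1") simp_all
    qed
    also have "\<dots> = ball_deficit \<psi> + (\<integral>\<^sup>+x. ennreal (1 / 2) * indicator (ball 0 1) x + ennreal B * ennreal (\<bar>\<psi> x\<bar> powr p) \<partial>lborel)"
      unfolding ball_deficit_def by (rule nn_integral_add) measurable
    also have "(\<integral>\<^sup>+x. ennreal (1 / 2) * indicator (ball 0 1) x + ennreal B * ennreal (\<bar>\<psi> x\<bar> powr p) \<partial>lborel)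
        = (\<integral>\<^sup>+x. ennreal (1 / 2) * indicator (ball (0::'a) 1) x \<partial>lborel) + (\<integral>\<^sup>+x. ennreal B * ennreal (\<bar>\<psi> x\<bar> powr p) \<partial>lborel)"
      by (rule nn_integral_add) measurable
    also have "(\<integral>\<^sup>+x. ennreal (1 / 2) * indicator (ball (0::'a) 1) x \<partial>lborel) = ennreal (1 / 2) * ennreal V"
      by (subst nn_integral_cmult_indicator) (simp_all add: emeasure_ball V_def)
    also have "(\<integral>\<^sup>+x. ennreal B * ennreal (\<bar>\<psi> x\<bar> powr p) \<partial>lborel) = ennreal B * I"
      unfolding I_def by (rule nn_integral_cmult) measurable
    also have "ball_deficit \<psi> + (ennreal (1 / 2) * ennreal V + ennreal B * I)
        \<le> ball_deficit \<psi> + (ennreal (1 / 2) * ennreal V + ennreal (V / 4))"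
      by (intro add_left_mono BI)
    finally have le: "ennreal V \<le> ball_deficit \<psi> + (ennreal (1 / 2) * ennreal V + ennreal (V / 4))" .
    show "ennreal (V / 4) \<le> ball_deficit \<psi>"
    proof (cases "ball_deficit \<psi>")
      case (real d)
      have "ennreal V \<le> ennreal (d + (1 / 2 * V + V / 4))"
      proof -
        have "ennreal (d + (1 / 2 * V + V / 4)) = ennreal d + ennreal (1 / 2 * V + V / 4)"
          by (rule ennreal_plus) (use real V in simp_all)
        also have "ennreal (1 / 2 * V + V / 4) = ennreal (1 / 2 * V) + ennreal (V / 4)"
          by (rule ennreal_plus) (use V in simp_all)
        also have "ennreal (1 / 2 * V) = ennreal (1 / 2) * ennreal V"
          by (rule ennreal_mult) (use V in simp_all)
        finally show ?thesis using le by (simp only: real)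
      qed
      then have "V \<le> d + (1 / 2 * V + V / 4)"
        by (rule ennreal_le_iff[THEN iffD1, rotated]) (use real V in simp)
      then show ?thesis using real by (simp add: ennreal_leI)
    qed simp
  qed
qed

section \<open>The deficit for exponent one\<close>

subsection \<open>Fractional perimeter of balls\<close>

lemma gagliardo_indicator_ball:
  fixes s :: real
  assumes "\<rho> > 0"
  shows "gagliardo s 1 (indicator (ball (0::'a::euclidean_space) \<rho>))
    = ennreal (\<rho> powr (real DIM('a) - s)) * gagliardo s 1 (indicator (ball (0::'a) 1))"
proof -
  have ind: "(indicator (ball 0 1) :: 'a \<Rightarrow> real) \<in> borel_measurable borel"
    by (rule borel_measurable_indicator) simp
  have "indicator (ball (0::'a) \<rho>) = (\<lambda>x. indicator (ball (0::'a) 1) ((1 / \<rho>) *\<^sub>R x + 0) :: real)"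
    using assms by (auto simp: fun_eq_iff divide_less_eq split: split_indicator)
  then have "gagliardo s 1 (indicator (ball (0::'a) \<rho>))
      = ennreal ((1 / \<rho>) powr (s * 1 - real DIM('a))) * gagliardo s 1 (indicator (ball (0::'a) 1))"
    using assms by (simp only:) (rule gagliardo_affine[OF ind]; simp)
  also have "(1 / \<rho>) powr (s * 1 - real DIM('a)) = \<rho> powr (real DIM('a) - s)"
    using assms by (simp add: powr_divide powr_minus_divide[symmetric])
  finally show ?thesis .
qed

lemma radial_superlevel_ball:
  fixes S :: "'a::euclidean_space set"
  assumes "open S" and lower: "cball 0 1 \<subseteq> S" and upper: "S \<subseteq> ball 0 R"
    and radial: "\<And>x y. x \<in> S \<Longrightarrow> norm y \<le> norm x \<Longrightarrow> y \<in> S"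
  obtains \<rho> where "1 \<le> \<rho>" "\<rho> \<le> R" "S = ball 0 \<rho>"
proof -
  define \<rho> where "\<rho> = Sup (norm ` S)"
  have bdd: "bdd_above (norm ` S)" using upper by (intro bdd_aboveI[of _ R]) auto
  obtain e :: 'a where e: "norm e = 1" using vector_choose_size[of 1] by auto
  have "e \<in> S" using lower e by auto
  have "1 \<le> \<rho>" unfolding \<rho>_def using \<open>e \<in> S\<close> e bdd by (metis cSup_upper imageI)
  moreover have "\<rho> \<le> R" unfolding \<rho>_def using \<open>e \<in> S\<close> upper by (intro cSup_least) auto
  moreover have "S = ball 0 \<rho>"
  proof (intro subset_antisym subsetI)
    fix x :: 'a assume "x \<in> ball 0 \<rho>"
    then have "norm x < Sup (norm ` S)" by (simp add: \<rho>_def)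
    then obtain y where "y \<in> S" "norm x < norm y"
      using \<open>e \<in> S\<close> by (subst (asm) less_cSup_iff[OF _ bdd]) auto
    then show "x \<in> S" using radial[of y x] by simp
  next
    fix x assume x: "x \<in> S"
    show "x \<in> ball 0 \<rho>"
    proof (cases "x = 0")
      case True
      then show ?thesis using \<open>1 \<le> \<rho>\<close> by simp
    next
      case False
      obtain d where d: "d > 0" "ball x d \<subseteq> S" using \<open>open S\<close> x by (auto simp: open_contains_ball)
      define y where "y = x + (d / (2 * norm x)) *\<^sub>R x"
      have "dist x y = d / 2" using d(1) False by (simp add: y_def dist_norm)
      then have "y \<in> S" using d by auto
      have "y = (1 + d / (2 * norm x)) *\<^sub>R x" by (simp add: y_def scaleR_add_left)
      then have "norm y = (1 + d / (2 * norm x)) * norm x" using d(1) by simp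
      then have "norm x < norm y" using d(1) False by (simp add: distrib_right)
      also have "norm y \<le> \<rho>" unfolding \<rho>_def using \<open>y \<in> S\<close> bdd by (intro cSup_upper) auto
      finally show ?thesis by simp
    qed
  qed
  ultimately show ?thesis using that by blast
qed

text \<open>The coarea formula for radial functions. The superlevel sets are balls, and the fractional
  perimeter of a ball is a power of its radius.\<close>

lemma radial_coarea_bounds:
  fixes g :: "'a::euclidean_space \<Rightarrow> real" and s R :: real
  defines "P \<equiv> gagliardo s 1 (indicator (ball (0::'a) 1))"
  assumes "s < 1" and cont: "continuous_on UNIV g" and range: "\<And>x. 0 \<le> g x" "\<And>x. g x \<le> 1"
    and one: "\<And>x. norm x \<le> 1 \<Longrightarrow> g x = 1" and zero: "\<And>x. R \<le> norm x \<Longrightarrow> g x = 0"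
    and anti: "\<And>x y. norm x \<le> norm y \<Longrightarrow> g y \<le> g x"
  shows "P \<le> gagliardo s 1 g" and "gagliardo s 1 g \<le> ennreal (R powr (real DIM('a) - s)) * P"
proof -
  let ?M = "lborel \<Otimes>\<^sub>M lborel :: ('a \<times> 'a) measure"
  have [measurable]: "g \<in> borel_measurable borel" by (rule borel_measurable_continuous_onI[OF cont])
  define k where "k z = 1 / norm (fst z - snd z) powr (real DIM('a) + s)" for z :: "'a \<times> 'a"
  define lev where "lev t x = (if t < g x then 1 else (0::real))" for t x
  have k0: "k z \<ge> 0" for z by (simp add: k_def)
  have [measurable]: "k \<in> borel_measurable ?M" unfolding k_def by measurable
  have gag: "gagliardo s 1 w = (\<integral>\<^sup>+z. ennreal (k z * \<bar>w (fst z) - w (snd z)\<bar>) \<partial>?M)" for w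
    unfolding gagliardo_eq gagliardo_density_def k_def by simp
  have layer: "ennreal \<bar>g x - g y\<bar> = (\<integral>\<^sup>+t. ennreal \<bar>lev t x - lev t y\<bar> * indicator {0..<1} t \<partial>lborel)" for x y
  proof -
    have *: "ennreal \<bar>g x - g y\<bar> = (\<integral>\<^sup>+t. ennreal \<bar>lev t x - lev t y\<bar> * indicator {0..<1} t \<partial>lborel)"
      if "g x \<le> g y" for x y
    proof -
      have "(\<integral>\<^sup>+t. ennreal \<bar>lev t x - lev t y\<bar> * indicator {0..<1} t \<partial>lborel) = (\<integral>\<^sup>+t. indicator {g x..<g y} t \<partial>lborel)"
        using range(1)[of x] range(2)[of y] that
        by (intro nn_integral_cong) (auto simp: lev_def split: split_indicator)
      also have "\<dots> = ennreal \<bar>g x - g y\<bar>" using that by simp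
      finally show ?thesis by simp
    qed
    show ?thesis
      using *[of x y] *[of y x] by (cases "g x \<le> g y") (simp_all add: abs_minus_commute)
  qed
  have "gagliardo s 1 g = (\<integral>\<^sup>+z. \<integral>\<^sup>+t. ennreal (k z * \<bar>lev t (fst z) - lev t (snd z)\<bar>) * indicator {0..<1} t \<partial>lborel \<partial>?M)"
    unfolding gag
  proof (rule nn_integral_cong)
    fix z
    have "ennreal (k z * \<bar>g (fst z) - g (snd z)\<bar>) = ennreal (k z) * (\<integral>\<^sup>+t. ennreal \<bar>lev t (fst z) - lev t (snd z)\<bar> * indicator {0..<1} t \<partial>lborel)"
      unfolding layer[symmetric] using k0[of z] by (simp add: ennreal_mult)
    also have "\<dots> = (\<integral>\<^sup>+t. ennreal (k z) * (ennreal \<bar>lev t (fst z) - lev t (snd z)\<bar> * indicator {0..<1} t) \<partial>lborel)"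
      unfolding lev_def by (rule nn_integral_cmult[symmetric]) measurable
    also have "\<dots> = (\<integral>\<^sup>+t. ennreal (k z * \<bar>lev t (fst z) - lev t (snd z)\<bar>) * indicator {0..<1} t \<partial>lborel)"
      using k0[of z] by (simp add: ennreal_mult mult.assoc)
    finally show "ennreal (k z * \<bar>g (fst z) - g (snd z)\<bar>)
        = (\<integral>\<^sup>+t. ennreal (k z * \<bar>lev t (fst z) - lev t (snd z)\<bar>) * indicator {0..<1} t \<partial>lborel)" .
  qed
  also have "\<dots> = (\<integral>\<^sup>+t. \<integral>\<^sup>+z. ennreal (k z * \<bar>lev t (fst z) - lev t (snd z)\<bar>) * indicator {0..<1} t \<partial>?M \<partial>lborel)"
  proof -
    interpret pair_sigma_finite "lborel :: real measure" ?M
      unfolding pair_sigma_finite_def by (simp add: lborel_prod lborel.sigma_finite_measure_axioms)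
    show ?thesis unfolding lev_def by (rule Fubini') measurable
  qed
  also have "\<dots> = (\<integral>\<^sup>+t. gagliardo s 1 (lev t) * indicator {0..<1} t \<partial>lborel)"
  proof (rule nn_integral_cong)
    fix t
    show "(\<integral>\<^sup>+z. ennreal (k z * \<bar>lev t (fst z) - lev t (snd z)\<bar>) * indicator {0..<1} t \<partial>?M) = gagliardo s 1 (lev t) * indicator {0..<1} t"
      unfolding gag lev_def by (rule nn_integral_multc) measurable
  qed
  finally have coarea: "gagliardo s 1 g = (\<integral>\<^sup>+t. gagliardo s 1 (lev t) * indicator {0..<1} t \<partial>lborel)" .
  have bounds: "P \<le> gagliardo s 1 (lev t)" "gagliardo s 1 (lev t) \<le> ennreal (R powr (real DIM('a) - s)) * P"
    if t: "t \<in> {0..<1}" for t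
  proof -
    obtain \<rho> where \<rho>: "1 \<le> \<rho>" "\<rho> \<le> R" "{x. t < g x} = ball 0 \<rho>"
    proof (rule radial_superlevel_ball[of "{x. t < g x}" R])
      show "open {x. t < g x}" by (rule open_Collect_less[OF continuous_on_const cont])
      show "cball 0 1 \<subseteq> {x. t < g x}" using one t by auto
      show "{x. t < g x} \<subseteq> ball 0 R"
      proof
        fix x assume "x \<in> {x. t < g x}"
        then have "\<not> R \<le> norm x" using zero[of x] t by auto
        then show "x \<in> ball 0 R" by simp
      qed
      show "y \<in> {x. t < g x}" if "x \<in> {x. t < g x}" "norm y \<le> norm x" for x y
        using anti[OF that(2)] that(1) by simp
    qed blast
    have "lev t = indicator (ball 0 \<rho>)"
      unfolding \<rho>(3)[symmetric] by (auto simp: lev_def fun_eq_iff split: split_indicator)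
    then have eq: "gagliardo s 1 (lev t) = ennreal (\<rho> powr (real DIM('a) - s)) * P"
      unfolding P_def using \<rho>(1) by (simp only:) (rule gagliardo_indicator_ball, simp)
    have N: "real DIM('a) - s \<ge> 0" using \<open>s < 1\<close> DIM_positive[where 'a='a] by linarith
    have "1 \<le> \<rho> powr (real DIM('a) - s)" using \<rho>(1) N by (rule ge_one_powr_ge_zero)
    then have "1 * P \<le> ennreal (\<rho> powr (real DIM('a) - s)) * P"
      by (intro mult_right_mono) (simp_all flip: ennreal_1)
    then show "P \<le> gagliardo s 1 (lev t)" by (simp add: eq)
    show "gagliardo s 1 (lev t) \<le> ennreal (R powr (real DIM('a) - s)) * P"
      unfolding eq using \<rho> N by (intro mult_right_mono ennreal_leI powr_mono2) auto
  qed
  have c: "(\<integral>\<^sup>+t. A * indicator {0..<1::real} t \<partial>lborel) = A" for A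
    by (subst nn_integral_cmult_indicator) simp_all
  have "(\<integral>\<^sup>+t. P * indicator {0..<1::real} t \<partial>lborel) \<le> gagliardo s 1 g"
    unfolding coarea using bounds(1) by (intro nn_integral_mono) (auto split: split_indicator)
  then show "P \<le> gagliardo s 1 g" by (simp only: c)
  have "gagliardo s 1 g \<le> (\<integral>\<^sup>+t. (ennreal (R powr (real DIM('a) - s)) * P) * indicator {0..<1::real} t \<partial>lborel)"
    unfolding coarea using bounds(2) by (intro nn_integral_mono) (auto split: split_indicator)
  then show "gagliardo s 1 g \<le> ennreal (R powr (real DIM('a) - s)) * P" by (simp only: c)
qed

subsection \<open>Quantitative lower semicontinuity\<close>

text \<open>Away from the diagonal the kernel is integrable, so that the truncated energy is Lipschitz
  continuous in \<open>L\<^sup>1\<close>; by monotone convergence it exhausts a finite energy.\<close>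

lemma gagliardo_quantitative_lsc:
  fixes f :: "'a::euclidean_space \<Rightarrow> real" and s \<epsilon> :: real
  assumes s: "0 < s" "s < 1" and [measurable]: "f \<in> borel_measurable borel"
    and fin: "gagliardo s 1 f < \<infinity>" and \<epsilon>: "\<epsilon> > 0"
  obtains A where "A \<ge> 0" "\<And>w. w \<in> borel_measurable borel \<Longrightarrow>
      gagliardo s 1 f \<le> gagliardo s 1 w + ennreal \<epsilon> + ennreal A * (\<integral>\<^sup>+x. ennreal \<bar>w x - f x\<bar> \<partial>lborel)"
proof -
  let ?M = "lborel \<Otimes>\<^sub>M lborel :: ('a \<times> 'a) measure"
  let ?k = "\<lambda>x y::'a. 1 / norm (x - y) powr (real DIM('a) + s)"
  define \<tau> where "\<tau> n = 1 / (real n + 1)" for n :: nat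
  have \<tau>: "\<tau> n > 0" "\<tau> n \<le> 1" for n by (simp_all add: \<tau>_def)
  define h where "h n z = ennreal (gagliardo_density s 1 f (fst z) (snd z)) *
    indicator {\<tau> n..} (norm (fst z - snd z))" for n and z :: "'a \<times> 'a"
  have [measurable]: "h n \<in> borel_measurable ?M" for n unfolding h_def by measurable
  have inc: "incseq h"
  proof (rule incseq_SucI, rule le_funI)
    fix n z
    have "\<tau> (Suc n) \<le> \<tau> n" by (simp add: \<tau>_def frac_le)
    then show "h n z \<le> h (Suc n) z" by (auto simp: h_def split: split_indicator)
  qed
  have sup: "(SUP n. h n z) = ennreal (gagliardo_density s 1 f (fst z) (snd z))" for z
  proof (cases "fst z = snd z")
    case True
    then show ?thesis by (simp add: h_def gagliardo_density_def)
  next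
    case False
    then have "norm (fst z - snd z) > 0" by simp
    then obtain n where "inverse (real (Suc n)) < norm (fst z - snd z)" using reals_Archimedean by blast
    then have hn: "h n z = ennreal (gagliardo_density s 1 f (fst z) (snd z))"
      by (simp add: h_def \<tau>_def inverse_eq_divide add.commute)
    show ?thesis
    proof (rule antisym)
      show "(SUP n. h n z) \<le> ennreal (gagliardo_density s 1 f (fst z) (snd z))"
        by (rule SUP_least) (auto simp: h_def split: split_indicator)
      show "ennreal (gagliardo_density s 1 f (fst z) (snd z)) \<le> (SUP n. h n z)"
        unfolding hn[symmetric] by (rule SUP_upper) simp
    qed
  qed
  have "gagliardo s 1 f = (\<integral>\<^sup>+z. (SUP n. h n z) \<partial>?M)" unfolding sup gagliardo_eq ..
  also have "\<dots> = (SUP n. \<integral>\<^sup>+z. h n z \<partial>?M)"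
    by (rule nn_integral_monotone_convergence_SUP[OF inc]) measurable
  finally have SUP: "gagliardo s 1 f = (SUP n. \<integral>\<^sup>+z. h n z \<partial>?M)" .
  obtain n where n: "gagliardo s 1 f \<le> (\<integral>\<^sup>+z. h n z \<partial>?M) + ennreal \<epsilon>"
  proof (cases "gagliardo s 1 f \<le> ennreal \<epsilon>")
    case True
    then show ?thesis using that[of 0] by (meson add_increasing zero_le)
  next
    case False
    obtain P where P: "gagliardo s 1 f = ennreal P" "P \<ge> 0" using fin by (cases "gagliardo s 1 f") auto
    have "\<epsilon> < P" using False P \<epsilon> by (metis ennreal_leI linorder_not_le)
    then have "ennreal (P - \<epsilon>) < gagliardo s 1 f" using \<epsilon> P by (simp add: ennreal_less_iff)
    then obtain n where "ennreal (P - \<epsilon>) < (\<integral>\<^sup>+z. h n z \<partial>?M)" unfolding SUP less_SUP_iff by blast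
    then have "ennreal (P - \<epsilon>) + ennreal \<epsilon> \<le> (\<integral>\<^sup>+z. h n z \<partial>?M) + ennreal \<epsilon>" by (intro add_right_mono) simp
    moreover have "ennreal (P - \<epsilon>) + ennreal \<epsilon> = gagliardo s 1 f"
      using \<open>\<epsilon> < P\<close> \<epsilon> P by (simp add: ennreal_plus[symmetric] del: ennreal_plus)
    ultimately show ?thesis using that[of n] by simp
  qed
  obtain m where m: "kernel_mass s 1 TYPE('a) = ennreal m" "m \<ge> 0"
    using kernel_mass_finite[of 1 s, where 'a='a] s by (cases "kernel_mass s 1 TYPE('a)") auto
  define k where "k x y = ennreal (1 / \<tau> n) * ennreal (min 1 (norm (x - y)) powr 1 / norm (x - y) powr (real DIM('a) + s * 1))"
    for x y :: 'a
  have [measurable]: "(\<lambda>(x, y). k x y) \<in> borel_measurable (lborel \<Otimes>\<^sub>M lborel)" unfolding k_def by measurable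
  have kint: "(\<integral>\<^sup>+y. k x y \<partial>lborel) = ennreal (m / \<tau> n)" "(\<integral>\<^sup>+y. k y x \<partial>lborel) = ennreal (m / \<tau> n)" for x
  proof -
    have "(\<integral>\<^sup>+y. k x y \<partial>lborel) = ennreal (1 / \<tau> n) * kernel_mass s 1 TYPE('a)"
      unfolding k_def kernel_mass_translate(1)[symmetric, of s 1 x] by (rule nn_integral_cmult) measurable
    moreover have "(\<integral>\<^sup>+y. k y x \<partial>lborel) = ennreal (1 / \<tau> n) * kernel_mass s 1 TYPE('a)"
      unfolding k_def kernel_mass_translate(2)[symmetric, where x=x] by (rule nn_integral_cmult) measurable
    moreover have "ennreal (1 / \<tau> n) * kernel_mass s 1 TYPE('a) = ennreal (m / \<tau> n)"
      unfolding m(1) using m(2) \<tau>(1)[of n] by (simp flip: ennreal_mult)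
    ultimately show "(\<integral>\<^sup>+y. k x y \<partial>lborel) = ennreal (m / \<tau> n)" "(\<integral>\<^sup>+y. k y x \<partial>lborel) = ennreal (m / \<tau> n)"
      by simp_all
  qed
  show ?thesis
  proof (rule that[of "2 * (m / \<tau> n)"])
    show "2 * (m / \<tau> n) \<ge> 0" using m \<tau>(1)[of n] by simp
    fix w :: "'a \<Rightarrow> real" assume [measurable]: "w \<in> borel_measurable borel"
    define d where "d x = ennreal \<bar>w x - f x\<bar>" for x
    have [measurable]: "d \<in> borel_measurable borel" unfolding d_def by measurable
    define I where "I = (\<integral>\<^sup>+x. d x \<partial>lborel)"
    have le: "h n (x, y) \<le> ennreal (gagliardo_density s 1 w x y) + (d x * k x y + d y * k x y)" for x y
    proof (cases "\<tau> n \<le> norm (x - y)")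
      case True
      have kk: "ennreal (?k x y) \<le> k x y"
      proof -
        have "1 \<le> 1 / \<tau> n * min 1 (norm (x - y))" using True \<tau>[of n] by (simp add: min_def)
        then have "1 / norm (x - y) powr (real DIM('a) + s)
            \<le> (1 / \<tau> n * min 1 (norm (x - y))) / norm (x - y) powr (real DIM('a) + s)"
          by (rule divide_right_mono) simp
        then have "ennreal (?k x y) \<le> ennreal (1 / \<tau> n * (min 1 (norm (x - y)) / norm (x - y) powr (real DIM('a) + s)))"
          by (intro ennreal_leI) simp
        also have "\<dots> = k x y"
          unfolding k_def using \<tau>(1)[of n] by (subst ennreal_mult) auto
        finally show ?thesis .
      qed
      have "gagliardo_density s 1 f x y \<le> gagliardo_density s 1 w x y + (\<bar>w x - f x\<bar> * ?k x y + \<bar>w y - f y\<bar> * ?k x y)"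
      proof -
        have "\<bar>f x - f y\<bar> \<le> \<bar>w x - w y\<bar> + (\<bar>w x - f x\<bar> + \<bar>w y - f y\<bar>)" by linarith
        then have "\<bar>f x - f y\<bar> / norm (x - y) powr (real DIM('a) + s)
            \<le> (\<bar>w x - w y\<bar> + (\<bar>w x - f x\<bar> + \<bar>w y - f y\<bar>)) / norm (x - y) powr (real DIM('a) + s)"
          by (rule divide_right_mono) simp
        then show ?thesis by (simp add: gagliardo_density_def add_divide_distrib)
      qed
      then have "ennreal (gagliardo_density s 1 f x y)
          \<le> ennreal (gagliardo_density s 1 w x y + (\<bar>w x - f x\<bar> * ?k x y + \<bar>w y - f y\<bar> * ?k x y))"
        by (rule ennreal_leI)
      also have "\<dots> = ennreal (gagliardo_density s 1 w x y) + ennreal (\<bar>w x - f x\<bar> * ?k x y + \<bar>w y - f y\<bar> * ?k x y)"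
        by (rule ennreal_plus) (simp_all add: gagliardo_density_nonneg)
      also have "ennreal (\<bar>w x - f x\<bar> * ?k x y + \<bar>w y - f y\<bar> * ?k x y)
          = ennreal (\<bar>w x - f x\<bar> * ?k x y) + ennreal (\<bar>w y - f y\<bar> * ?k x y)"
        by (rule ennreal_plus) simp_all
      also have "ennreal (\<bar>w x - f x\<bar> * ?k x y) = d x * ennreal (?k x y)"
        unfolding d_def by (rule ennreal_mult) simp_all
      also have "ennreal (\<bar>w y - f y\<bar> * ?k x y) = d y * ennreal (?k x y)"
        unfolding d_def by (rule ennreal_mult) simp_all
      also have "ennreal (gagliardo_density s 1 w x y) + (d x * ennreal (?k x y) + d y * ennreal (?k x y))
          \<le> ennreal (gagliardo_density s 1 w x y) + (d x * k x y + d y * k x y)"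
        by (intro add_left_mono add_mono mult_left_mono kk) simp_all
      finally show ?thesis using True by (simp add: h_def)
    qed (simp add: h_def)
    have "(\<integral>\<^sup>+z. h n z \<partial>?M) = (\<integral>\<^sup>+x. \<integral>\<^sup>+y. h n (x, y) \<partial>lborel \<partial>lborel)"
      by (rule lborel.nn_integral_fst[symmetric]) measurable
    also have "\<dots> \<le> (\<integral>\<^sup>+x. \<integral>\<^sup>+y. ennreal (gagliardo_density s 1 w x y) + (d x * k x y + d y * k x y) \<partial>lborel \<partial>lborel)"
      by (intro nn_integral_mono le)
    also have "\<dots> = (\<integral>\<^sup>+x. (\<integral>\<^sup>+y. ennreal (gagliardo_density s 1 w x y) \<partial>lborel)
        + ((\<integral>\<^sup>+y. d x * k x y \<partial>lborel) + (\<integral>\<^sup>+y. d y * k x y \<partial>lborel)) \<partial>lborel)"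
    proof (rule nn_integral_cong)
      fix x
      have "(\<integral>\<^sup>+y. ennreal (gagliardo_density s 1 w x y) + (d x * k x y + d y * k x y) \<partial>lborel)
          = (\<integral>\<^sup>+y. ennreal (gagliardo_density s 1 w x y) \<partial>lborel) + (\<integral>\<^sup>+y. d x * k x y + d y * k x y \<partial>lborel)"
        by (rule nn_integral_add) measurable
      also have "(\<integral>\<^sup>+y. d x * k x y + d y * k x y \<partial>lborel) = (\<integral>\<^sup>+y. d x * k x y \<partial>lborel) + (\<integral>\<^sup>+y. d y * k x y \<partial>lborel)"
        by (rule nn_integral_add) measurable
      finally show "(\<integral>\<^sup>+y. ennreal (gagliardo_density s 1 w x y) + (d x * k x y + d y * k x y) \<partial>lborel)
          = (\<integral>\<^sup>+y. ennreal (gagliardo_density s 1 w x y) \<partial>lborel) + ((\<integral>\<^sup>+y. d x * k x y \<partial>lborel) + (\<integral>\<^sup>+y. d y * k x y \<partial>lborel))" .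
    qed
    also have "\<dots> = (\<integral>\<^sup>+x. \<integral>\<^sup>+y. ennreal (gagliardo_density s 1 w x y) \<partial>lborel \<partial>lborel)
        + (\<integral>\<^sup>+x. (\<integral>\<^sup>+y. d x * k x y \<partial>lborel) + (\<integral>\<^sup>+y. d y * k x y \<partial>lborel) \<partial>lborel)"
      by (rule nn_integral_add) measurable
    also have "(\<integral>\<^sup>+x. (\<integral>\<^sup>+y. d x * k x y \<partial>lborel) + (\<integral>\<^sup>+y. d y * k x y \<partial>lborel) \<partial>lborel)
        = (\<integral>\<^sup>+x. \<integral>\<^sup>+y. d x * k x y \<partial>lborel \<partial>lborel) + (\<integral>\<^sup>+x. \<integral>\<^sup>+y. d y * k x y \<partial>lborel \<partial>lborel)"
      by (rule nn_integral_add) measurable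
    also have "(\<integral>\<^sup>+x. \<integral>\<^sup>+y. d x * k x y \<partial>lborel \<partial>lborel) = I * ennreal (m / \<tau> n)"
    proof -
      have "(\<integral>\<^sup>+y. d x * k x y \<partial>lborel) = d x * ennreal (m / \<tau> n)" for x
        unfolding kint(1)[of x, symmetric] by (rule nn_integral_cmult) measurable
      then show ?thesis unfolding I_def by (simp only:) (rule nn_integral_multc, measurable)
    qed
    also have "(\<integral>\<^sup>+x. \<integral>\<^sup>+y. d y * k x y \<partial>lborel \<partial>lborel) = (\<integral>\<^sup>+y. \<integral>\<^sup>+x. d y * k x y \<partial>lborel \<partial>lborel)"
      by (rule lborel_pair.Fubini'[symmetric]) measurable
    also have "\<dots> = I * ennreal (m / \<tau> n)"
    proof -
      have "(\<integral>\<^sup>+x. d y * k x y \<partial>lborel) = d y * ennreal (m / \<tau> n)" for y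
        unfolding kint(2)[of y, symmetric] by (rule nn_integral_cmult) measurable
      then show ?thesis unfolding I_def by (simp only:) (rule nn_integral_multc, measurable)
    qed
    also have "I * ennreal (m / \<tau> n) + I * ennreal (m / \<tau> n) = ennreal (2 * (m / \<tau> n)) * I"
    proof -
      have "ennreal (2 * (m / \<tau> n)) = ennreal (m / \<tau> n) + ennreal (m / \<tau> n)"
        unfolding mult_2 using m(2) \<tau>(1)[of n] by (intro ennreal_plus) simp_all
      then show ?thesis by (simp only: distrib_right mult.commute[of I])
    qed
    also have "(\<integral>\<^sup>+x. \<integral>\<^sup>+y. ennreal (gagliardo_density s 1 w x y) \<partial>lborel \<partial>lborel) = gagliardo s 1 w"
      by (rule gagliardo_iterated[symmetric]) measurable
    finally have "(\<integral>\<^sup>+z. h n z \<partial>?M) + ennreal \<epsilon> \<le> gagliardo s 1 w + ennreal (2 * (m / \<tau> n)) * I + ennreal \<epsilon>"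
      by (rule add_right_mono)
    with n have "gagliardo s 1 f \<le> gagliardo s 1 w + ennreal (2 * (m / \<tau> n)) * I + ennreal \<epsilon>" by (rule order_trans)
    then show "gagliardo s 1 f \<le> gagliardo s 1 w + ennreal \<epsilon> + ennreal (2 * (m / \<tau> n)) * (\<integral>\<^sup>+x. ennreal \<bar>w x - f x\<bar> \<partial>lborel)"
      by (simp only: I_def d_def add.assoc add.commute[of "ennreal \<epsilon>"])
  qed
qed

subsection \<open>Submodularity and the deficit\<close>

text \<open>A smooth maximum and minimum; they depend on the sum and, through the \<open>1\<close>-Lipschitz
  function \<open>soft_abs e\<close>, on the difference.\<close>

definition soft_max :: "real \<Rightarrow> real \<Rightarrow> real \<Rightarrow> real" where
  "soft_max e a b = (a + b + soft_abs e (a - b)) / 2"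

definition soft_min :: "real \<Rightarrow> real \<Rightarrow> real \<Rightarrow> real" where
  "soft_min e a b = (a + b - soft_abs e (a - b)) / 2"

text \<open>The increments of the two functions are \<open>(S + D) / 2\<close> and \<open>(S - D) / 2\<close>, where \<open>S\<close> and \<open>D\<close> are the
  increments of the sum and of the smoothed difference; their absolute values add up to the larger of
  \<open>|S|\<close> and \<open>|D|\<close>.\<close>

lemma soft_max_min_submodular:
  "\<bar>soft_max e a b - soft_max e a' b'\<bar> + \<bar>soft_min e a b - soft_min e a' b'\<bar> \<le> \<bar>a - a'\<bar> + \<bar>b - b'\<bar>"
proof -
  define S where "S = (a + b) - (a' + b')"
  define D where "D = soft_abs e (a - b) - soft_abs e (a' - b')"
  have "\<bar>D\<bar> \<le> \<bar>(a - b) - (a' - b')\<bar>" unfolding D_def by (rule soft_abs_Lipschitz)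
  then have D: "\<bar>D\<bar> \<le> \<bar>a - a'\<bar> + \<bar>b - b'\<bar>" by linarith
  have S: "\<bar>S\<bar> \<le> \<bar>a - a'\<bar> + \<bar>b - b'\<bar>" unfolding S_def by linarith
  have "soft_max e a b - soft_max e a' b' = (S + D) / 2" "soft_min e a b - soft_min e a' b' = (S - D) / 2"
    by (simp_all add: soft_max_def soft_min_def S_def D_def field_simps)
  moreover have "\<bar>(S + D) / 2\<bar> + \<bar>(S - D) / 2\<bar> \<le> max \<bar>S\<bar> \<bar>D\<bar>"
    by (auto simp: abs_if max_def field_simps)
  ultimately show ?thesis using S D by (simp only: max_def split: if_splits)
qed

lemma gagliardo_submodular:
  fixes u v :: "'a::euclidean_space \<Rightarrow> real"
  assumes u: "u \<in> test_functions \<Omega>" and v: "v \<in> test_functions \<Omega>" and e: "e > 0"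
  shows "gagliardo s 1 (\<lambda>x. soft_max e (u x) (v x)) + gagliardo s 1 (\<lambda>x. soft_min e (u x) (v x))
    \<le> gagliardo s 1 u + gagliardo s 1 v"
proof -
  let ?M = "lborel \<Otimes>\<^sub>M lborel :: ('a \<times> 'a) measure"
  let ?F = "\<lambda>x. soft_max e (u x) (v x)" and ?G = "\<lambda>x. soft_min e (u x) (v x)"
  note [measurable] = test_functions_borel[OF u] test_functions_borel[OF v]
  have [measurable]: "?F \<in> borel_measurable borel" "?G \<in> borel_measurable borel"
    unfolding soft_max_def soft_min_def soft_abs_def by measurable
  let ?d = "\<lambda>w z. ennreal (gagliardo_density s 1 w (fst z) (snd z))"
  have "gagliardo s 1 ?F + gagliardo s 1 ?G = (\<integral>\<^sup>+z. ?d ?F z + ?d ?G z \<partial>?M)"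
    unfolding gagliardo_eq by (rule nn_integral_add[symmetric]) measurable
  also have "\<dots> \<le> (\<integral>\<^sup>+z. ?d u z + ?d v z \<partial>?M)"
  proof (rule nn_integral_mono)
    fix z
    have "gagliardo_density s 1 ?F (fst z) (snd z) + gagliardo_density s 1 ?G (fst z) (snd z)
        \<le> gagliardo_density s 1 u (fst z) (snd z) + gagliardo_density s 1 v (fst z) (snd z)"
      unfolding gagliardo_density_def add_divide_distrib[symmetric]
      by (rule divide_right_mono) (simp_all add: soft_max_min_submodular)
    then show "?d ?F z + ?d ?G z \<le> ?d u z + ?d v z"
      by (simp add: gagliardo_density_nonneg ennreal_leI flip: ennreal_plus)
  qed
  also have "\<dots> = gagliardo s 1 u + gagliardo s 1 v"
    unfolding gagliardo_eq by (rule nn_integral_add) measurable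
  finally show ?thesis .
qed

text \<open>Suppose \<open>\<psi>\<close> is close to \<open>1\<close> in the unit ball and \<open>g\<close> is a cutoff close to the indicator
  function of the ball. Then the maximum of the two is admissible for the capacity of the ball,
  while the minimum is close to the indicator function; its energy is therefore at least that of
  \<open>g\<close>, up to a small error. By submodularity the energy of \<open>\<psi>\<close> is at least that of the maximum,
  hence at least the capacity, up to a small error.\<close>

lemma deficit_of_energy_below_capacity:
  fixes s \<kappa> \<gamma> :: real
  assumes s: "0 < s" "s < 1" and \<kappa>: "\<kappa> > 0" and \<gamma>: "0 < \<gamma>" "\<gamma> < 1"
    and cap: "frac_cap s 1 (cball (0::'a::euclidean_space) 1) (ball 0 2) = ennreal \<kappa>"
  obtains \<delta> where "\<delta> > 0"
    "\<And>\<psi> :: 'a \<Rightarrow> real. \<psi> \<in> test_functions (ball 0 2) \<Longrightarrow> (\<And>x. 0 \<le> \<psi> x) \<Longrightarrow> (\<And>x. \<psi> x \<le> 1) \<Longrightarrow>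
      gagliardo s 1 \<psi> \<le> ennreal (\<gamma> * \<kappa>) \<Longrightarrow> ennreal \<delta> \<le> ball_deficit \<psi>"
proof -
  let ?B = "ball (0::'a) 1"
  define V where "V = unit_ball_vol (real DIM('a))"
  have V: "V > 0" by (simp add: V_def)
  define P where "P = enn2real (gagliardo s 1 (indicator ?B))"
  have cut: "gagliardo s 1 (indicator ?B) \<le> gagliardo s 1 (cutoff (0::'a) 1 R)"
    "gagliardo s 1 (cutoff (0::'a) 1 R) \<le> ennreal (R powr (real DIM('a) - s)) * gagliardo s 1 (indicator ?B)"
    if "R > 1" for R
    using radial_coarea_bounds[of s "cutoff (0::'a) 1 R" R] s(2) that
      test_functions_continuous[OF test_functions_cutoff[of 1 R 0 UNIV]] cutoff_range[of 0 1 R]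
    by (auto simp: cutoff_eq_1 cutoff_eq_0 cutoff_antimono)
  have "gagliardo s 1 (cutoff (0::'a) 1 2) < \<infinity>"
    by (rule gagliardo_finite[OF _ s test_functions_cutoff[of 1 2 0 UNIV]]) auto
  with cut(1)[of 2] have fin: "gagliardo s 1 (indicator ?B) < \<infinity>" by (simp add: le_less_trans)
  then have P: "gagliardo s 1 (indicator ?B) = ennreal P" "P \<ge> 0" by (auto simp: P_def)
  define \<epsilon> where "\<epsilon> = (1 - \<gamma>) * \<kappa> / 8"
  have \<epsilon>: "\<epsilon> > 0" using \<gamma> \<kappa> by (simp add: \<epsilon>_def)
  have ind: "(indicator ?B :: 'a \<Rightarrow> real) \<in> borel_measurable borel"
    by (rule borel_measurable_indicator) simp
  obtain A where A: "A \<ge> 0" "\<And>w. w \<in> borel_measurable borel \<Longrightarrow>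
      gagliardo s 1 (indicator ?B) \<le> gagliardo s 1 w + ennreal \<epsilon> + ennreal A * (\<integral>\<^sup>+x. ennreal \<bar>w x - indicator ?B x\<bar> \<partial>lborel)"
    using gagliardo_quantitative_lsc[OF s ind fin \<epsilon>] by blast
  \<comment> \<open>the outer radius of the cutoff and the smoothing parameter; each error term is at most \<open>\<epsilon>\<close>\<close>
  obtain R where R: "1 < R" "R < 2" "R powr (real DIM('a) - s) * P \<le> P + \<epsilon>" "A * (V * (R ^ DIM('a) - 1)) \<le> \<epsilon>"
  proof -
    have "((\<lambda>R. R powr (real DIM('a) - s) * P) \<longlongrightarrow> 1 powr (real DIM('a) - s) * P) (at_right 1)"
      by (intro tendsto_intros) simp
    then have 1: "eventually (\<lambda>R. R powr (real DIM('a) - s) * P < P + \<epsilon>) (at_right 1)"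
      using \<epsilon> by (intro order_tendstoD(2)) auto
    have "((\<lambda>R. A * (V * (R ^ DIM('a) - 1))) \<longlongrightarrow> A * (V * (1 ^ DIM('a) - 1))) (at_right (1::real))"
      by (intro tendsto_intros)
    then have 2: "eventually (\<lambda>R. A * (V * (R ^ DIM('a) - 1)) < \<epsilon>) (at_right (1::real))"
      using \<epsilon> by (intro order_tendstoD(2)) auto
    have 3: "eventually (\<lambda>R. R \<in> {1<..<2}) (at_right (1::real))"
      by (rule eventually_at_right_real) simp
    have "eventually (\<lambda>R. R \<in> {1<..<2} \<and> R powr (real DIM('a) - s) * P < P + \<epsilon> \<and> A * (V * (R ^ DIM('a) - 1)) < \<epsilon>) (at_right (1::real))"
      using 1 2 3 by eventually_elim simp
    then obtain R where "R \<in> {1<..<2}" "R powr (real DIM('a) - s) * P < P + \<epsilon>" "A * (V * (R ^ DIM('a) - 1)) < \<epsilon>"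
      using eventually_happens'[OF trivial_limit_at_right_real] by blast
    then show ?thesis using that[of R] by auto
  qed
  define W where "W = V * 2 ^ DIM('a)"
  have W: "W > 0" using V by (simp add: W_def)
  define e where "e = min 1 (min (\<epsilon> / \<kappa>) (\<epsilon> / (A * W + 1)))"
  have AW: "A * W + 1 > 0" using A W by (simp add: add_nonneg_pos)
  have e: "e > 0" "e \<le> 1" "e * \<kappa> \<le> \<epsilon>" "A * (e * W) \<le> \<epsilon>"
  proof -
    show "e > 0" "e \<le> 1" using \<epsilon> \<kappa> AW by (auto simp: e_def)
    have "e \<le> \<epsilon> / \<kappa>" "e \<le> \<epsilon> / (A * W + 1)" by (auto simp: e_def)
    then show "e * \<kappa> \<le> \<epsilon>" using \<kappa> by (simp add: pos_le_divide_eq)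
    have "e * (A * W + 1) \<le> \<epsilon>" using \<open>e \<le> \<epsilon> / (A * W + 1)\<close> AW by (simp add: pos_le_divide_eq)
    then show "A * (e * W) \<le> \<epsilon>" using \<open>e > 0\<close> by (simp add: distrib_left mult_ac)
  qed
  define g where "g = cutoff (0::'a) 1 R"
  have g: "g \<in> test_functions (ball 0 2)" unfolding g_def using R by (intro test_functions_cutoff) auto
  have gr: "0 \<le> g x" "g x \<le> 1" for x using cutoff_range[of 0 1 R x] by (auto simp: g_def)
  define \<delta> where "\<delta> = \<epsilon> / (A + 1)"
  show ?thesis
  proof (rule that[of \<delta>])
    show "\<delta> > 0" using \<epsilon> A(1) by (simp add: \<delta>_def add_nonneg_pos)
    fix \<psi> :: "'a \<Rightarrow> real"
    assume \<psi>: "\<psi> \<in> test_functions (ball 0 2)" "\<And>x. 0 \<le> \<psi> x" "\<And>x. \<psi> x \<le> 1" "gagliardo s 1 \<psi> \<le> ennreal (\<gamma> * \<kappa>)"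
    note [measurable] = test_functions_borel[OF \<psi>(1)] test_functions_borel[OF g]
    have [measurable]: "?B \<in> sets borel" "ball (0::'a) 2 \<in> sets borel" "ball (0::'a) R - ?B \<in> sets borel"
      by (auto intro!: sets.Diff borel_open)
    define F where "F x = soft_max e (\<psi> x) (g x)" for x
    define m where "m x = soft_min e (\<psi> x) (g x)" for x
    have F: "F \<in> test_functions (ball 0 2)"
      unfolding F_def[abs_def]
    proof (rule test_functions_compose2[OF \<psi>(1) g])
      have "Ck k (\<lambda>x. (1 / 2) * ((\<psi> x + g x) + soft_abs e (\<psi> x - g x)))" for k
        by (rule Ck_cmult[OF Ck_add[OF Ck_add Ck_soft_abs[OF e(1) Ck_diff]]])
           (rule test_functions_Ck[OF \<psi>(1)] test_functions_Ck[OF g])+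
      then show "Ck k (\<lambda>x. soft_max e (\<psi> x) (g x))" for k
        unfolding soft_max_def by simp
      show "soft_max e 0 0 = 0" using e(1) by (simp add: soft_max_def soft_abs_0)
    qed
    have [measurable]: "m \<in> borel_measurable borel"
      unfolding m_def[abs_def] soft_min_def soft_abs_def by measurable
    \<comment> \<open>after division by \<open>1 - e / 2\<close> the smooth maximum is admissible\<close>
    have FK: "ennreal ((1 - e / 2) * \<kappa>) \<le> gagliardo s 1 F"
    proof -
      have e2: "1 - e / 2 > 0" using e by simp
      have "1 \<le> 1 / (1 - e / 2) * F x" if "x \<in> cball 0 1" for x
      proof -
        have "g x = 1" using that R by (simp add: g_def cutoff_eq_1)
        then have "1 - e / 2 \<le> F x"
          using soft_abs_bounds(2)[of e "\<psi> x - g x"] e(1) by (simp add: F_def soft_max_def)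
        then show ?thesis using e2 by (simp add: pos_le_divide_eq)
      qed
      then have "ennreal \<kappa> \<le> gagliardo s 1 (\<lambda>x. 1 / (1 - e / 2) * F x)"
        unfolding cap[symmetric] frac_cap_def using test_functions_cmult[OF F] by (intro Inf_lower) blast
      also have "\<dots> = ennreal (1 / (1 - e / 2)) * gagliardo s 1 F"
        using gagliardo_cmult[OF test_functions_borel[OF F], of s 1 "1 / (1 - e / 2)"] e2 by simp
      finally have "ennreal (1 - e / 2) * ennreal \<kappa> \<le> ennreal (1 - e / 2) * (ennreal (1 / (1 - e / 2)) * gagliardo s 1 F)"
        by (rule mult_left_mono) simp
      also have "\<dots> = gagliardo s 1 F"
      proof -
        have "ennreal (1 - e / 2) * ennreal (1 / (1 - e / 2)) = ennreal ((1 - e / 2) * (1 / (1 - e / 2)))"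
          by (rule ennreal_mult[symmetric]) (use e2 in simp_all)
        also have "(1 - e / 2) * (1 / (1 - e / 2)) = 1" using e2 by simp
        finally show ?thesis by (simp only: mult.assoc[symmetric] ennreal_1 mult_1)
      qed
      also have "ennreal (1 - e / 2) * ennreal \<kappa> = ennreal ((1 - e / 2) * \<kappa>)"
        by (rule ennreal_mult[symmetric]) (use e2 \<kappa> in simp_all)
      finally show ?thesis .
    qed
    have sub: "gagliardo s 1 F + gagliardo s 1 m \<le> ennreal (\<gamma> * \<kappa>) + ennreal (P + \<epsilon>)"
    proof -
      have "gagliardo s 1 F + gagliardo s 1 m \<le> gagliardo s 1 \<psi> + gagliardo s 1 g"
        unfolding F_def[abs_def] m_def[abs_def] by (rule gagliardo_submodular[OF \<psi>(1) g e(1)])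
      also have "gagliardo s 1 g \<le> ennreal (P + \<epsilon>)"
      proof -
        have "gagliardo s 1 g \<le> ennreal (R powr (real DIM('a) - s)) * ennreal P"
          unfolding g_def P(1)[symmetric] by (rule cut(2)[OF R(1)])
        also have "\<dots> = ennreal (R powr (real DIM('a) - s) * P)" using P(2) by (simp add: ennreal_mult)
        also have "\<dots> \<le> ennreal (P + \<epsilon>)" by (rule ennreal_leI[OF R(3)])
        finally show ?thesis .
      qed
      finally show ?thesis using \<psi>(4) by (meson add_mono order_refl order_trans)
    qed
    have dist: "(\<integral>\<^sup>+x. ennreal \<bar>m x - indicator ?B x\<bar> \<partial>lborel)
        \<le> ball_deficit \<psi> + (ennreal (V * (R ^ DIM('a) - 1)) + ennreal (e / 2 * W))"
    proof -
      have pw: "ennreal \<bar>m x - indicator ?B x\<bar> \<le> ennreal (1 - \<psi> x) * indicator ?B x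
          + (indicator (ball 0 R - ?B) x + ennreal (e / 2) * indicator (ball 0 2) x)" for x
      proof (cases "x \<in> ball 0 2")
        case False
        then have "\<psi> x = 0" "g x = 0" using test_functions_outside[OF \<psi>(1)] test_functions_outside[OF g] by auto
        moreover have "x \<notin> ?B" using False by auto
        ultimately show ?thesis using e(1) by (simp add: m_def soft_min_def soft_abs_0)
      next
        case x: True
        have m_bounds: "min (\<psi> x) (g x) \<le> m x" "m x \<le> min (\<psi> x) (g x) + e / 2"
          using soft_abs_bounds(2,3)[of e "\<psi> x - g x"] e(1) by (auto simp: m_def soft_min_def min_def abs_if split: if_splits)
        consider "x \<in> ?B" | "x \<notin> ?B" "x \<in> ball 0 R" | "x \<notin> ?B" "x \<notin> ball 0 R" by blast
        then show ?thesis
        proof cases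
          case 1
          then have "g x = 1" using R by (simp add: g_def cutoff_eq_1)
          then have "\<bar>m x - 1\<bar> \<le> (1 - \<psi> x) + e / 2"
            using m_bounds \<psi>(3)[of x] e(1) by (auto simp: min_def split: if_splits)
          then have "ennreal \<bar>m x - 1\<bar> \<le> ennreal ((1 - \<psi> x) + e / 2)" by (rule ennreal_leI)
          also have "\<dots> = ennreal (1 - \<psi> x) + ennreal (e / 2)"
            by (rule ennreal_plus) (use \<psi>(3)[of x] e(1) in simp_all)
          finally show ?thesis using 1 x by simp
        next
          case 2
          have "\<bar>m x\<bar> \<le> 1 + e / 2" using m_bounds \<psi>(2,3)[of x] gr[of x] by (auto simp: min_def split: if_splits)
          then have "ennreal \<bar>m x\<bar> \<le> ennreal (1 + e / 2)" by (rule ennreal_leI)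
          also have "\<dots> = 1 + ennreal (e / 2)"
            using e(1) by (subst ennreal_plus) simp_all
          finally show ?thesis using 2 x by simp
        next
          case 3
          then have "g x = 0" using R by (auto simp: g_def intro!: cutoff_eq_0)
          then have "\<bar>m x\<bar> \<le> e / 2" using m_bounds \<psi>(2)[of x] by (auto simp: min_def split: if_splits)
          then have "ennreal \<bar>m x\<bar> \<le> ennreal (e / 2)" by (rule ennreal_leI)
          then show ?thesis using 3 x by simp
        qed
      qed
      have "(\<integral>\<^sup>+x. ennreal \<bar>m x - indicator ?B x\<bar> \<partial>lborel) \<le> (\<integral>\<^sup>+x. ennreal (1 - \<psi> x) * indicator ?B x
          + (indicator (ball 0 R - ?B) x + ennreal (e / 2) * indicator (ball 0 2) x) \<partial>lborel)"
        by (intro nn_integral_mono pw)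
      also have "\<dots> = ball_deficit \<psi> + (\<integral>\<^sup>+x. indicator (ball 0 R - ?B) x + ennreal (e / 2) * indicator (ball 0 2) x \<partial>lborel)"
        unfolding ball_deficit_def by (rule nn_integral_add) measurable
      also have "(\<integral>\<^sup>+x. indicator (ball 0 R - ?B) x + ennreal (e / 2) * indicator (ball (0::'a) 2) x \<partial>lborel)
          = (\<integral>\<^sup>+x. indicator (ball 0 R - ?B) x \<partial>lborel) + (\<integral>\<^sup>+x. ennreal (e / 2) * indicator (ball (0::'a) 2) x \<partial>lborel)"
        by (rule nn_integral_add) measurable
      also have "(\<integral>\<^sup>+x. ennreal (e / 2) * indicator (ball (0::'a) 2) x \<partial>lborel) = ennreal (e / 2 * W)"
      proof -
        have "(\<integral>\<^sup>+x. ennreal (e / 2) * indicator (ball (0::'a) 2) x \<partial>lborel) = ennreal (e / 2) * ennreal W"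
          by (subst nn_integral_cmult_indicator) (simp_all add: emeasure_ball V_def W_def)
        also have "\<dots> = ennreal (e / 2 * W)" by (rule ennreal_mult[symmetric]) (use e(1) W in simp_all)
        finally show ?thesis .
      qed
      also have "(\<integral>\<^sup>+x. indicator (ball 0 R - ?B) x \<partial>lborel) = ennreal (V * (R ^ DIM('a) - 1))"
      proof -
        have "(\<integral>\<^sup>+x. indicator (ball 0 R - ?B) x \<partial>lborel) = emeasure lborel (ball (0::'a) R - ?B)"
          by (rule nn_integral_indicator) measurable
        also have "\<dots> = emeasure lborel (ball (0::'a) R) - emeasure lborel ?B"
          using R by (intro emeasure_Diff) (auto simp: emeasure_ball)
        also have "\<dots> = ennreal (V * R ^ DIM('a)) - ennreal (V * 1)"
          using R by (simp add: emeasure_ball V_def)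
        also have "\<dots> = ennreal (V * R ^ DIM('a) - V * 1)" using V by (intro ennreal_minus) simp
        finally show ?thesis by (simp add: right_diff_distrib)
      qed
      finally show ?thesis .
    qed
    show "ennreal \<delta> \<le> ball_deficit \<psi>"
    proof (cases "ball_deficit \<psi>")
      case (real d)
      have V1: "V * (R ^ DIM('a) - 1) \<ge> 0" using V R(1) by (simp add: one_le_power)
      define D where "D = d + (V * (R ^ DIM('a) - 1) + e / 2 * W)"
      have D: "D \<ge> 0" using real(1) V1 e(1) W by (simp add: D_def)
      have "ball_deficit \<psi> + (ennreal (V * (R ^ DIM('a) - 1)) + ennreal (e / 2 * W)) = ennreal D"
        unfolding real D_def using real V1 e(1) W by (subst ennreal_plus[symmetric], simp, simp, subst ennreal_plus[symmetric]) simp_all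
      with dist have dD: "(\<integral>\<^sup>+x. ennreal \<bar>m x - indicator ?B x\<bar> \<partial>lborel) \<le> ennreal D" by simp
      have "ennreal P \<le> gagliardo s 1 m + ennreal \<epsilon> + ennreal A * (\<integral>\<^sup>+x. ennreal \<bar>m x - indicator ?B x\<bar> \<partial>lborel)"
        unfolding P(1)[symmetric] by (rule A(2)) measurable
      also have "\<dots> \<le> gagliardo s 1 m + ennreal \<epsilon> + ennreal A * ennreal D"
        by (intro add_left_mono mult_left_mono dD) simp
      finally have Pm: "ennreal P \<le> gagliardo s 1 m + (ennreal \<epsilon> + ennreal A * ennreal D)" by (simp only: add.assoc)
      have "ennreal ((1 - e / 2) * \<kappa>) + ennreal P \<le> gagliardo s 1 F + (gagliardo s 1 m + (ennreal \<epsilon> + ennreal A * ennreal D))"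
        by (rule add_mono[OF FK Pm])
      also have "\<dots> = (gagliardo s 1 F + gagliardo s 1 m) + (ennreal \<epsilon> + ennreal A * ennreal D)"
        by (simp only: add.assoc)
      also have "\<dots> \<le> (ennreal (\<gamma> * \<kappa>) + ennreal (P + \<epsilon>)) + (ennreal \<epsilon> + ennreal A * ennreal D)"
        by (rule add_right_mono[OF sub])
      also have "\<dots> = ennreal ((\<gamma> * \<kappa> + (P + \<epsilon>)) + (\<epsilon> + A * D))"
      proof -
        have 1: "ennreal A * ennreal D = ennreal (A * D)" by (rule ennreal_mult[symmetric]) (use A D in simp_all)
        have 2: "ennreal \<epsilon> + ennreal (A * D) = ennreal (\<epsilon> + A * D)" by (rule ennreal_plus[symmetric]) (use \<epsilon> A D in simp_all)
        have 3: "ennreal (\<gamma> * \<kappa>) + ennreal (P + \<epsilon>) = ennreal (\<gamma> * \<kappa> + (P + \<epsilon>))"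
          by (rule ennreal_plus[symmetric]) (use \<gamma> \<kappa> P \<epsilon> in simp_all)
        show ?thesis unfolding 1 2 3 by (rule ennreal_plus[symmetric]) (use \<gamma> \<kappa> P \<epsilon> A D in simp_all)
      qed
      also have "ennreal ((1 - e / 2) * \<kappa>) + ennreal P = ennreal ((1 - e / 2) * \<kappa> + P)"
        by (rule ennreal_plus[symmetric]) (use e \<kappa> P in simp_all)
      finally have "(1 - e / 2) * \<kappa> + P \<le> (\<gamma> * \<kappa> + (P + \<epsilon>)) + (\<epsilon> + A * D)"
        by (rule ennreal_le_iff[THEN iffD1, rotated]) (use \<gamma> \<kappa> P \<epsilon> A D in simp)
      moreover have "(1 - e / 2) * \<kappa> = \<kappa> - (e * \<kappa>) / 2" by (simp add: left_diff_distrib)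
      moreover have "\<kappa> - \<gamma> * \<kappa> = 8 * \<epsilon>" by (simp add: \<epsilon>_def left_diff_distrib)
      moreover have "A * D = A * d + A * (V * (R ^ DIM('a) - 1)) + A * (e * W) / 2"
        by (simp add: D_def distrib_left)
      ultimately have "\<epsilon> \<le> A * d" using e(3,4) R(4) \<epsilon> by linarith
      also have "\<dots> \<le> (A + 1) * d" using real(1) by (intro mult_right_mono) simp_all
      finally have "\<delta> \<le> d" using A(1) by (simp add: \<delta>_def pos_divide_le_eq add_nonneg_pos mult.commute)
      then show ?thesis unfolding real by (rule ennreal_leI)
    qed simp
  qed
qed

section \<open>The characterisation of the embedding\<close>

lemma subcritical_exponent_pos:
  assumes "1 \<le> p" "p \<le> q" "s * p \<le> real N" "0 < N" "ereal q < critical_exponent N s p"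
  shows "0 < s * p - real N + real N * p / q"
proof (cases "s * p < real N")
  case True
  then have "q < real N * p / (real N - s * p)" using assms(5) by (simp add: critical_exponent_def)
  then have "q * (real N - s * p) < real N * p" using True by (simp add: pos_less_divide_eq)
  then have "real N - s * p < real N * p / q" using assms(1,2) by (simp add: pos_less_divide_eq mult.commute)
  then show ?thesis by simp
next
  case False
  then have "s * p = real N" using assms(3) by simp
  then show ?thesis using assms by simp
qed

lemma lambda_spq_pos:
  fixes \<Omega> :: "'a::euclidean_space set" and s p q C :: real
  assumes "open \<Omega>" "p > 0" "q > 0" "C \<ge> 0"
    and ineq: "\<And>u. u \<in> test_functions \<Omega> \<Longrightarrow>
      (\<integral>\<^sup>+x. ennreal (\<bar>u x\<bar> powr q) \<partial>lborel) \<le> ennreal (C * enn2real (gagliardo s p u) powr (q / p))"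
  shows "0 < lambda_spq s p q \<Omega>"
proof -
  define c where "c = (1 / (C + 1)) powr (p / q)"
  have c: "c > 0" using assms(4) by (simp add: c_def)
  have "ennreal c \<le> gagliardo s p u" if u: "u \<in> test_functions \<Omega>" and n: "Lq_norm q \<Omega> u = 1" for u
  proof -
    obtain m where m: "(\<integral>\<^sup>+x. ennreal (\<bar>u x\<bar> powr q) \<partial>lborel) = ennreal m" "m \<ge> 0"
      using test_functions_Lq_finite[OF u assms(3)] by (cases "\<integral>\<^sup>+x. ennreal (\<bar>u x\<bar> powr q) \<partial>lborel") auto
    have "ennreal (m powr (1 / q)) = 1"
      using n Lq_norm_eq[OF assms(1) test_functions_borel[OF u] assms(3) test_functions_outside[OF u]] m
      by (simp add: ennpowr_ennreal)
    then have "m powr (1 / q) = 1" by simp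
    then have "(m powr (1 / q)) powr q = 1" by simp
    then have "m = 1" using m(2) assms(3) by (simp add: powr_powr)
    define g where "g = enn2real (gagliardo s p u)"
    have g: "g \<ge> 0" by (simp add: g_def)
    have "1 \<le> C * g powr (q / p)"
      using ineq[OF u] m \<open>m = 1\<close> assms(4) by (simp add: g_def)
    also have "\<dots> \<le> (C + 1) * g powr (q / p)" by (intro mult_right_mono) auto
    finally have "1 / (C + 1) \<le> g powr (q / p)" using assms(4) by (simp add: pos_divide_le_eq mult.commute)
    then have "c \<le> (g powr (q / p)) powr (p / q)"
      unfolding c_def using assms by (intro powr_mono2) auto
    also have "\<dots> = g" using g assms by (simp add: powr_powr)
    finally have "ennreal c \<le> ennreal g" by (rule ennreal_leI)
    also have "\<dots> \<le> gagliardo s p u" unfolding g_def by (cases "gagliardo s p u") simp_all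
    finally show ?thesis .
  qed
  then have "ennreal c \<le> lambda_spq s p q \<Omega>" unfolding lambda_spq_def by (intro Inf_greatest) auto
  moreover have "0 < ennreal c" using c by simp
  ultimately show ?thesis by (rule less_le_trans[rotated])
qed

text \<open>The threshold is \<open>1\<close> for \<open>p = 1\<close> and the constant of \<open>deficit_of_small_energy\<close> otherwise. Every
  \<open>\<gamma>\<close> below it admits a larger \<open>\<gamma>'\<close> at which the deficit is bounded below: for \<open>p = 1\<close> the
  midpoint of \<open>\<gamma>\<close> and \<open>1\<close>, otherwise the threshold itself.\<close>

theorem capacitary_inradius_threshold:
  fixes p s :: real
  assumes ps: "1 \<le> p" "0 < s" "s < 1" and sp: "s * p \<le> real DIM('a::euclidean_space)"
  shows "\<exists>\<gamma>\<^sub>0::real. 0 < \<gamma>\<^sub>0 \<and> \<gamma>\<^sub>0 \<le> 1 \<and> (p = 1 \<longrightarrow> \<gamma>\<^sub>0 = 1) \<and>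
    (\<forall>q \<gamma>. p \<le> q \<and> ereal q < critical_exponent DIM('a) s p \<and> 0 < \<gamma> \<and> \<gamma> < \<gamma>\<^sub>0 \<longrightarrow>
       (\<exists>C>0. \<forall>\<Omega>::'a set. open \<Omega> \<longrightarrow>
          lambda_spq s p q \<Omega> \<le> ennreal C *
            ennpowr (1 / cap_inradius s p \<gamma> \<Omega>) (s * p - real DIM('a) + real DIM('a) * p / q))) \<and>
    (\<forall>q. \<forall>\<Omega>::'a set. p \<le> q \<and> ereal q < critical_exponent DIM('a) s p \<and> open \<Omega> \<longrightarrow>
       (D0_embeds s p q \<Omega> \<longleftrightarrow>
         (\<exists>\<gamma>. 0 < \<gamma> \<and> \<gamma> < \<gamma>\<^sub>0 \<and> cap_inradius s p \<gamma> \<Omega> < \<infinity>)))"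
proof -
  define deficit where "deficit \<gamma> \<kappa> \<delta> \<longleftrightarrow> (\<forall>\<psi> :: 'a \<Rightarrow> real. \<psi> \<in> test_functions (ball 0 2) \<longrightarrow> (\<forall>x. 0 \<le> \<psi> x) \<longrightarrow>
      (\<forall>x. \<psi> x \<le> 1) \<longrightarrow> gagliardo s p \<psi> \<le> ennreal (\<gamma> * \<kappa>) \<longrightarrow> ennreal \<delta> \<le> ball_deficit \<psi>)" for \<gamma> \<kappa> \<delta> :: real
  obtain \<kappa> where \<kappa>: "\<kappa> > 0" "frac_cap s p (cball (0::'a) 1) (ball 0 2) = ennreal \<kappa>"
  proof -
    obtain k where "k > 0" "\<And>x::'a. ennreal k \<le> frac_cap s p (cball x 1) (ball x (2 * 1))"
      using frac_cap_ball_lower_bound[OF ps(1,2), of 1, where 'a='a] by auto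
    then have "0 < k" "ennreal k \<le> frac_cap s p (cball (0::'a) 1) (ball 0 2)" by (metis mult_1_right)+
    moreover have "frac_cap s p (cball (0::'a) 1) (ball 0 2) < \<infinity>"
      using frac_cap_ball_finite[OF ps, of 1 "0::'a"] by simp
    ultimately show ?thesis
      using that by (cases "frac_cap s p (cball (0::'a) 1) (ball 0 2)") (auto simp: ennreal_le_iff)
  qed
  obtain \<gamma>0 where \<gamma>0: "0 < \<gamma>0" "\<gamma>0 \<le> 1" "p = 1 \<Longrightarrow> \<gamma>0 = 1"
    and def: "\<And>\<gamma>. 0 < \<gamma> \<Longrightarrow> \<gamma> < \<gamma>0 \<Longrightarrow> \<exists>\<gamma>'>\<gamma>. \<exists>\<delta>>0. deficit \<gamma>' \<kappa> \<delta>"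
  proof (cases "p = 1")
    case True
    have "\<exists>\<gamma>'>\<gamma>. \<exists>\<delta>>0. deficit \<gamma>' \<kappa> \<delta>" if "0 < \<gamma>" "\<gamma> < 1" for \<gamma>
    proof -
      have *: "0 < (1 + \<gamma>) / 2" "(1 + \<gamma>) / 2 < 1" "\<gamma> < (1 + \<gamma>) / 2" using that by auto
      obtain \<delta> where "\<delta> > 0" "deficit ((1 + \<gamma>) / 2) \<kappa> \<delta>"
        using deficit_of_energy_below_capacity[OF ps(2,3) \<kappa>(1) *(1,2) \<kappa>(2)[unfolded True]]
        unfolding deficit_def True by metis
      then show ?thesis using *(3) by blast
    qed
    then show ?thesis using that[of 1] by simp
  next
    case False
    obtain \<gamma>0 \<delta> where g: "0 < \<gamma>0" "\<gamma>0 \<le> 1" "\<delta> > 0" "deficit \<gamma>0 \<kappa> \<delta>"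
      using deficit_of_small_energy[OF ps(1,2) \<kappa>(1)] unfolding deficit_def by metis
    then have "\<exists>\<gamma>'>\<gamma>. \<exists>\<delta>>0. deficit \<gamma>' \<kappa> \<delta>" if "\<gamma> < \<gamma>0" for \<gamma> using that by blast
    then show ?thesis using that[of \<gamma>0] g False by simp
  qed
  have upper: "\<exists>C>0. \<forall>\<Omega>::'a set. open \<Omega> \<longrightarrow> lambda_spq s p q \<Omega> \<le> ennreal C *
      ennpowr (1 / cap_inradius s p \<gamma> \<Omega>) (s * p - real DIM('a) + real DIM('a) * p / q)"
    if q: "p \<le> q" "ereal q < critical_exponent DIM('a) s p" and \<gamma>: "0 < \<gamma>" "\<gamma> < \<gamma>0" for q \<gamma>
  proof -
    have a: "0 < s * p - real DIM('a) + real DIM('a) * p / q"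
      by (rule subcritical_exponent_pos[OF ps(1) q(1) sp _ q(2)]) simp
    obtain \<gamma>' \<delta> where d: "\<gamma> < \<gamma>'" "\<delta> > 0" "deficit \<gamma>' \<kappa> \<delta>" using def[OF \<gamma>] by blast
    show ?thesis
    proof (rule upper_bound_from_deficit[OF ps q(1) a \<gamma>(1) d(1,2) \<kappa>])
      show "ennreal \<delta> \<le> ball_deficit \<psi>"
        if "\<psi> \<in> test_functions (ball 0 2)" "\<And>x. 0 \<le> \<psi> x" "\<And>x. \<psi> x \<le> 1" "gagliardo s p \<psi> \<le> ennreal (\<gamma>' * \<kappa>)" for \<psi> :: "'a \<Rightarrow> real"
        using d(3) that unfolding deficit_def by blast
      show ?thesis if "C > 0" "\<And>\<Omega>::'a set. open \<Omega> \<Longrightarrow> lambda_spq s p q \<Omega> \<le> ennreal C *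
          ennpowr (1 / cap_inradius s p \<gamma> \<Omega>) (s * p - real DIM('a) + real DIM('a) * p / q)" for C
        using that by blast
    qed
  qed
  have equiv: "D0_embeds s p q \<Omega> \<longleftrightarrow> (\<exists>\<gamma>. 0 < \<gamma> \<and> \<gamma> < \<gamma>0 \<and> cap_inradius s p \<gamma> \<Omega> < \<infinity>)"
    if q: "p \<le> q" "ereal q < critical_exponent DIM('a) s p" and "open \<Omega>" for q and \<Omega> :: "'a set"
  proof -
    interpret completion s p \<Omega> by standard (use ps \<open>open \<Omega>\<close> in auto)
    have a: "0 < s * p - real DIM('a) + real DIM('a) * p / q"
      by (rule subcritical_exponent_pos[OF ps(1) q(1) sp _ q(2)]) simp
    have q0: "q > 0" "q \<ge> 1" using ps q by auto
    show ?thesis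
    proof
      assume "D0_embeds s p q \<Omega>"
      then obtain K where K: "K \<ge> 0" "\<And>u. u \<in> test_functions \<Omega> \<Longrightarrow>
          (\<integral>\<^sup>+x. ennreal (\<bar>u x\<bar> powr q) \<partial>lborel) \<le> ennreal (K * enn2real (gagliardo s p u) powr (q / p))"
        using inequality_if_embedding[OF q0(1)] by blast
      have pos: "0 < lambda_spq s p q \<Omega>"
        by (rule lambda_spq_pos[OF \<open>open \<Omega>\<close> p_pos q0(1) K])
      have \<gamma>: "0 < \<gamma>0 / 2" "\<gamma>0 / 2 < \<gamma>0" using \<gamma>0(1) by auto
      obtain C where C: "lambda_spq s p q \<Omega> \<le> ennreal C *
          ennpowr (1 / cap_inradius s p (\<gamma>0 / 2) \<Omega>) (s * p - real DIM('a) + real DIM('a) * p / q)"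
        using upper[OF q \<gamma>] \<open>open \<Omega>\<close> by blast
      have "cap_inradius s p (\<gamma>0 / 2) \<Omega> \<noteq> \<infinity>"
      proof
        assume inf: "cap_inradius s p (\<gamma>0 / 2) \<Omega> = \<infinity>"
        have "ennpowr (1 / (\<infinity>::ennreal)) (s * p - real DIM('a) + real DIM('a) * p / q) = 0"
          by (simp add: ennpowr_def)
        with C have "lambda_spq s p q \<Omega> \<le> 0" unfolding inf by simp
        then show False using pos by simp
      qed
      then have "cap_inradius s p (\<gamma>0 / 2) \<Omega> < \<infinity>" by (simp add: less_top)
      then show "\<exists>\<gamma>. 0 < \<gamma> \<and> \<gamma> < \<gamma>0 \<and> cap_inradius s p \<gamma> \<Omega> < \<infinity>" using \<gamma> by blast
    next
      assume "\<exists>\<gamma>. 0 < \<gamma> \<and> \<gamma> < \<gamma>0 \<and> cap_inradius s p \<gamma> \<Omega> < \<infinity>"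
      then obtain \<gamma> where \<gamma>: "0 < \<gamma>" "cap_inradius s p \<gamma> \<Omega> < \<infinity>" by blast
      obtain C where C: "C \<ge> 0" "\<And>u. u \<in> test_functions \<Omega> \<Longrightarrow>
          (\<integral>\<^sup>+x. ennreal (\<bar>u x\<bar> powr q) \<partial>lborel) \<le> ennreal (C * enn2real (gagliardo s p u) powr (q / p))"
        using Lq_le_gagliardo_if_inradius_finite[OF ps q(1) a \<gamma>(1) \<open>open \<Omega>\<close> \<gamma>(2)] by blast
      interpret completion_inequality s p \<Omega> q C by standard (use q0 C in auto)
      show "D0_embeds s p q \<Omega>" by (rule embedding_if_inequality)
    qed
  qed
  show ?thesis
    using \<gamma>0 upper equiv by (intro exI[of _ \<gamma>0]) simp
qed

theorem corollary1p7:
  fixes p s :: real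
  assumes "1 \<le> p" and "0 < s" and "s < 1" and "s * p \<le> real CARD('n::finite)"
  shows "\<exists>\<gamma>\<^sub>0::real. 0 < \<gamma>\<^sub>0 \<and> \<gamma>\<^sub>0 \<le> 1 \<and> (p = 1 \<longrightarrow> \<gamma>\<^sub>0 = 1) \<and>
    (\<forall>q \<gamma>. p \<le> q \<and> ereal q < critical_exponent CARD('n) s p \<and> 0 < \<gamma> \<and> \<gamma> < \<gamma>\<^sub>0 \<longrightarrow>
       (\<exists>C>0. \<forall>\<Omega>::(real^'n) set. open \<Omega> \<longrightarrow>
          lambda_spq s p q \<Omega> \<le> ennreal C *
            ennpowr (1 / cap_inradius s p \<gamma> \<Omega>)
              (s * p - real CARD('n) + real CARD('n) * p / q))) \<and>
    (\<forall>q. \<forall>\<Omega>::(real^'n) set. p \<le> q \<and> ereal q < critical_exponent CARD('n) s p \<and> open \<Omega> \<longrightarrow>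
       (D0_embeds s p q \<Omega> \<longleftrightarrow>
         (\<exists>\<gamma>. 0 < \<gamma> \<and> \<gamma> < \<gamma>\<^sub>0 \<and> cap_inradius s p \<gamma> \<Omega> < \<infinity>)))"
proof -
  have dim: "DIM(real^'n) = CARD('n)" by simp
  have "s * p \<le> real DIM(real^'n)" using assms(4) by (simp only: dim)
  from capacitary_inradius_threshold[OF assms(1-3) this] show ?thesis
    unfolding dim .
qed

end
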